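(* Let $d\ge 0$ and let $X\times \mathbb{Z}^d\to X$ be a proper (continuous, right) action of the discrete group $\mathbb{Z}^d$ on a locally compact Hausdorff space $X$, with quotient map $\pi\colon X\to X/\mathbb{Z}^d$. Let $\mathcal{F}$ be a $\mathbb{Z}^d$-equivariant sheaf of abelian groups on $X$ which is $\mathrm{Supp}(\mathrm{c}\mathbb{Z}^d)$-soft, where $$\mathrm{c}\mathbb{Z}^d:=\{K\mathbb{Z}^d\ :\ K\subseteq X\text{ compact}\}.$$ Then, for the group cohomology of $\mathbb{Z}^d$ with coefficients in the $\mathbb{Z}^d$-module $\Gamma_{\mathrm{c}}(\mathcal{F})$ of compactly supported global sections, $$H^p\left(\mathbb{Z}^d,\ \Gamma_{\mathrm{c}}(X,\mathcal{F})\right)\cong\begin{cases}\Gamma_{\mathrm{c}}\left(X/\mathbb{Z}^d,\ \mathcal{F}/\mathbb{Z}^d\right)&\text{if }p=d,\\ 0&\text{otherwise.}\end{cases}$$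
   Context: An action $X\times G\to X$ of a locally compact group is proper if the map $X\times G\to X\times X$, $(x,g)\mapsto(xg,x)$ is proper (closed with compact fibers); on a locally compact Hausdorff space this is equivalent to: for all $x,x'\in X$ there are neighborhoods $V_x\ni x$, $V_{x'}\ni x'$ such that $\{g\in G: V_xg\cap V_{x'}\neq\emptyset\}$ is relatively compact. A $G$-equivariant sheaf carries a compatible action of $G$, so $G$ acts on its section spaces. A family of supports on $X$ is a family of closed subsets closed under finite unions and under passing to closed subsets; for a family $\Theta$ of closed sets, $\mathrm{Supp}(\Theta)$ is the family of supports it generates. For a family of supports $\Phi$, a sheaf is $\Phi$-soft if every section over any member of $\Phi$ extends to a global section; $\Gamma_\Phi$ denotes sections with support in $\Phi$, and $\Gamma_{\mathrm{c}}$ compactly supported sections. The sheaf of invariants $\mathcal{F}/G:=(\pi_*\mathcal{F})^G$ on $X/G$ has as sections over $U\subseteq X/G$ the $G$-invariant sections of $\mathcal{F}$ over $\pi^{-1}(U)$. *)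

theory Defs
  imports "HOL-Analysis.Analysis" "HOL-Algebra.Algebra"
begin

definition Zd :: "nat \<Rightarrow> (nat \<Rightarrow> int) set" where
  "Zd d = {g. \<forall>i\<ge>d. g i = 0}"

definition vadd :: "(nat \<Rightarrow> int) \<Rightarrow> (nat \<Rightarrow> int) \<Rightarrow> (nat \<Rightarrow> int)" where
  "vadd g h = (\<lambda>i. g i + h i)"

definition vneg :: "(nat \<Rightarrow> int) \<Rightarrow> (nat \<Rightarrow> int)" where
  "vneg g = (\<lambda>i. - g i)"

definition vzero :: "nat \<Rightarrow> int" where
  "vzero = (\<lambda>i. 0)"

definition right_action ::
  "'a topology \<Rightarrow> nat \<Rightarrow> ('a \<Rightarrow> (nat \<Rightarrow> int) \<Rightarrow> 'a) \<Rightarrow> bool" where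
  "right_action Xs d act \<longleftrightarrow>
     continuous_map (prod_topology Xs (discrete_topology (Zd d))) Xs (\<lambda>(x, g). act x g) \<and>
     (\<forall>x\<in>topspace Xs. act x vzero = x) \<and>
     (\<forall>x\<in>topspace Xs. \<forall>g\<in>Zd d. \<forall>h\<in>Zd d. act (act x g) h = act x (vadd g h))"

definition proper_action ::
  "'a topology \<Rightarrow> nat \<Rightarrow> ('a \<Rightarrow> (nat \<Rightarrow> int) \<Rightarrow> 'a) \<Rightarrow> bool" where
  "proper_action Xs d act \<longleftrightarrow>
     right_action Xs d act \<and>
     proper_map (prod_topology Xs (discrete_topology (Zd d))) (prod_topology Xs Xs)
        (\<lambda>(x, g). (act x g, x))"

text \<open>A sheaf of abelian groups on Xs is given by its etale space E with projection p,
  a local homeomorphism onto Xs, with continuous fibrewise abelian group operations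
  (addition eadd, zero section zer, negation neg).\<close>

definition etale_sheaf ::
  "'a topology \<Rightarrow> 'e topology \<Rightarrow> ('e \<Rightarrow> 'a) \<Rightarrow> ('e \<Rightarrow> 'e \<Rightarrow> 'e) \<Rightarrow> ('a \<Rightarrow> 'e)
     \<Rightarrow> ('e \<Rightarrow> 'e) \<Rightarrow> bool" where
  "etale_sheaf Xs E p eadd zer neg \<longleftrightarrow>
     continuous_map E Xs p \<and> p ` topspace E = topspace Xs \<and>
     (\<forall>e\<in>topspace E. \<exists>U. openin E U \<and> e \<in> U \<and> openin Xs (p ` U) \<and>
         homeomorphic_map (subtopology E U) (subtopology Xs (p ` U)) p) \<and>
     continuous_map Xs E zer \<and> (\<forall>x\<in>topspace Xs. p (zer x) = x) \<and>
     continuous_map E E neg \<and> (\<forall>e\<in>topspace E. p (neg e) = p e) \<and>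
     continuous_map (subtopology (prod_topology E E)
                       {(e, f). e \<in> topspace E \<and> f \<in> topspace E \<and> p e = p f})
                    E (\<lambda>(e, f). eadd e f) \<and>
     (\<forall>e\<in>topspace E. \<forall>f\<in>topspace E. p e = p f \<longrightarrow> p (eadd e f) = p e) \<and>
     (\<forall>e\<in>topspace E. \<forall>f\<in>topspace E. \<forall>k\<in>topspace E. p e = p f \<and> p f = p k \<longrightarrow>
         eadd (eadd e f) k = eadd e (eadd f k)) \<and>
     (\<forall>e\<in>topspace E. \<forall>f\<in>topspace E. p e = p f \<longrightarrow> eadd e f = eadd f e) \<and>
     (\<forall>e\<in>topspace E. eadd (zer (p e)) e = e) \<and>
     (\<forall>e\<in>topspace E. eadd (neg e) e = zer (p e))"

definition equivariant_sheaf ::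
  "'a topology \<Rightarrow> nat \<Rightarrow> ('a \<Rightarrow> (nat \<Rightarrow> int) \<Rightarrow> 'a) \<Rightarrow> 'e topology \<Rightarrow> ('e \<Rightarrow> 'a)
     \<Rightarrow> ('e \<Rightarrow> 'e \<Rightarrow> 'e) \<Rightarrow> ('a \<Rightarrow> 'e) \<Rightarrow> ('e \<Rightarrow> 'e) \<Rightarrow> ('e \<Rightarrow> (nat \<Rightarrow> int) \<Rightarrow> 'e) \<Rightarrow> bool" where
  "equivariant_sheaf Xs d act E p eadd zer neg tau \<longleftrightarrow>
     etale_sheaf Xs E p eadd zer neg \<and>
     continuous_map (prod_topology E (discrete_topology (Zd d))) E (\<lambda>(e, g). tau e g) \<and>
     (\<forall>e\<in>topspace E. \<forall>g\<in>Zd d. p (tau e g) = act (p e) g) \<and>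
     (\<forall>e\<in>topspace E. tau e vzero = e) \<and>
     (\<forall>e\<in>topspace E. \<forall>g\<in>Zd d. \<forall>h\<in>Zd d. tau (tau e g) h = tau e (vadd g h)) \<and>
     (\<forall>e\<in>topspace E. \<forall>f\<in>topspace E. \<forall>g\<in>Zd d. p e = p f \<longrightarrow>
         tau (eadd e f) g = eadd (tau e g) (tau f g))"

definition section_on ::
  "'a topology \<Rightarrow> 'e topology \<Rightarrow> ('e \<Rightarrow> 'a) \<Rightarrow> 'a set \<Rightarrow> ('a \<Rightarrow> 'e) \<Rightarrow> bool" where
  "section_on Xs E p S s \<longleftrightarrow> continuous_map (subtopology Xs S) E s \<and> (\<forall>x\<in>S. p (s x) = x)"

definition global_sections ::
  "'a topology \<Rightarrow> 'e topology \<Rightarrow> ('e \<Rightarrow> 'a) \<Rightarrow> ('a \<Rightarrow> 'e) \<Rightarrow> ('a \<Rightarrow> 'e) set" where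
  "global_sections Xs E p zer =
     {s. section_on Xs E p (topspace Xs) s \<and> (\<forall>x. x \<notin> topspace Xs \<longrightarrow> s x = zer x)}"

definition supp :: "'a topology \<Rightarrow> ('a \<Rightarrow> 'e) \<Rightarrow> ('a \<Rightarrow> 'e) \<Rightarrow> 'a set" where
  "supp Xs zer s = {x \<in> topspace Xs. s x \<noteq> zer x}"

definition Gamma_c ::
  "'a topology \<Rightarrow> 'e topology \<Rightarrow> ('e \<Rightarrow> 'a) \<Rightarrow> ('a \<Rightarrow> 'e) \<Rightarrow> ('a \<Rightarrow> 'e) set" where
  "Gamma_c Xs E p zer = {s \<in> global_sections Xs E p zer. compactin Xs (supp Xs zer s)}"

definition family_of_supports :: "'a topology \<Rightarrow> 'a set set \<Rightarrow> bool" where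
  "family_of_supports Xs \<Phi> \<longleftrightarrow>
     (\<forall>C\<in>\<Phi>. closedin Xs C) \<and> {} \<in> \<Phi> \<and>
     (\<forall>A\<in>\<Phi>. \<forall>B\<in>\<Phi>. A \<union> B \<in> \<Phi>) \<and>
     (\<forall>A\<in>\<Phi>. \<forall>B. closedin Xs B \<and> B \<subseteq> A \<longrightarrow> B \<in> \<Phi>)"

definition Supp :: "'a topology \<Rightarrow> 'a set set \<Rightarrow> 'a set set" where
  "Supp Xs \<Theta> = \<Inter>{\<Phi>. family_of_supports Xs \<Phi> \<and> \<Theta> \<subseteq> \<Phi>}"

definition cZd :: "'a topology \<Rightarrow> nat \<Rightarrow> ('a \<Rightarrow> (nat \<Rightarrow> int) \<Rightarrow> 'a) \<Rightarrow> 'a set set" where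
  "cZd Xs d act = {(\<Union>g\<in>Zd d. (\<lambda>x. act x g) ` K) | K. compactin Xs K}"

definition soft_wrt ::
  "'a topology \<Rightarrow> 'e topology \<Rightarrow> ('e \<Rightarrow> 'a) \<Rightarrow> 'a set set \<Rightarrow> bool" where
  "soft_wrt Xs E p \<Phi> \<longleftrightarrow>
     (\<forall>C\<in>\<Phi>. \<forall>s. section_on Xs E p C s \<longrightarrow>
        (\<exists>t. section_on Xs E p (topspace Xs) t \<and> (\<forall>x\<in>C. t x = s x)))"

definition sec_add :: "'a topology \<Rightarrow> ('e \<Rightarrow> 'e \<Rightarrow> 'e) \<Rightarrow> ('a \<Rightarrow> 'e)
     \<Rightarrow> ('a \<Rightarrow> 'e) \<Rightarrow> ('a \<Rightarrow> 'e) \<Rightarrow> ('a \<Rightarrow> 'e)" where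
  "sec_add Xs eadd zer s t = (\<lambda>x. if x \<in> topspace Xs then eadd (s x) (t x) else zer x)"

definition sec_act :: "'a topology \<Rightarrow> ('a \<Rightarrow> (nat \<Rightarrow> int) \<Rightarrow> 'a)
     \<Rightarrow> ('e \<Rightarrow> (nat \<Rightarrow> int) \<Rightarrow> 'e) \<Rightarrow> ('a \<Rightarrow> 'e) \<Rightarrow> (nat \<Rightarrow> int) \<Rightarrow> ('a \<Rightarrow> 'e) \<Rightarrow> ('a \<Rightarrow> 'e)" where
  "sec_act Xs act tau zer g s =
     (\<lambda>x. if x \<in> topspace Xs then tau (s (act x (vneg g))) g else zer x)"

definition Gamma_c_grp :: "'a topology \<Rightarrow> 'e topology \<Rightarrow> ('e \<Rightarrow> 'a) \<Rightarrow> ('e \<Rightarrow> 'e \<Rightarrow> 'e)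
     \<Rightarrow> ('a \<Rightarrow> 'e) \<Rightarrow> ('a \<Rightarrow> 'e) monoid" where
  "Gamma_c_grp Xs E p eadd zer =
     \<lparr>carrier = Gamma_c Xs E p zer, mult = sec_add Xs eadd zer, one = zer\<rparr>"

definition valid_tuple :: "nat \<Rightarrow> nat \<Rightarrow> (nat \<Rightarrow> int) list \<Rightarrow> bool" where
  "valid_tuple d n gs \<longleftrightarrow> length gs = n \<and> set gs \<subseteq> Zd d"

definition cochains :: "nat \<Rightarrow> ('m, 'b) monoid_scheme \<Rightarrow> nat \<Rightarrow> ((nat \<Rightarrow> int) list \<Rightarrow> 'm) set" where
  "cochains d M n = {f. (\<forall>gs. valid_tuple d n gs \<longrightarrow> f gs \<in> carrier M) \<and>
                         (\<forall>gs. \<not> valid_tuple d n gs \<longrightarrow> f gs = \<one>\<^bsub>M\<^esub>)}"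

definition cochain_grp :: "nat \<Rightarrow> ('m, 'b) monoid_scheme \<Rightarrow> nat \<Rightarrow> ((nat \<Rightarrow> int) list \<Rightarrow> 'm) monoid" where
  "cochain_grp d M n =
     \<lparr>carrier = cochains d M n, mult = (\<lambda>f h gs. f gs \<otimes>\<^bsub>M\<^esub> h gs), one = (\<lambda>gs. \<one>\<^bsub>M\<^esub>)\<rparr>"

text \<open>merge i gs (1 <= i < length gs) replaces the entries g_i, g_(i+1) by g_i + g_(i+1).\<close>

definition merge :: "nat \<Rightarrow> (nat \<Rightarrow> int) list \<Rightarrow> (nat \<Rightarrow> int) list" where
  "merge i gs = take (i - 1) gs @ [vadd (gs ! (i - 1)) (gs ! i)] @ drop (i + 1) gs"

definition coboundary :: "nat \<Rightarrow> ('m, 'b) monoid_scheme \<Rightarrow> ((nat \<Rightarrow> int) \<Rightarrow> 'm \<Rightarrow> 'm)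
     \<Rightarrow> nat \<Rightarrow> ((nat \<Rightarrow> int) list \<Rightarrow> 'm) \<Rightarrow> ((nat \<Rightarrow> int) list \<Rightarrow> 'm)" where
  "coboundary d M ma n f = (\<lambda>gs.
     if valid_tuple d (Suc n) gs then
       ma (hd gs) (f (tl gs)) \<otimes>\<^bsub>M\<^esub>
       (finprod M (\<lambda>i. f (merge i gs) [^]\<^bsub>M\<^esub> ((-1::int) ^ i)) {1..n}) \<otimes>\<^bsub>M\<^esub>
       (f (take n gs) [^]\<^bsub>M\<^esub> ((-1::int) ^ Suc n))
     else \<one>\<^bsub>M\<^esub>)"

definition cocycles :: "nat \<Rightarrow> ('m, 'b) monoid_scheme \<Rightarrow> ((nat \<Rightarrow> int) \<Rightarrow> 'm \<Rightarrow> 'm)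
     \<Rightarrow> nat \<Rightarrow> ((nat \<Rightarrow> int) list \<Rightarrow> 'm) set" where
  "cocycles d M ma n = {f \<in> cochains d M n. coboundary d M ma n f = (\<lambda>gs. \<one>\<^bsub>M\<^esub>)}"

definition coboundaries :: "nat \<Rightarrow> ('m, 'b) monoid_scheme \<Rightarrow> ((nat \<Rightarrow> int) \<Rightarrow> 'm \<Rightarrow> 'm)
     \<Rightarrow> nat \<Rightarrow> ((nat \<Rightarrow> int) list \<Rightarrow> 'm) set" where
  "coboundaries d M ma n =
     (if n = 0 then {(\<lambda>gs. \<one>\<^bsub>M\<^esub>)}
      else coboundary d M ma (n - 1) ` cochains d M (n - 1))"

definition group_cohomology :: "nat \<Rightarrow> ('m, 'b) monoid_scheme \<Rightarrow> ((nat \<Rightarrow> int) \<Rightarrow> 'm \<Rightarrow> 'm)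
     \<Rightarrow> nat \<Rightarrow> ((nat \<Rightarrow> int) list \<Rightarrow> 'm) set monoid" where
  "group_cohomology d M ma n =
     ((cochain_grp d M n)\<lparr>carrier := cocycles d M ma n\<rparr>) Mod (coboundaries d M ma n)"

definition orbit :: "nat \<Rightarrow> ('a \<Rightarrow> (nat \<Rightarrow> int) \<Rightarrow> 'a) \<Rightarrow> 'a \<Rightarrow> 'a set" where
  "orbit d act x = (\<lambda>g. act x g) ` Zd d"

definition quotient_space :: "'a topology \<Rightarrow> nat \<Rightarrow> ('a \<Rightarrow> (nat \<Rightarrow> int) \<Rightarrow> 'a) \<Rightarrow> 'a set topology" where
  "quotient_space Xs d act =
     topology (\<lambda>U. U \<subseteq> orbit d act ` topspace Xs \<and>
                   openin Xs {x \<in> topspace Xs. orbit d act x \<in> U})"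

text \<open>Sections of F/Z^d over an open V of Xs/Z^d are the invariant sections of F over
  pi^-1(V); a global section of F/Z^d is thus an invariant global section s of F.
  Its support in Xs/Z^d is the set of orbits y at which its germ is non-zero, i.e. such
  that s does not vanish on pi^-1(W) for any open neighbourhood W of y.\<close>

definition quotient_supp :: "'a topology \<Rightarrow> nat \<Rightarrow> ('a \<Rightarrow> (nat \<Rightarrow> int) \<Rightarrow> 'a)
     \<Rightarrow> ('a \<Rightarrow> 'e) \<Rightarrow> ('a \<Rightarrow> 'e) \<Rightarrow> 'a set set" where
  "quotient_supp Xs d act zer s =
     {y \<in> topspace (quotient_space Xs d act).
        \<forall>W. openin (quotient_space Xs d act) W \<and> y \<in> W \<longrightarrow>
            \<not> (\<forall>x\<in>topspace Xs. orbit d act x \<in> W \<longrightarrow> s x = zer x)}"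

definition Gamma_c_quot :: "'a topology \<Rightarrow> nat \<Rightarrow> ('a \<Rightarrow> (nat \<Rightarrow> int) \<Rightarrow> 'a)
     \<Rightarrow> 'e topology \<Rightarrow> ('e \<Rightarrow> 'a) \<Rightarrow> ('a \<Rightarrow> 'e) \<Rightarrow> ('e \<Rightarrow> (nat \<Rightarrow> int) \<Rightarrow> 'e) \<Rightarrow> ('a \<Rightarrow> 'e) set" where
  "Gamma_c_quot Xs d act E p zer tau =
     {s \<in> global_sections Xs E p zer.
        (\<forall>g\<in>Zd d. sec_act Xs act tau zer g s = s) \<and>
        compactin (quotient_space Xs d act) (quotient_supp Xs d act zer s)}"

definition Gamma_c_quot_grp :: "'a topology \<Rightarrow> nat \<Rightarrow> ('a \<Rightarrow> (nat \<Rightarrow> int) \<Rightarrow> 'a)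
     \<Rightarrow> 'e topology \<Rightarrow> ('e \<Rightarrow> 'a) \<Rightarrow> ('e \<Rightarrow> 'e \<Rightarrow> 'e) \<Rightarrow> ('a \<Rightarrow> 'e)
     \<Rightarrow> ('e \<Rightarrow> (nat \<Rightarrow> int) \<Rightarrow> 'e) \<Rightarrow> ('a \<Rightarrow> 'e) monoid" where
  "Gamma_c_quot_grp Xs d act E p eadd zer tau =
     \<lparr>carrier = Gamma_c_quot Xs d act E p zer tau, mult = sec_add Xs eadd zer, one = zer\<rparr>"

end

theory Submission
  imports Defs
begin

text \<open>
  For \<open>S \<subseteq> \<int>\<^sup>d\<close> consider the sections supported in \<open>K S\<close> for some compact \<open>K\<close>. If \<open>S\<close> is a half
  space in \<open>\<int>\<^sup>k\<^sup>+\<^sup>1\<close>, bounded below or above in its last coordinate, then \<open>1 - t\<close> is bijective on these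
  sections for the corresponding generator \<open>t\<close> (properness makes the geometric series locally finite);
  as \<open>t\<close> acts trivially on cohomology, all cohomology vanishes. By softness every section
  supported in \<open>K \<int>\<^sup>k\<^sup>+\<^sup>1\<close> is a difference of sections of the two half-space types, and by properness
  the two types intersect in the sections supported in \<open>K \<int>\<^sup>k\<close>. Mayer--Vietoris thus identifies
  the cohomology of the latter with that of the former, one degree lower. After \<open>d\<close> steps
  \<open>H\<^sup>d(\<int>\<^sup>d, \<Gamma>\<^sub>c)\<close> becomes the group of invariant sections with support in some \<open>K \<int>\<^sup>d\<close>, and in degrees
  \<open>n < d\<close> one is left with the invariants of a generator acting without fixed points. Degrees above
  \<open>d\<close> vanish for every module: \<open>M\<close> is the last stage of a chain of function modules, each the kernel
  of a surjective difference operator on the next, that ends in a coinduced module.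
\<close>

text \<open>Modules are multiplicative in the code and additive in the comments. Half spaces are not
  invariant under the group, yet they define submodules: since the group is commutative,
  \<open>K S\<close> translated by \<open>g\<close> is \<open>(K g) S\<close>, so the action moves
  only the compact set. Hence all cohomology can be taken over the whole group while the support
  condition alone is filtered. The shift compares degree n of the compactly supported sections with
  degree n - d of the sections supported in some \<open>K Z^d\<close>. It does not say that the
  latter vanishes in positive degrees, which is why degrees above d need an argument of their own.
  Modules are records with a carrier, where alternating sums are awkward. The bar complex is
  therefore computed once with formal chains in a free abelian group, whose generator (a, l) stands
  for a acting on f(l). Every module receives the identities by evaluation.\<close>

lemma vadd_assoc: "vadd (vadd a b) c = vadd a (vadd b c)"
  by (simp add: vadd_def add.assoc)

lemma vadd_commute: "vadd a b = vadd b a"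
  by (simp add: vadd_def add.commute)

lemma vadd_left_commute: "vadd a (vadd b c) = vadd b (vadd a c)"
  by (simp add: vadd_def add.left_commute)

lemmas vadd_ac = vadd_assoc vadd_commute vadd_left_commute

lemma vadd_vzero [simp]: "vadd vzero a = a" "vadd a vzero = a"
  by (simp_all add: vadd_def vzero_def)

lemma vadd_vneg [simp]: "vadd a (vneg a) = vzero" "vadd (vneg a) a = vzero"
  by (simp_all add: vadd_def vzero_def vneg_def)

lemma vneg_vneg [simp]: "vneg (vneg a) = a"
  by (simp add: vneg_def)

lemma vneg_vzero [simp]: "vneg vzero = vzero"
  by (simp add: vneg_def vzero_def)

lemma vneg_vadd: "vneg (vadd a b) = vadd (vneg a) (vneg b)"
  by (simp add: vneg_def vadd_def)

lemma Zd_vzero [simp]: "vzero \<in> Zd d"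
  and Zd_vadd [simp]: "a \<in> Zd d \<Longrightarrow> b \<in> Zd d \<Longrightarrow> vadd a b \<in> Zd d"
  and Zd_vneg [simp]: "a \<in> Zd d \<Longrightarrow> vneg a \<in> Zd d"
  by (simp_all add: Zd_def vzero_def vadd_def vneg_def)

subsection \<open>The bar differential\<close>

text \<open>Here \<open>\<phi> a gs\<close> stands for \<open>a \<cdot> f gs\<close> with \<open>f\<close> an inhomogeneous cochain.
  Recursion on the tuple turns the usual index bookkeeping into rewriting.\<close>

fun bar_tail :: "('g \<Rightarrow> (nat \<Rightarrow> int) list \<Rightarrow> 'b) \<Rightarrow> 'g \<Rightarrow> (nat \<Rightarrow> int) list \<Rightarrow> 'b::ab_group_add" where
  "bar_tail \<phi> a [] = 0"
| "bar_tail \<phi> a [g] = - \<phi> a []"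
| "bar_tail \<phi> a (g # h # r) = - \<phi> a (vadd g h # r) - bar_tail (\<lambda>a l. \<phi> a (g # l)) a (h # r)"

fun bar_diff :: "((nat \<Rightarrow> int) \<Rightarrow> (nat \<Rightarrow> int) list \<Rightarrow> 'b) \<Rightarrow> (nat \<Rightarrow> int) \<Rightarrow> (nat \<Rightarrow> int) list
    \<Rightarrow> 'b::ab_group_add" where
  "bar_diff \<phi> a [] = 0"
| "bar_diff \<phi> a (g # r) = \<phi> (vadd a g) r + bar_tail \<phi> a (g # r)"

text \<open>The differential of the cochain with \<open>g\<close> put in front has a leading term
  \<open>\<phi> (vadd a h) (g # r)\<close> that the recursion of \<open>bar_tail\<close> lacks.
  Adding it back yields a recursion in \<open>bar_diff\<close> alone, as the inductions
  need.\<close>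

lemma bar_diff_Cons2:
  "bar_diff \<phi> a (g # h # r) = \<phi> (vadd a g) (h # r) - \<phi> a (vadd g h # r) + \<phi> (vadd a h) (g # r)
     - bar_diff (\<lambda>a l. \<phi> a (g # l)) a (h # r)"
  by simp

lemma bar_tail_cong:
  "(\<And>l. Suc (length l) = length gs \<Longrightarrow> \<phi> a l = \<psi> a l) \<Longrightarrow> bar_tail \<phi> a gs = bar_tail \<psi> a gs"
  by (induction \<phi> a gs arbitrary: \<psi> rule: bar_tail.induct) auto

lemma bar_diff_cong:
  assumes "\<And>a l. Suc (length l) = length gs \<Longrightarrow> \<phi> a l = \<psi> a l"
  shows "bar_diff \<phi> a gs = bar_diff \<psi> a gs"
proof (cases gs)
  case (Cons g r)
  then show ?thesis
    using assms bar_tail_cong[of gs \<phi> a \<psi>] by auto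
qed simp

lemma bar_tail_add:
  "bar_tail (\<lambda>a l. \<phi> a l + \<psi> a l) a gs = bar_tail \<phi> a gs + bar_tail \<psi> a gs"
  by (induction \<phi> a gs arbitrary: \<psi> rule: bar_tail.induct) simp_all

lemma bar_tail_minus:
  "bar_tail (\<lambda>a l. \<phi> a l - \<psi> a l) a gs = bar_tail \<phi> a gs - bar_tail \<psi> a gs"
  by (induction \<phi> a gs arbitrary: \<psi> rule: bar_tail.induct) simp_all

lemma bar_diff_add:
  "bar_diff (\<lambda>a l. \<phi> a l + \<psi> a l) a gs = bar_diff \<phi> a gs + bar_diff \<psi> a gs"
  by (cases gs) (simp_all add: bar_tail_add)

lemma bar_diff_minus:
  "bar_diff (\<lambda>a l. \<phi> a l - \<psi> a l) a gs = bar_diff \<phi> a gs - bar_diff \<psi> a gs"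
  by (cases gs) (simp_all add: bar_tail_minus)

lemma bar_tail_shift: "bar_tail (\<lambda>a. \<phi> (s a)) a gs = bar_tail \<phi> (s a) gs"
  by (induction \<phi> "s a" gs rule: bar_tail.induct) auto

text \<open>This equivariance, which rests on commutativity of the group, later allows
  \<open>ma a\<close> to be moved inside a coboundary.\<close>

lemma bar_diff_shift: "bar_diff (\<lambda>a. \<phi> (vadd a g)) a gs = bar_diff \<phi> (vadd a g) gs"
proof (cases gs)
  case (Cons h r)
  have "vadd (vadd a h) g = vadd (vadd a g) h" by (simp add: vadd_ac)
  then show ?thesis
    using bar_tail_shift[of \<phi> "\<lambda>a. vadd a g" a gs] unfolding Cons bar_diff.simps by (simp only:)
qed simp

lemma bar_diff_bar_diff: "2 \<le> length gs \<Longrightarrow> bar_diff (bar_diff \<phi>) a gs = 0"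
proof (induction gs arbitrary: \<phi> a)
  case (Cons g gs)
  then obtain h r where gs: "gs = h # r" by (cases gs) auto
  show ?case
  proof (cases r)
    case Nil
    then show ?thesis by (simp add: gs vadd_ac)
  next
    case r: (Cons k r')
    \<comment> \<open>The second and third terms of \<open>bar_diff_Cons2\<close>, read as cochains
      in \<open>l\<close>; \<open>hd\<close> and \<open>tl\<close> stand in for a pattern so that
      \<open>bar_diff\<close> can be applied to them.\<close>
    let ?T = "\<lambda>a l. \<phi> a (vadd g (hd l) # tl l)"
    let ?R = "\<lambda>a l. \<phi> (vadd a (hd l)) (g # tl l)"
    have IH: "bar_diff (bar_diff (\<lambda>a l. \<phi> a (g # l))) a gs = 0"
      by (rule Cons.IH) (simp add: gs r)
    have "bar_diff (\<lambda>a l. bar_diff \<phi> a (g # l)) a gs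
        = bar_diff (\<lambda>a l. \<phi> (vadd a g) l - ?T a l + ?R a l - bar_diff (\<lambda>a l. \<phi> a (g # l)) a l) a gs"
    proof (rule bar_diff_cong)
      fix a and l :: "(nat \<Rightarrow> int) list" assume "Suc (length l) = length gs"
      then obtain x y where "l = x # y" by (cases l) (auto simp: gs r)
      then show "bar_diff \<phi> a (g # l) = \<phi> (vadd a g) l - ?T a l + ?R a l - bar_diff (\<lambda>a l. \<phi> a (g # l)) a l"
        by (simp only: bar_diff_Cons2 list.sel)
    qed
    also have "\<dots> = bar_diff (\<lambda>a. \<phi> (vadd a g)) a gs - bar_diff ?T a gs + bar_diff ?R a gs"
      by (simp only: bar_diff_add bar_diff_minus IH diff_0_right)
    finally have X: "bar_diff (\<lambda>a l. bar_diff \<phi> a (g # l)) a gs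
        = bar_diff \<phi> (vadd a g) gs - bar_diff ?T a gs + bar_diff ?R a gs"
      by (simp only: bar_diff_shift)
    have T: "bar_diff ?T a gs = \<phi> (vadd a h) (vadd g k # r') - \<phi> a (vadd g (vadd h k) # r')
        + \<phi> (vadd a k) (vadd g h # r') - bar_diff (\<lambda>a l. \<phi> a (vadd g h # l)) a r"
      unfolding gs r bar_diff_Cons2 list.sel ..
    have R: "bar_diff ?R a gs = \<phi> (vadd (vadd a k) h) (g # r')
        - bar_diff (\<lambda>a l. \<phi> a (g # l)) (vadd a h) r"
      unfolding gs r bar_diff_Cons2 list.sel bar_diff_shift[of "\<lambda>a l. \<phi> a (g # l)" h, symmetric]
      by (simp add: vadd_assoc del: bar_diff.simps)
    show ?thesis
      unfolding gs bar_diff_Cons2[of "bar_diff \<phi>"] X[unfolded gs] T[unfolded gs] R[unfolded gs]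
      unfolding r bar_diff_Cons2
      by (simp add: vadd_assoc vadd_commute[of h k] vadd_commute[of h g] del: bar_diff.simps)
  qed
qed simp

text \<open>The alternating sum over all insertions of \<open>t\<close> into the tuple, with sign
  (-1)^i at position i. As \<open>t\<close> is central, the neighbouring entries need no
  conjugation.\<close>

fun bar_homotopy :: "(nat \<Rightarrow> int) \<Rightarrow> ('g \<Rightarrow> (nat \<Rightarrow> int) list \<Rightarrow> 'b) \<Rightarrow> 'g \<Rightarrow> (nat \<Rightarrow> int) list
    \<Rightarrow> 'b::ab_group_add" where
  "bar_homotopy t \<phi> a [] = \<phi> a [t]"
| "bar_homotopy t \<phi> a (g # r) = \<phi> a (t # g # r) - bar_homotopy t (\<lambda>a l. \<phi> a (g # l)) a r"

lemma bar_homotopy_cong: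
  "(\<And>l. length l = Suc (length gs) \<Longrightarrow> \<phi> a l = \<psi> a l) \<Longrightarrow> bar_homotopy t \<phi> a gs = bar_homotopy t \<psi> a gs"
proof (induction gs arbitrary: \<phi> \<psi>)
  case (Cons g gs)
  have "bar_homotopy t (\<lambda>a l. \<phi> a (g # l)) a gs = bar_homotopy t (\<lambda>a l. \<psi> a (g # l)) a gs"
    by (rule Cons.IH) (simp add: Cons.prems)
  then show ?case by (simp add: Cons.prems)
qed simp

lemma bar_homotopy_add:
  "bar_homotopy t (\<lambda>a l. \<phi> a l + \<psi> a l) a gs = bar_homotopy t \<phi> a gs + bar_homotopy t \<psi> a gs"
  by (induction gs arbitrary: \<phi> \<psi>) simp_all

lemma bar_homotopy_minus:
  "bar_homotopy t (\<lambda>a l. \<phi> a l - \<psi> a l) a gs = bar_homotopy t \<phi> a gs - bar_homotopy t \<psi> a gs"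
  by (induction gs arbitrary: \<phi> \<psi>) simp_all

lemma bar_homotopy_shift:
  "bar_homotopy t (\<lambda>a. \<phi> (s a)) a gs = bar_homotopy t \<phi> (s a) gs"
  by (induction gs arbitrary: \<phi>) auto

text \<open>Inserting \<open>t\<close> just before or just after an entry and merging the two gives
  the same tuple, since \<open>t\<close> is central, and the signs are opposite. What survives is
  \<open>t\<close> in front, acting on the coefficient, and \<open>t\<close> at the end, being
  dropped.\<close>

lemma bar_homotopy_formula:
  "bar_diff (bar_homotopy t \<phi>) a gs + bar_homotopy t (bar_diff \<phi>) a gs = \<phi> (vadd a t) gs - \<phi> a gs"
proof (induction gs arbitrary: \<phi> a)
  case (Cons g gs)
  show ?case
  proof (cases gs)
    case Nil
    then show ?thesis by (simp add: vadd_ac)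
  next
    case gs: (Cons h r)
    let ?\<phi>g = "\<lambda>a l. \<phi> a (g # l)"
    let ?T = "\<lambda>a l. \<phi> a (vadd g (hd l) # tl l)"
    let ?R = "\<lambda>a l. \<phi> (vadd a (hd l)) (g # tl l)"
    have 1: "bar_diff (\<lambda>a l. bar_homotopy t \<phi> a (g # l)) a gs
        = bar_diff (\<lambda>a l. \<phi> a (t # g # l)) a gs - bar_diff (bar_homotopy t ?\<phi>g) a gs"
      by (simp add: bar_diff_minus)
    have "bar_homotopy t (\<lambda>a l. bar_diff \<phi> a (g # l)) a gs
        = bar_homotopy t (\<lambda>a l. \<phi> (vadd a g) l - ?T a l + ?R a l - bar_diff ?\<phi>g a l) a gs"
    proof (rule bar_homotopy_cong)
      fix l :: "(nat \<Rightarrow> int) list" assume "length l = Suc (length gs)"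
      then obtain x y where "l = x # y" by (cases l) auto
      then show "bar_diff \<phi> a (g # l) = \<phi> (vadd a g) l - ?T a l + ?R a l - bar_diff ?\<phi>g a l"
        by (simp only: bar_diff_Cons2 list.sel)
    qed
    also have "\<dots> = bar_homotopy t \<phi> (vadd a g) gs - bar_homotopy t ?T a gs + bar_homotopy t ?R a gs
        - bar_homotopy t (bar_diff ?\<phi>g) a gs"
      by (simp only: bar_homotopy_add bar_homotopy_minus
            bar_homotopy_shift[of t \<phi> "\<lambda>a. vadd a g" a gs])
    finally have 2: "bar_homotopy t (\<lambda>a l. bar_diff \<phi> a (g # l)) a gs = \<dots>" .
    have R: "bar_homotopy t (\<lambda>a l. \<phi> (vadd a h) (g # l)) a r = bar_homotopy t ?\<phi>g (vadd a h) r"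
      by (rule bar_homotopy_shift[where s = "\<lambda>a. vadd a h" and \<phi> = ?\<phi>g])
    have IH: "bar_diff (bar_homotopy t ?\<phi>g) a gs
        = \<phi> (vadd a t) (g # gs) - \<phi> a (g # gs) - bar_homotopy t (bar_diff ?\<phi>g) a gs"
      using Cons.IH[of ?\<phi>g a] by (simp add: algebra_simps)
    have "bar_diff (bar_homotopy t \<phi>) a (g # gs)
        = bar_homotopy t \<phi> (vadd a g) (h # r) - bar_homotopy t \<phi> a (vadd g h # r)
          + bar_homotopy t \<phi> (vadd a h) (g # r)
          - (bar_diff (\<lambda>a l. \<phi> a (t # g # l)) a gs - bar_diff (bar_homotopy t ?\<phi>g) a gs)"
      unfolding 1[symmetric] unfolding gs bar_diff_Cons2 ..
    moreover have "bar_homotopy t (bar_diff \<phi>) a (g # gs) = bar_diff \<phi> a (t # g # gs)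
        - (bar_homotopy t \<phi> (vadd a g) gs - bar_homotopy t ?T a gs + bar_homotopy t ?R a gs
        - bar_homotopy t (bar_diff ?\<phi>g) a gs)"
      unfolding 2[symmetric] bar_homotopy.simps(2) ..
    moreover have "bar_diff \<phi> a (t # g # gs) = \<phi> (vadd a t) (g # gs) - \<phi> a (vadd t g # gs)
        + \<phi> (vadd a g) (t # gs) - (\<phi> (vadd a g) (t # gs) - \<phi> a (t # vadd g h # r)
        + \<phi> (vadd a h) (t # g # r) - bar_diff (\<lambda>a l. \<phi> a (t # g # l)) a gs)"
      unfolding gs bar_diff_Cons2 ..
    ultimately show ?thesis
      unfolding IH unfolding gs
      by (simp add: R vadd_commute[of t g] del: bar_diff.simps)
  qed
qed simp

section \<open>Comparison of the recursive differential with the indexed sum\<close>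

lemma merge_Cons: "1 \<le> i \<Longrightarrow> merge (Suc i) (g # l) = g # merge i l"
  by (cases i) (simp_all add: merge_def)

lemma merge_1: "merge (Suc 0) (g # h # r) = vadd g h # r"
  by (simp add: merge_def)

text \<open>Peeling off the first entry shifts the remaining merge positions by one, and this shift
  is the minus sign in the recursion. The values are formal chains because there a sign acts by
  \<open>frag_cmul\<close>.\<close>

lemma bar_tail_eq_sum:
  fixes \<phi> :: "'g \<Rightarrow> (nat \<Rightarrow> int) list \<Rightarrow> 'c \<Rightarrow>\<^sub>0 int"
  assumes "length gs = Suc n"
  shows "bar_tail \<phi> a gs = (\<Sum>i\<in>{1..n}. frag_cmul ((-1) ^ i) (\<phi> a (merge i gs)))
           + frag_cmul ((-1) ^ Suc n) (\<phi> a (take n gs))"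
  using assms
proof (induction n arbitrary: gs \<phi>)
  case 0
  then obtain g where "gs = [g]" by (auto simp: length_Suc_conv)
  then show ?case by simp
next
  case (Suc n)
  then obtain g h r where gs: "gs = g # h # r" by (auto simp: length_Suc_conv)
  let ?c = "\<lambda>i. frag_cmul ((-1) ^ i)"
  have "(\<Sum>i\<in>{1..Suc n}. ?c i (\<phi> a (merge i gs)))
      = ?c 1 (\<phi> a (merge 1 gs)) + (\<Sum>i\<in>{1..n}. ?c (Suc i) (\<phi> a (merge (Suc i) gs)))"
  proof -
    have "Suc 0 \<le> Suc n" by simp
    then show ?thesis
      unfolding One_nat_def by (rule sum.atLeast_Suc_atMost[THEN trans]) (rule arg_cong[OF sum.shift_bounds_cl_Suc_ivl])
  qed
  also have "(\<Sum>i\<in>{1..n}. ?c (Suc i) (\<phi> a (merge (Suc i) gs)))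
      = (\<Sum>i\<in>{1..n}. - ?c i (\<phi> a (g # merge i (h # r))))"
  proof (rule sum.cong)
    fix i assume "i \<in> {1..n}"
    then have "merge (Suc i) gs = g # merge i (h # r)" by (simp add: gs merge_Cons)
    then show "?c (Suc i) (\<phi> a (merge (Suc i) gs)) = - ?c i (\<phi> a (g # merge i (h # r)))"
      by simp
  qed simp
  also have "\<dots> = - (\<Sum>i\<in>{1..n}. ?c i (\<phi> a (g # merge i (h # r))))"
    by (rule sum_negf)
  also have "?c 1 (\<phi> a (merge 1 gs)) = - \<phi> a (vadd g h # r)"
    by (simp add: gs merge_1)
  finally have *: "(\<Sum>i\<in>{1..Suc n}. ?c i (\<phi> a (merge i gs)))
      = - \<phi> a (vadd g h # r) + - (\<Sum>i\<in>{1..n}. ?c i (\<phi> a (g # merge i (h # r))))" .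
  have "bar_tail \<phi> a gs = - \<phi> a (vadd g h # r) - bar_tail (\<lambda>a l. \<phi> a (g # l)) a (h # r)"
    by (simp add: gs)
  also have "bar_tail (\<lambda>a l. \<phi> a (g # l)) a (h # r)
      = (\<Sum>i\<in>{1..n}. ?c i (\<phi> a (g # merge i (h # r)))) + ?c (Suc n) (\<phi> a (g # take n (h # r)))"
    using Suc.prems by (intro Suc.IH) (simp add: gs)
  finally show ?case
    unfolding * by (simp add: gs)
qed

lemma valid_tuple_Zd_subset: "valid_tuple d n gs \<Longrightarrow> set gs \<subseteq> Zd d"
  and valid_tuple_length: "valid_tuple d n gs \<Longrightarrow> length gs = n"
  by (auto simp: valid_tuple_def)

subsection \<open>Evaluating formal chains in an abelian group\<close>

text \<open>The universal cochain. An identity between formal chains holds in every module after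
  evaluation, although a module is a record to which the class \<open>ab_group_add\<close> required
  by \<open>bar_diff\<close> does not apply.\<close>

abbreviation formal :: "(nat \<Rightarrow> int) \<Rightarrow> (nat \<Rightarrow> int) list \<Rightarrow> ((nat \<Rightarrow> int) \<times> (nat \<Rightarrow> int) list) \<Rightarrow>\<^sub>0 int" where
  "formal a l \<equiv> frag_of (a, l)"

context comm_group
begin

context
  fixes F :: "('k \<Rightarrow>\<^sub>0 int) \<Rightarrow> 'a"
  assumes F: "F \<in> hom (free_Abelian_group UNIV) G"
begin

interpretation F: group_hom "free_Abelian_group UNIV" G F
  by (simp add: group_hom_def group_hom_axioms_def F)

lemma frag_hom_closed [simp]: "F x \<in> carrier G"
  using F.hom_closed by simp

lemma frag_hom_add: "F (x + y) = F x \<otimes> F y"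
  using F.hom_mult[of x y] by simp

lemma frag_hom_zero: "F 0 = \<one>"
  using F.hom_one by simp

lemma frag_hom_uminus: "F (- x) = inv F x"
  using F.hom_inv[of x] by simp

lemma frag_hom_diff: "F (x - y) = F x \<otimes> inv F y"
  using frag_hom_add[of x "- y"] by (simp add: frag_hom_uminus)

lemma frag_hom_cmul: "F (frag_cmul n x) = F x [^] n"
  using F.hom_int_pow[of x n] by simp

lemma frag_hom_sum: "finite A \<Longrightarrow> F (sum f A) = finprod G (\<lambda>i. F (f i)) A"
  by (induction A rule: finite_induct) (auto simp: frag_hom_zero frag_hom_add)

end

lemmas frag_hom_simps = frag_hom_zero frag_hom_add frag_hom_uminus frag_hom_diff

text \<open>Two evaluations are compared only on the tuples that the differential reaches: one entry
  shorter, with all entries in \<open>Zd d\<close>. Agreement everywhere would be too much to ask,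
  as cochains are controlled on valid tuples only.\<close>

lemma bar_tail_transfer:
  assumes F: "F \<in> hom (free_Abelian_group UNIV) G" and F': "F' \<in> hom (free_Abelian_group UNIV) G"
    and "\<And>l. set l \<subseteq> Zd d \<Longrightarrow> Suc (length l) = length gs \<Longrightarrow> F (\<phi> a l) = F' (\<psi> b l)"
    and "set gs \<subseteq> Zd d"
  shows "F (bar_tail \<phi> a gs) = F' (bar_tail \<psi> b gs)"
  using assms(3,4)
proof (induction \<phi> a gs arbitrary: \<psi> rule: bar_tail.induct)
  case (1 \<phi> a)
  then show ?case by (simp add: frag_hom_simps[OF F] frag_hom_simps[OF F'])
next
  case (2 \<phi> a g)
  then show ?case by (simp add: frag_hom_simps[OF F] frag_hom_simps[OF F'])
next
  case (3 \<phi> a g h r)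
  have "F (bar_tail (\<lambda>a l. \<phi> a (g # l)) a (h # r)) = F' (bar_tail (\<lambda>a l. \<psi> a (g # l)) b (h # r))"
    using 3(2,3) by (intro 3(1)) auto
  then show ?case
    using 3(2)[of "vadd g h # r"] 3(3) by (simp add: frag_hom_simps[OF F] frag_hom_simps[OF F'])
qed

lemma bar_diff_transfer:
  assumes F: "F \<in> hom (free_Abelian_group UNIV) G" and F': "F' \<in> hom (free_Abelian_group UNIV) G"
    and eq: "\<And>b l. b \<in> Zd d \<Longrightarrow> set l \<subseteq> Zd d \<Longrightarrow> Suc (length l) = length gs \<Longrightarrow> F (\<phi> b l) = F' (\<psi> b l)"
    and a: "a \<in> Zd d" and gs: "set gs \<subseteq> Zd d"
  shows "F (bar_diff \<phi> a gs) = F' (bar_diff \<psi> a gs)"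
proof (cases gs)
  case Nil
  then show ?thesis by (simp add: frag_hom_simps[OF F] frag_hom_simps[OF F'])
next
  case (Cons g r)
  have "F (bar_tail \<phi> a gs) = F' (bar_tail \<psi> a gs)"
    using eq a gs by (intro bar_tail_transfer[OF F F', of d]) auto
  then show ?thesis
    using eq[of "vadd a g" r] a gs
    by (simp add: Cons frag_hom_add[OF F] frag_hom_add[OF F'] del: bar_tail.simps)
qed

lemma bar_homotopy_transfer:
  assumes F: "F \<in> hom (free_Abelian_group UNIV) G" and F': "F' \<in> hom (free_Abelian_group UNIV) G"
    and t: "t \<in> Zd d"
    and "\<And>l. set l \<subseteq> Zd d \<Longrightarrow> length l = Suc (length gs) \<Longrightarrow> F (\<phi> a l) = F' (\<psi> b l)"
    and "set gs \<subseteq> Zd d"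
  shows "F (bar_homotopy t \<phi> a gs) = F' (bar_homotopy t \<psi> b gs)"
  using assms(4,5)
proof (induction gs arbitrary: \<phi> \<psi>)
  case Nil
  then show ?case using t by simp
next
  case (Cons g r)
  have "F (bar_homotopy t (\<lambda>a l. \<phi> a (g # l)) a r) = F' (bar_homotopy t (\<lambda>a l. \<psi> a (g # l)) b r)"
    using Cons.prems by (intro Cons.IH) auto
  then show ?case
    using Cons.prems(1)[of "t # g # r"] Cons.prems(2) t
    by (simp add: frag_hom_simps[OF F] frag_hom_simps[OF F'])
qed

end

subsection \<open>Modules and cochains\<close>

lemma coboundary_invalid: "\<not> valid_tuple d (Suc n) gs \<Longrightarrow> coboundary d M ma n f gs = \<one>\<^bsub>M\<^esub>"
  by (simp add: coboundary_def)

locale gmodule = comm_group M for M :: "('m, 'b) monoid_scheme" (structure) +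
  fixes d :: nat and ma :: "(nat \<Rightarrow> int) \<Rightarrow> 'm \<Rightarrow> 'm"
  assumes ma_hom: "g \<in> Zd d \<Longrightarrow> ma g \<in> hom M M"
    and ma_vzero: "x \<in> carrier M \<Longrightarrow> ma vzero x = x"
    and ma_vadd: "g \<in> Zd d \<Longrightarrow> h \<in> Zd d \<Longrightarrow> x \<in> carrier M \<Longrightarrow> ma g (ma h x) = ma (vadd g h) x"
begin

lemma ma_closed [simp]: "g \<in> Zd d \<Longrightarrow> x \<in> carrier M \<Longrightarrow> ma g x \<in> carrier M"
  using ma_hom hom_in_carrier by metis

lemma ma_mult: "g \<in> Zd d \<Longrightarrow> x \<in> carrier M \<Longrightarrow> y \<in> carrier M \<Longrightarrow> ma g (x \<otimes> y) = ma g x \<otimes> ma g y"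
  using ma_hom hom_mult by metis

lemma group_hom_ma: "g \<in> Zd d \<Longrightarrow> group_hom M M (ma g)"
  by (simp add: group_hom_def group_hom_axioms_def ma_hom)

lemma ma_one [simp]: "g \<in> Zd d \<Longrightarrow> ma g \<one> = \<one>"
  using group_hom.hom_one[OF group_hom_ma] by metis

lemma ma_inv: "g \<in> Zd d \<Longrightarrow> x \<in> carrier M \<Longrightarrow> ma g (inv x) = inv (ma g x)"
  using group_hom.hom_inv[OF group_hom_ma] by metis

definition extends :: "((((nat \<Rightarrow> int) \<times> (nat \<Rightarrow> int) list) \<Rightarrow>\<^sub>0 int) \<Rightarrow> 'm) \<Rightarrow> ((nat \<Rightarrow> int) list \<Rightarrow> 'm) \<Rightarrow> bool" where
  "extends F f \<longleftrightarrow> F \<in> hom (free_Abelian_group UNIV) M \<and> (\<forall>a\<in>Zd d. \<forall>l. F (formal a l) = ma a (f l))"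

lemma extends_exists:
  assumes "\<And>l. f l \<in> carrier M"
  obtains F where "extends F f"
proof -
  \<comment> \<open>Nothing is known about \<open>ma a\<close> for \<open>a\<close> outside
    \<open>Zd d\<close>, so these generators go to \<open>\<one>\<close> to stay in the
    carrier.\<close>
  let ?f = "\<lambda>(a, l). if a \<in> Zd d then ma a (f l) else \<one>"
  have "?f ` UNIV \<subseteq> carrier M" using assms by auto
  then show thesis
  proof (rule free_Abelian_group_universal)
    fix F assume "F \<in> hom (free_Abelian_group UNIV) M" and "\<And>x. x \<in> UNIV \<Longrightarrow> F (frag_of x) = ?f x"
    then show thesis by (intro that[of F]) (simp add: extends_def)
  qed
qed

lemma extends_hom: "extends F f \<Longrightarrow> F \<in> hom (free_Abelian_group UNIV) M"
  and extends_formal: "extends F f \<Longrightarrow> a \<in> Zd d \<Longrightarrow> F (formal a l) = ma a (f l)"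
  by (auto simp: extends_def)

text \<open>The coefficient starts at \<open>vzero\<close>, which acts trivially, so only the
  leading term picks up an action, that of the first entry.\<close>

lemma coboundary_eq_bar_diff:
  assumes ext: "extends F f" and f: "\<And>l. f l \<in> carrier M" and gs: "valid_tuple d (Suc n) gs"
  shows "coboundary d M ma n f gs = F (bar_diff formal vzero gs)"
proof -
  note F = extends_hom[OF ext]
  have len: "length gs = Suc n" and sub: "set gs \<subseteq> Zd d" using gs by (auto simp: valid_tuple_def)
  obtain g r where gr: "gs = g # r" using len by (cases gs) auto
  have Ff: "F (formal vzero l) = f l" for l
    using f by (simp add: extends_formal[OF ext] ma_vzero)
  have "F (bar_diff formal vzero gs) = F (formal g r) \<otimes> F (bar_tail formal vzero gs)"
    by (simp add: gr frag_hom_add[OF F] del: bar_tail.simps)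
  also have "F (formal g r) = ma g (f r)"
    using sub by (simp add: gr extends_formal[OF ext])
  also have "F (bar_tail formal vzero gs)
      = finprod M (\<lambda>i. f (merge i gs) [^] ((-1::int) ^ i)) {1..n} \<otimes> (f (take n gs) [^] ((-1::int) ^ Suc n))"
    unfolding bar_tail_eq_sum[OF len]
    by (simp only: frag_hom_add[OF F] frag_hom_sum[OF F] frag_hom_cmul[OF F] Ff finite_atLeastAtMost)
  finally have "F (bar_diff formal vzero gs) = ma g (f r) \<otimes>
      (finprod M (\<lambda>i. f (merge i gs) [^] ((-1::int) ^ i)) {1..n} \<otimes> (f (take n gs) [^] ((-1::int) ^ Suc n)))" .
  moreover have "finprod M (\<lambda>i. f (merge i gs) [^] ((-1::int) ^ i)) {1..n} \<in> carrier M"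
    by (intro finprod_closed Pi_I int_pow_closed f)
  moreover have "ma g (f r) \<in> carrier M" "f (take n gs) [^] ((-1::int) ^ Suc n) \<in> carrier M"
    using sub gr f by (auto intro!: ma_closed)
  moreover have "hd gs = g" "tl gs = r" by (simp_all add: gr)
  ultimately show ?thesis
    using gs by (simp only: coboundary_def if_True m_assoc)
qed

text \<open>When a coboundary is differentiated again, the first entry acts on an inner coboundary;
  this forces a general coefficient \<open>a\<close>.\<close>

lemma ma_coboundary_eq_bar_diff:
  assumes ext: "extends F f" and f: "\<And>l. f l \<in> carrier M" and gs: "valid_tuple d (Suc n) gs"
    and a: "a \<in> Zd d"
  shows "ma a (coboundary d M ma n f gs) = F (bar_diff formal a gs)"
proof -
  note F = extends_hom[OF ext]
  have maF: "(\<lambda>x. ma a (F x)) \<in> hom (free_Abelian_group UNIV) M"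
    using Group.hom_compose[OF F ma_hom[OF a]] by (simp add: comp_def)
  have "ma a (F (bar_diff formal vzero gs)) = F (bar_diff (\<lambda>b. formal (vadd b a)) vzero gs)"
    using a gs f
    by (intro bar_diff_transfer[OF maF F, of d])
       (auto simp: extends_formal[OF ext] ma_vadd vadd_commute valid_tuple_def)
  then show ?thesis
    using bar_diff_shift[of formal a vzero gs] by (simp add: coboundary_eq_bar_diff[OF ext f gs])
qed

lemma cochain_closed: "f \<in> cochains d M n \<Longrightarrow> f l \<in> carrier M"
  by (cases "valid_tuple d n l") (auto simp: cochains_def)

lemma coboundary_cochain:
  assumes f: "\<And>l. f l \<in> carrier M"
  shows "coboundary d M ma n f \<in> cochains d M (Suc n)"
proof -
  obtain F where F: "extends F f" using extends_exists[of f, OF f] by blast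
  have "coboundary d M ma n f gs \<in> carrier M" if "valid_tuple d (Suc n) gs" for gs
    unfolding coboundary_eq_bar_diff[OF F f that] by (rule frag_hom_closed[OF extends_hom[OF F]])
  then show ?thesis by (auto simp: cochains_def coboundary_def)
qed

lemma coboundary_coboundary:
  assumes f: "\<And>l. f l \<in> carrier M"
  shows "coboundary d M ma (Suc n) (coboundary d M ma n f) = (\<lambda>gs. \<one>)"
proof
  fix gs
  let ?df = "coboundary d M ma n f"
  have df: "?df l \<in> carrier M" for l using cochain_closed[OF coboundary_cochain[of f, OF f]] .
  obtain F F' where F: "extends F f" and F': "extends F' ?df"
    using extends_exists[of f] extends_exists[of ?df] f df by metis
  show "coboundary d M ma (Suc n) ?df gs = \<one>"
  proof (cases "valid_tuple d (Suc (Suc n)) gs")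
    case True
    then have "set gs \<subseteq> Zd d" and len: "length gs = Suc (Suc n)" by (auto simp: valid_tuple_def)
    have "coboundary d M ma (Suc n) ?df gs = F' (bar_diff formal vzero gs)"
      by (rule coboundary_eq_bar_diff[OF F' df True])
    \<comment> \<open>One differential is absorbed: evaluation at \<open>?df\<close> is evaluation
      at \<open>f\<close> after \<open>bar_diff\<close>, on tuples of the length that
      occurs.\<close>
    also have "\<dots> = F (bar_diff (bar_diff formal) vzero gs)"
    proof (rule bar_diff_transfer[OF extends_hom[OF F'] extends_hom[OF F], of d])
      fix b l assume "b \<in> Zd d" "set l \<subseteq> Zd d" "Suc (length l) = length gs"
      then show "F' (formal b l) = F (bar_diff formal b l)"
        using ma_coboundary_eq_bar_diff[OF F f, of n l b] len
        by (simp add: extends_formal[OF F'] valid_tuple_def)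
    qed (use \<open>set gs \<subseteq> Zd d\<close> in auto)
    also have "\<dots> = \<one>"
      using len by (simp add: bar_diff_bar_diff frag_hom_zero[OF extends_hom[OF F]])
    finally show ?thesis .
  qed (simp add: coboundary_def)
qed

text \<open>A group element acts trivially on cohomology, since it is central.\<close>

lemma translate_cocycle:
  assumes f: "f \<in> cocycles d M ma (Suc n)" and t: "t \<in> Zd d"
  obtains k where "k \<in> cochains d M n" "\<And>gs. valid_tuple d (Suc n) gs \<Longrightarrow>
     coboundary d M ma n k gs = ma t (f gs) \<otimes> inv f gs"
proof -
  have fc: "f l \<in> carrier M" for l using f cochain_closed by (auto simp: cocycles_def)
  have df: "coboundary d M ma (Suc n) f l = \<one>" for l using f by (auto simp: cocycles_def)
  obtain F where ext: "extends F f" using extends_exists[of f, OF fc] by blast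
  note F = extends_hom[OF ext]
  \<comment> \<open>The insertion homotopy evaluated at \<open>f\<close>; the default
    \<open>\<one>\<close> on invalid tuples makes it a cochain.\<close>
  define k where "k = (\<lambda>l. if valid_tuple d n l then F (bar_homotopy t formal vzero l) else \<one>)"
  have k: "k \<in> cochains d M n" by (auto simp: k_def cochains_def F)
  have kc: "k l \<in> carrier M" for l using k cochain_closed by blast
  obtain F' where ext': "extends F' k" using extends_exists[of k, OF kc] by blast
  note F' = extends_hom[OF ext']
  have "coboundary d M ma n k gs = ma t (f gs) \<otimes> inv f gs" if gs: "valid_tuple d (Suc n) gs" for gs
  proof -
    note sub = valid_tuple_Zd_subset[OF gs] and len = valid_tuple_length[OF gs]
    have "coboundary d M ma n k gs = F' (bar_diff formal vzero gs)"
      by (rule coboundary_eq_bar_diff[OF ext' kc gs])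
    also have "\<dots> = F (bar_diff (bar_homotopy t formal) vzero gs)"
    proof (rule bar_diff_transfer[OF F' F, of d])
      fix b l assume b: "b \<in> Zd d" and l: "set l \<subseteq> Zd d" "Suc (length l) = length gs"
      have maF: "(\<lambda>x. ma b (F x)) \<in> hom (free_Abelian_group UNIV) M"
        using Group.hom_compose[OF F ma_hom[OF b]] by (simp add: comp_def)
      have "F' (formal b l) = ma b (F (bar_homotopy t formal vzero l))"
        using b l len by (simp add: extends_formal[OF ext'] k_def valid_tuple_def)
      also have "\<dots> = F (bar_homotopy t formal b l)"
        using b l t fc by (intro bar_homotopy_transfer[OF maF F t])
          (simp_all add: extends_formal[OF ext] ma_vzero)
      finally show "F' (formal b l) = F (bar_homotopy t formal b l)" .
    qed (use sub in auto)
    also have "bar_diff (bar_homotopy t formal) vzero gs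
        = formal t gs - formal vzero gs - bar_homotopy t (bar_diff formal) vzero gs"
      using bar_homotopy_formula[of t formal vzero gs] by (simp add: algebra_simps)
    also have "F (formal t gs - formal vzero gs - bar_homotopy t (bar_diff formal) vzero gs)
        = ma t (f gs) \<otimes> inv f gs \<otimes> inv F (bar_homotopy t (bar_diff formal) vzero gs)"
      using t fc by (simp add: frag_hom_diff[OF F] extends_formal[OF ext] ma_vzero)
    \<comment> \<open>This term involves only values of the coboundary of \<open>f\<close>, all
      trivial, so the zero chain may replace it.\<close>
    also have "F (bar_homotopy t (bar_diff formal) vzero gs) = F (bar_homotopy t (\<lambda>_ _. 0) vzero gs)"
      using sub t len coboundary_eq_bar_diff[OF ext fc, of "Suc n"] df
      by (intro bar_homotopy_transfer[OF F F t]) (auto simp: frag_hom_zero[OF F] valid_tuple_def)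
    also have "bar_homotopy t (\<lambda>_ _. 0) vzero gs = (0 :: _ \<Rightarrow>\<^sub>0 int)"
      by (induction gs) auto
    finally show ?thesis using t fc by (simp add: frag_hom_zero[OF F])
  qed
  then show thesis using that k by blast
qed

lemma coboundary_mult:
  assumes f: "\<And>l. f l \<in> carrier M" and h: "\<And>l. h l \<in> carrier M"
  shows "coboundary d M ma n (\<lambda>l. f l \<otimes> h l) = (\<lambda>gs. coboundary d M ma n f gs \<otimes> coboundary d M ma n h gs)"
proof
  fix gs
  obtain F F' where F: "extends F f" and F': "extends F' h"
    using extends_exists[of f] extends_exists[of h] f h by metis
  have "extends (\<lambda>x. F x \<otimes> F' x) (\<lambda>l. f l \<otimes> h l)"
    unfolding extends_def
  proof (intro conjI ballI allI homI)
    note cl = frag_hom_closed[OF extends_hom[OF F]] frag_hom_closed[OF extends_hom[OF F']]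
    fix x y :: "(nat \<Rightarrow> int) \<times> (nat \<Rightarrow> int) list \<Rightarrow>\<^sub>0 int"
    show "F (x \<otimes>\<^bsub>free_Abelian_group UNIV\<^esub> y) \<otimes> F' (x \<otimes>\<^bsub>free_Abelian_group UNIV\<^esub> y)
        = F x \<otimes> F' x \<otimes> (F y \<otimes> F' y)"
      by (simp add: cl m_ac frag_hom_add[OF extends_hom[OF F]] frag_hom_add[OF extends_hom[OF F']])
    show "F x \<otimes> F' x \<in> carrier M" by (simp add: cl)
  next
    fix a l assume "a \<in> Zd d"
    then show "F (formal a l) \<otimes> F' (formal a l) = ma a (f l \<otimes> h l)"
      using f h by (simp add: extends_formal[OF F] extends_formal[OF F'] ma_mult)
  qed
  then show "coboundary d M ma n (\<lambda>l. f l \<otimes> h l) gs = coboundary d M ma n f gs \<otimes> coboundary d M ma n h gs"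
    using coboundary_eq_bar_diff[OF F f] coboundary_eq_bar_diff[OF F' h] f h
      coboundary_eq_bar_diff[of "\<lambda>x. F x \<otimes> F' x" "\<lambda>l. f l \<otimes> h l" n gs]
    by (cases "valid_tuple d (Suc n) gs") (simp_all add: coboundary_invalid)
qed

end

text \<open>Evaluation at \<open>\<theta> \<circ> f\<close> is \<open>\<theta>\<close> after
  evaluation at \<open>f\<close>, so both sides evaluate the same formal chain. It is applied to
  inclusions, to inversion and to operators 1 - t, among others.\<close>

lemma coboundary_natural:
  assumes M: "gmodule M d ma" and N: "gmodule N d mb" and \<theta>: "\<theta> \<in> hom M N"
    and eq: "\<And>g x. g \<in> Zd d \<Longrightarrow> x \<in> carrier M \<Longrightarrow> \<theta> (ma g x) = mb g (\<theta> x)"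
    and f: "\<And>l. f l \<in> carrier M"
  shows "coboundary d N mb n (\<lambda>l. \<theta> (f l)) = (\<lambda>gs. \<theta> (coboundary d M ma n f gs))"
proof
  fix gs
  interpret M: gmodule M d ma by (rule M)
  interpret N: gmodule N d mb by (rule N)
  interpret \<theta>: group_hom M N \<theta> by (simp add: group_hom_def group_hom_axioms_def \<theta>)
  obtain F where F: "M.extends F f" using M.extends_exists[of f, OF f] by blast
  have "N.extends (\<lambda>x. \<theta> (F x)) (\<lambda>l. \<theta> (f l))"
    using Group.hom_compose[OF M.extends_hom[OF F] \<theta>] M.extends_formal[OF F] eq f
    by (auto simp: N.extends_def comp_def)
  then show "coboundary d N mb n (\<lambda>l. \<theta> (f l)) gs = \<theta> (coboundary d M ma n f gs)"
    using M.coboundary_eq_bar_diff[OF F f] N.coboundary_eq_bar_diff[of "\<lambda>x. \<theta> (F x)" "\<lambda>l. \<theta> (f l)" n gs] f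
    by (cases "valid_tuple d (Suc n) gs") (simp_all add: coboundary_invalid)
qed

subsection \<open>Submodules and vanishing of cohomology\<close>

lemma (in group) mult_inv_eq_one_iff:
  "x \<in> carrier G \<Longrightarrow> y \<in> carrier G \<Longrightarrow> x \<otimes> inv y = \<one> \<longleftrightarrow> x = y"
  by (metis inv_closed inv_equality inv_inv r_inv)

context gmodule
begin

definition gsub :: "'m set \<Rightarrow> bool" where
  "gsub P \<longleftrightarrow> subgroup P M \<and> (\<forall>g\<in>Zd d. \<forall>x\<in>P. ma g x \<in> P)"

lemma gsub_subset: "gsub P \<Longrightarrow> x \<in> P \<Longrightarrow> x \<in> carrier M"
  and gsub_one: "gsub P \<Longrightarrow> \<one> \<in> P"
  and gsub_mult: "gsub P \<Longrightarrow> x \<in> P \<Longrightarrow> y \<in> P \<Longrightarrow> x \<otimes> y \<in> P"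
  and gsub_inv: "gsub P \<Longrightarrow> x \<in> P \<Longrightarrow> inv x \<in> P"
  unfolding gsub_def
  by (auto simp: subgroup.mem_carrier subgroup.one_closed subgroup.m_closed subgroup.m_inv_closed)

lemma gsub_Int: "gsub P \<Longrightarrow> gsub Q \<Longrightarrow> gsub (P \<inter> Q)"
  by (auto simp: gsub_def subgroups_Inter_pair)

lemma gsub_carrier: "gsub (carrier M)"
  by (simp add: gsub_def subgroup_self)

lemma gmodule_gsub: "gsub P \<Longrightarrow> gmodule (M\<lparr>carrier := P\<rparr>) d ma"
proof -
  assume P: "gsub P"
  interpret S: comm_group "M\<lparr>carrier := P\<rparr>"
    using P group.group_comm_groupI[OF subgroup_imp_group, of P] m_comm gsub_subset[OF P]
    by (simp add: gsub_def)
  show ?thesis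
    using P by unfold_locales (auto simp: hom_def gsub_def ma_mult ma_vzero ma_vadd subgroup.mem_carrier)
qed

text \<open>\<open>finprod\<close> and negative powers refer to the carrier, so unfolding does not
  give this. The inclusion is an equivariant homomorphism, and naturality does.\<close>

lemma coboundary_gsub:
  assumes P: "gsub P" and f: "\<And>l. f l \<in> P"
  shows "coboundary d (M\<lparr>carrier := P\<rparr>) ma n f = coboundary d M ma n f"
proof -
  have "(\<lambda>x. x) \<in> hom (M\<lparr>carrier := P\<rparr>) M"
    using gsub_subset[OF P] by (auto simp: hom_def)
  from coboundary_natural[OF gmodule_gsub[OF P] gmodule_axioms this, of f n] f show ?thesis
    by simp
qed

abbreviation cochains_in :: "'m set \<Rightarrow> nat \<Rightarrow> ((nat \<Rightarrow> int) list \<Rightarrow> 'm) set" where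
  "cochains_in P n \<equiv> cochains d (M\<lparr>carrier := P\<rparr>) n"

abbreviation \<delta> :: "nat \<Rightarrow> ((nat \<Rightarrow> int) list \<Rightarrow> 'm) \<Rightarrow> (nat \<Rightarrow> int) list \<Rightarrow> 'm" where
  "\<delta> \<equiv> coboundary d M ma"

lemma cochains_in_iff:
  "f \<in> cochains_in P n \<longleftrightarrow> (\<forall>l. valid_tuple d n l \<longrightarrow> f l \<in> P) \<and> (\<forall>l. \<not> valid_tuple d n l \<longrightarrow> f l = \<one>)"
  by (simp add: cochains_def)

lemma cochains_in_mem: "gsub P \<Longrightarrow> f \<in> cochains_in P n \<Longrightarrow> f l \<in> P"
  by (cases "valid_tuple d n l") (auto simp: cochains_in_iff gsub_one)

lemma cochains_in_closed: "gsub P \<Longrightarrow> f \<in> cochains_in P n \<Longrightarrow> f l \<in> carrier M"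
  using cochains_in_mem gsub_subset by blast

lemma cochains_in_carrier: "cochains_in (carrier M) n = cochains d M n"
  by (simp add: cochains_def)

lemma cochains_in_mult:
  "gsub P \<Longrightarrow> f \<in> cochains_in P n \<Longrightarrow> h \<in> cochains_in P n \<Longrightarrow> (\<lambda>l. f l \<otimes> h l) \<in> cochains_in P n"
  by (auto simp: cochains_in_iff gsub_mult)

lemma cochains_in_inv: "gsub P \<Longrightarrow> f \<in> cochains_in P n \<Longrightarrow> (\<lambda>l. inv f l) \<in> cochains_in P n"
  by (auto simp: cochains_in_iff gsub_inv)

lemma cochains_in_one: "gsub P \<Longrightarrow> (\<lambda>l. \<one>) \<in> cochains_in P n"
  by (auto simp: cochains_in_iff gsub_one)

lemma cochains_in_mono: "P \<subseteq> Q \<Longrightarrow> f \<in> cochains_in P n \<Longrightarrow> f \<in> cochains_in Q n"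
  by (auto simp: cochains_in_iff)

lemma \<delta>_in:
  assumes "gsub P" "f \<in> cochains_in P n"
  shows "\<delta> n f \<in> cochains_in P (Suc n)"
proof -
  interpret S: gmodule "M\<lparr>carrier := P\<rparr>" d ma by (rule gmodule_gsub[OF assms(1)])
  show ?thesis
    using S.coboundary_cochain[of f n] cochains_in_mem[OF assms] coboundary_gsub[OF assms(1), of f n]
    by simp
qed

lemma \<delta>_closed: "(\<And>l. f l \<in> carrier M) \<Longrightarrow> \<delta> n f l \<in> carrier M"
  using cochain_closed[OF coboundary_cochain[of f n]] by blast

lemma \<delta>_inv:
  assumes f: "\<And>l. f l \<in> carrier M"
  shows "\<delta> n (\<lambda>l. inv f l) = (\<lambda>l. inv \<delta> n f l)"
proof -
  have "(\<lambda>x. inv x) \<in> hom M M" by (auto simp: hom_def inv_mult)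
  from coboundary_natural[OF gmodule_axioms gmodule_axioms this, of f n] f show ?thesis
    by (simp add: ma_inv)
qed

lemma \<delta>_diff:
  assumes f: "\<And>l. f l \<in> carrier M" and h: "\<And>l. h l \<in> carrier M"
  shows "\<delta> n (\<lambda>l. f l \<otimes> inv h l) = (\<lambda>l. \<delta> n f l \<otimes> inv \<delta> n h l)"
  using coboundary_mult[of f "\<lambda>l. inv h l" n] \<delta>_inv[of h n] f h by simp

lemma \<delta>_one: "\<delta> n (\<lambda>l. \<one>) = (\<lambda>l. \<one>)"
proof -
  have "\<delta> n (\<lambda>l. \<one> \<otimes> inv \<one>) = (\<lambda>l. \<one>)"
    unfolding \<delta>_diff[OF one_closed one_closed] using \<delta>_closed[OF one_closed] by simp
  then show ?thesis by simp
qed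

lemma cocycles_in_iff:
  "gsub P \<Longrightarrow> f \<in> cocycles d (M\<lparr>carrier := P\<rparr>) ma n \<longleftrightarrow> f \<in> cochains_in P n \<and> \<delta> n f = (\<lambda>l. \<one>)"
  using coboundary_gsub cochains_in_mem unfolding cocycles_def by fastforce

lemma coboundaries_in_Suc:
  "gsub P \<Longrightarrow> f \<in> coboundaries d (M\<lparr>carrier := P\<rparr>) ma (Suc n) \<longleftrightarrow> (\<exists>k\<in>cochains_in P n. f = \<delta> n k)"
proof -
  assume P: "gsub P"
  have "coboundary d (M\<lparr>carrier := P\<rparr>) ma n k = \<delta> n k" if "k \<in> cochains_in P n" for k
    using coboundary_gsub[OF P, of k n] cochains_in_mem[OF P that] by blast
  then show ?thesis by (auto simp: coboundaries_def image_iff)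
qed

lemma coboundaries_in_0:
  "f \<in> coboundaries d (M\<lparr>carrier := P\<rparr>) ma 0 \<longleftrightarrow> f = (\<lambda>l. \<one>)"
  by (simp add: coboundaries_def)

lemma \<delta>_0:
  assumes f: "f \<in> cochains d M 0" and g: "g \<in> Zd d"
  shows "\<delta> 0 f [g] = ma g (f []) \<otimes> inv f []"
  using cochain_closed[OF f] g by (simp add: coboundary_def valid_tuple_def int_pow_neg)

lemma cocycles_0_iff:
  "f \<in> cocycles d M ma 0 \<longleftrightarrow> f \<in> cochains d M 0 \<and> (\<forall>g\<in>Zd d. ma g (f []) = f [])"
proof (cases "f \<in> cochains d M 0")
  case True
  have "\<delta> 0 f = (\<lambda>l. \<one>) \<longleftrightarrow> (\<forall>g\<in>Zd d. \<delta> 0 f [g] = \<one>)"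
  proof
    assume *: "\<forall>g\<in>Zd d. \<delta> 0 f [g] = \<one>"
    show "\<delta> 0 f = (\<lambda>l. \<one>)"
    proof
      fix l
      show "\<delta> 0 f l = \<one>"
        using * by (cases "valid_tuple d (Suc 0) l")
          (auto simp: coboundary_invalid valid_tuple_def length_Suc_conv)
    qed
  qed auto
  also have "\<dots> \<longleftrightarrow> (\<forall>g\<in>Zd d. ma g (f []) = f [])"
    using cochain_closed[OF True] \<delta>_0[OF True] by (simp add: mult_inv_eq_one_iff)
  finally show ?thesis using True by (simp add: cocycles_def)
qed (simp add: cocycles_def)

lemma cochains_0_eq_one: "f \<in> cochains d M 0 \<Longrightarrow> f [] = \<one> \<Longrightarrow> f = (\<lambda>l. \<one>)"
  by (rule ext) (metis (mono_tags, lifting) cochains_def length_0_conv mem_Collect_eq valid_tuple_def)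

text \<open>As 1 - t is invertible on values, a cocycle has the form (1 - t) \<psi>. The coboundary
  of \<psi> is fixed by \<open>t\<close>, hence trivial, so \<psi> is a cocycle and
  \<open>translate_cocycle\<close> makes (1 - t) \<psi> a coboundary. In degree 0 the only
  coboundary is trivial, and injectivity alone does it.\<close>

theorem cocycles_subset_coboundaries_if_bij:
  assumes t: "t \<in> Zd d"
    and surj: "\<And>x. x \<in> carrier M \<Longrightarrow> \<exists>y\<in>carrier M. y \<otimes> inv (ma t y) = x"
    and inj: "\<And>y. y \<in> carrier M \<Longrightarrow> ma t y = y \<Longrightarrow> y = \<one>"
  shows "cocycles d M ma n \<subseteq> coboundaries d M ma n"
proof
  fix f assume f: "f \<in> cocycles d M ma n"
  then have fc: "f \<in> cochains d M n" and df: "\<delta> n f = (\<lambda>l. \<one>)" by (auto simp: cocycles_def)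
  show "f \<in> coboundaries d M ma n"
  proof (cases n)
    case 0
    then have "f [] = \<one>" using f t inj cochain_closed[OF fc] by (auto simp: cocycles_0_iff)
    then show ?thesis using cochains_0_eq_one fc 0 by (auto simp: coboundaries_def)
  next
    case (Suc m)
    define \<psi> where "\<psi> = (\<lambda>l. if valid_tuple d n l then SOME y. y \<in> carrier M \<and> y \<otimes> inv (ma t y) = f l else \<one>)"
    have \<psi>v: "\<psi> l \<in> carrier M \<and> \<psi> l \<otimes> inv (ma t (\<psi> l)) = f l" if "valid_tuple d n l" for l
      using someI_ex[of "\<lambda>y. y \<in> carrier M \<and> y \<otimes> inv (ma t y) = f l"] surj[OF cochain_closed[OF fc]] that
      unfolding \<psi>_def by auto
    have \<psi>: "\<psi> \<in> cochains d M n" using \<psi>v by (auto simp: cochains_def \<psi>_def)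
    note \<psi>c = cochain_closed[OF \<psi>]
    have \<psi>f: "\<psi> l \<otimes> inv (ma t (\<psi> l)) = f l" for l
      using \<psi>v[of l] fc t by (cases "valid_tuple d n l") (auto simp: \<psi>_def cochains_def)
    have hom: "(\<lambda>x. x \<otimes> inv (ma t x)) \<in> hom M M"
      using t by (auto simp: hom_def ma_mult inv_mult m_ac)
    have "\<delta> n f = (\<lambda>gs. \<delta> n \<psi> gs \<otimes> inv (ma t (\<delta> n \<psi> gs)))"
      using coboundary_natural[OF gmodule_axioms gmodule_axioms hom, of \<psi> n] t \<psi>c
      by (simp add: \<psi>f ma_mult ma_inv ma_vadd vadd_commute)
    then have "\<delta> n \<psi> gs \<otimes> inv (ma t (\<delta> n \<psi> gs)) = \<one>" for gs
      using df by (simp add: fun_eq_iff)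
    then have "ma t (\<delta> n \<psi> gs) = \<delta> n \<psi> gs" for gs
      using \<delta>_closed[of \<psi> n gs, OF \<psi>c] t mult_inv_eq_one_iff[of "\<delta> n \<psi> gs" "ma t (\<delta> n \<psi> gs)"] by simp
    then have "\<delta> n \<psi> gs = \<one>" for gs using inj \<delta>_closed[of \<psi> n gs, OF \<psi>c] by simp
    then have "\<delta> n \<psi> = (\<lambda>l. \<one>)" by (rule ext)
    then have "\<psi> \<in> cocycles d M ma (Suc m)" using \<psi> Suc by (simp add: cocycles_def)
    then obtain k where k: "k \<in> cochains d M m"
      and dk: "\<And>gs. valid_tuple d (Suc m) gs \<Longrightarrow> \<delta> m k gs = ma t (\<psi> gs) \<otimes> inv \<psi> gs"
      using translate_cocycle t by blast
    \<comment> \<open>\<open>dk\<close> describes (t - 1) \<psi>, whereas \<open>f\<close> is (1 -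
      t) \<psi>; hence the inverse.\<close>
    have "f = \<delta> m (\<lambda>l. inv k l)"
    proof
      fix gs
      have "inv (\<delta> m k gs) = f gs"
      proof (cases "valid_tuple d (Suc m) gs")
        case True
        then show ?thesis unfolding dk[OF True] \<psi>f[symmetric] using \<psi>c t by (simp add: inv_mult m_comm)
      next
        case False
        then show ?thesis using fc Suc by (simp add: coboundary_invalid cochains_def)
      qed
      then show "f gs = \<delta> m (\<lambda>l. inv k l) gs"
        using \<delta>_inv[of k m] cochain_closed[OF k] by simp
    qed
    then show ?thesis
      using cochains_in_inv[OF gsub_carrier, of k m] k Suc by (auto simp: coboundaries_def cochains_in_carrier)
  qed
qed

end

text \<open>Exactness of H^(n+1)(N') -> H^(n+2)(K) -> H^(n+2)(N) with both outer groups zero.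
  Degrees for \<open>K\<close> start at 2 because vanishing for \<open>N'\<close> will be available
  in positive degrees only.\<close>

lemma cocycles_kernel_subset_coboundaries:
  assumes N: "gmodule N d ma" and N': "gmodule N' d mb" and \<theta>: "\<theta> \<in> hom N N'"
    and eq: "\<And>g x. g \<in> Zd d \<Longrightarrow> x \<in> carrier N \<Longrightarrow> \<theta> (ma g x) = mb g (\<theta> x)"
    and surj: "\<theta> ` carrier N = carrier N'"
    and zN: "cocycles d N ma (Suc (Suc n)) \<subseteq> coboundaries d N ma (Suc (Suc n))"
    and zN': "cocycles d N' mb (Suc n) \<subseteq> coboundaries d N' mb (Suc n)"
    and K: "K = {x \<in> carrier N. \<theta> x = \<one>\<^bsub>N'\<^esub>}"
  shows "cocycles d (N\<lparr>carrier := K\<rparr>) ma (Suc (Suc n)) \<subseteq> coboundaries d (N\<lparr>carrier := K\<rparr>) ma (Suc (Suc n))"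
proof
  interpret N: gmodule N d ma by (rule N)
  interpret N': gmodule N' d mb by (rule N')
  interpret \<theta>: group_hom N N' \<theta> by (simp add: group_hom_def group_hom_axioms_def \<theta>)
  have gK: "N.gsub K"
  proof -
    have "subgroup K N" using \<theta>.subgroup_kernel by (simp add: K kernel_def)
    moreover have "ma g x \<in> K" if "g \<in> Zd d" "x \<in> K" for g x
      using that eq[of g x] by (simp add: K)
    ultimately show ?thesis by (simp add: N.gsub_def)
  qed
  have nat: "coboundary d N' mb k (\<lambda>l. \<theta> (f l)) gs = \<theta> (N.\<delta> k f gs)" if "\<And>l. f l \<in> carrier N" for f k gs
    using coboundary_natural[OF N N' \<theta>, of f k] eq that by simp
  fix f assume f: "f \<in> cocycles d (N\<lparr>carrier := K\<rparr>) ma (Suc (Suc n))"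
  then have fK: "f \<in> N.cochains_in K (Suc (Suc n))" and df: "N.\<delta> (Suc (Suc n)) f = (\<lambda>l. \<one>\<^bsub>N\<^esub>)"
    unfolding N.cocycles_in_iff[OF gK] by blast+
  have "f \<in> cocycles d N ma (Suc (Suc n))"
    using fK df N.cochains_in_mono[of K "carrier N"] by (auto simp: cocycles_def N.cochains_in_carrier K)
  then obtain a where a: "a \<in> cochains d N (Suc n)" and fa: "f = N.\<delta> (Suc n) a"
    using zN by (auto simp: coboundaries_def)
  note ac = N.cochain_closed[OF a]
  have "(\<lambda>l. \<theta> (a l)) \<in> cocycles d N' mb (Suc n)"
  proof -
    have "\<theta> (N.\<delta> (Suc n) a gs) = \<one>\<^bsub>N'\<^esub>" for gs
      using N.cochains_in_mem[OF gK fK, of gs] by (simp add: fa K)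
    then have "coboundary d N' mb (Suc n) (\<lambda>l. \<theta> (a l)) = (\<lambda>l. \<one>\<^bsub>N'\<^esub>)"
      using nat[of a "Suc n", OF ac] by (simp add: fun_eq_iff)
    moreover have "(\<lambda>l. \<theta> (a l)) \<in> cochains d N' (Suc n)"
      using a by (simp add: cochains_def)
    ultimately show ?thesis by (simp add: cocycles_def)
  qed
  then obtain b' where b': "b' \<in> cochains d N' n" and ab': "(\<lambda>l. \<theta> (a l)) = coboundary d N' mb n b'"
    using zN' by (auto simp: coboundaries_def)
  \<comment> \<open>A lift of \<open>b'\<close> through \<open>\<theta>\<close>, value by value; it
    must be \<open>\<one>\<close> off the valid tuples for \<open>b\<close> to be a cochain.\<close>
  have "\<exists>y. y \<in> carrier N \<and> \<theta> y = b' l \<and> (\<not> valid_tuple d n l \<longrightarrow> y = \<one>\<^bsub>N\<^esub>)" for l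
  proof (cases "valid_tuple d n l")
    case True
    have "b' l \<in> \<theta> ` carrier N" using N'.cochain_closed[OF b', of l] surj by simp
    then show ?thesis using True by auto
  next
    case False
    then show ?thesis using b' by (intro exI[of _ "\<one>\<^bsub>N\<^esub>"]) (simp add: cochains_def)
  qed
  then obtain b where b: "\<And>l. b l \<in> carrier N" "\<And>l. \<theta> (b l) = b' l"
    "\<And>l. \<not> valid_tuple d n l \<Longrightarrow> b l = \<one>\<^bsub>N\<^esub>" by metis
  \<comment> \<open>Subtracting the coboundary of the lift moves \<open>a\<close> into the kernel
    without changing its coboundary \<open>f\<close>.\<close>
  define c where "c = (\<lambda>l. a l \<otimes>\<^bsub>N\<^esub> inv\<^bsub>N\<^esub> N.\<delta> n b l)"
  have dbc: "N.\<delta> n b l \<in> carrier N" for l using N.\<delta>_closed[of b n l] b by blast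
  have "\<theta> (c l) = \<one>\<^bsub>N'\<^esub>" for l
  proof -
    have "\<theta> (N.\<delta> n b l) = \<theta> (a l)"
      using nat[of b n l, OF b(1)] b(2) fun_cong[OF ab', of l] by simp
    then show ?thesis using ac dbc by (simp add: c_def)
  qed
  then have "c \<in> N.cochains_in K (Suc n)"
    using a ac dbc by (auto simp: N.cochains_in_iff K c_def coboundary_invalid cochains_def)
  moreover have "N.\<delta> (Suc n) c = f"
    unfolding c_def N.\<delta>_diff[of a "N.\<delta> n b", OF ac dbc] fa
    using N.coboundary_coboundary[of b n] b N.\<delta>_closed[of a "Suc n"] ac by simp
  ultimately show "f \<in> coboundaries d (N\<lparr>carrier := K\<rparr>) ma (Suc (Suc n))"
    using N.coboundaries_in_Suc[OF gK] by blast
qed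

subsection \<open>Dimension shifting\<close>

text \<open>\<open>\<theta>\<close> induces an isomorphism from the cohomology in degree \<open>n\<close> onto \<open>H\<close>; phrasing this
  on cocycles keeps cosets out of the dimension shift.\<close>

definition cohom_rep :: "nat \<Rightarrow> ('m, 'b) monoid_scheme \<Rightarrow> ((nat \<Rightarrow> int) \<Rightarrow> 'm \<Rightarrow> 'm) \<Rightarrow> nat
    \<Rightarrow> ('x, 'c) monoid_scheme \<Rightarrow> (((nat \<Rightarrow> int) list \<Rightarrow> 'm) \<Rightarrow> 'x) \<Rightarrow> bool" where
  "cohom_rep d M ma n H \<theta> \<longleftrightarrow>
     (\<forall>f\<in>cocycles d M ma n. \<forall>h\<in>cocycles d M ma n. \<theta> (\<lambda>l. f l \<otimes>\<^bsub>M\<^esub> h l) = \<theta> f \<otimes>\<^bsub>H\<^esub> \<theta> h) \<and>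
     \<theta> ` cocycles d M ma n = carrier H \<and>
     (\<forall>f\<in>cocycles d M ma n. \<theta> f = \<one>\<^bsub>H\<^esub> \<longleftrightarrow> f \<in> coboundaries d M ma n)"

context gmodule
begin

lemma cocycles_iff: "f \<in> cocycles d M ma n \<longleftrightarrow> f \<in> cochains d M n \<and> \<delta> n f = (\<lambda>l. \<one>)"
  by (auto simp: cocycles_def)

lemma coboundaries_subset_cocycles: "coboundaries d M ma n \<subseteq> cocycles d M ma n"
proof (cases n)
  case 0
  then show ?thesis
    using cochains_in_one[OF gsub_carrier] \<delta>_one by (auto simp: coboundaries_def cocycles_iff cochains_in_carrier)
next
  case (Suc m)
  have "\<delta> m k \<in> cocycles d M ma (Suc m)" if "k \<in> cochains d M m" for k
    using coboundary_coboundary[of k m] coboundary_cochain[of k m] cochain_closed[OF that]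
    by (simp add: cocycles_iff)
  then show ?thesis by (auto simp: coboundaries_def Suc)
qed

lemma one_coboundary: "(\<lambda>l. \<one>) \<in> coboundaries d M ma n"
proof (cases n)
  case (Suc m)
  have "\<delta> m (\<lambda>l. \<one>) = (\<lambda>l. \<one>)" by (rule \<delta>_one)
  then show ?thesis
    using cochains_in_one[OF gsub_carrier, of m] Suc
    by (auto simp: coboundaries_def cochains_in_carrier image_iff intro!: bexI[of _ "\<lambda>l. \<one>"])
qed (simp add: coboundaries_def)

lemma group_cocycles: "group ((cochain_grp d M n)\<lparr>carrier := cocycles d M ma n\<rparr>)" (is "group ?Z")
proof (rule groupI)
  have cl: "f l \<in> carrier M" if "f \<in> cocycles d M ma n" for f l
    using that cochain_closed by (auto simp: cocycles_iff)
  note defs = cochain_grp_def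
  show "\<one>\<^bsub>?Z\<^esub> \<in> carrier ?Z"
    using one_coboundary coboundaries_subset_cocycles by (auto simp: defs)
  fix x assume x: "x \<in> carrier ?Z"
  show "\<one>\<^bsub>?Z\<^esub> \<otimes>\<^bsub>?Z\<^esub> x = x" using x cl by (simp add: defs)
  have "(\<lambda>l. inv x l) \<in> cocycles d M ma n"
    using x cochains_in_inv[OF gsub_carrier, of x n] \<delta>_inv[of x n] cl[of x]
    by (simp add: defs cocycles_iff cochains_in_carrier)
  moreover have "(\<lambda>l. inv x l \<otimes> x l) = (\<lambda>l. \<one>)" using x cl by (simp add: defs)
  ultimately show "\<exists>y\<in>carrier ?Z. y \<otimes>\<^bsub>?Z\<^esub> x = \<one>\<^bsub>?Z\<^esub>"
    by (auto simp: defs intro!: bexI[of _ "\<lambda>l. inv x l"])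
  fix y assume y: "y \<in> carrier ?Z"
  show "x \<otimes>\<^bsub>?Z\<^esub> y \<in> carrier ?Z"
    using x y cochains_in_mult[OF gsub_carrier, of x n y] coboundary_mult[of x y n] cl[of x] cl[of y]
    by (simp add: defs cocycles_iff cochains_in_carrier)
  fix z assume z: "z \<in> carrier ?Z"
  show "x \<otimes>\<^bsub>?Z\<^esub> y \<otimes>\<^bsub>?Z\<^esub> z = x \<otimes>\<^bsub>?Z\<^esub> (y \<otimes>\<^bsub>?Z\<^esub> z)"
    using x y z cl by (simp add: defs m_assoc)
qed

lemma group_cohomology_iso:
  assumes rep: "cohom_rep d M ma n H \<theta>" and H: "group H"
  shows "group_cohomology d M ma n \<cong> H"
proof -
  let ?Z = "(cochain_grp d M n)\<lparr>carrier := cocycles d M ma n\<rparr>"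
  interpret Z: group ?Z by (rule group_cocycles)
  interpret H: group H by (rule H)
  have "\<theta> \<in> hom ?Z H"
    using rep by (auto simp: hom_def cohom_rep_def cochain_grp_def)
  then interpret \<theta>: group_hom ?Z H \<theta>
    by (simp add: group_hom_def group_hom_axioms_def Z.is_group H)
  have "kernel ?Z H \<theta> = coboundaries d M ma n"
    using rep coboundaries_subset_cocycles[of n] by (auto simp: kernel_def cohom_rep_def)
  moreover have "\<theta> ` carrier ?Z = carrier H"
    using rep by (simp add: cohom_rep_def)
  ultimately show ?thesis
    using \<theta>.FactGroup_iso_set unfolding group_cohomology_def is_iso_def by auto
qed

lemma group_cohomology_trivial:
  assumes "cocycles d M ma n \<subseteq> coboundaries d M ma n"
  shows "carrier (group_cohomology d M ma n) = {\<one>\<^bsub>group_cohomology d M ma n\<^esub>}"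
proof -
  let ?Z = "(cochain_grp d M n)\<lparr>carrier := cocycles d M ma n\<rparr>"
  interpret Z: group ?Z by (rule group_cocycles)
  have eq: "coboundaries d M ma n = carrier ?Z"
    using assms coboundaries_subset_cocycles by auto
  have "rcosets\<^bsub>?Z\<^esub> (carrier ?Z) = {carrier ?Z}"
    using Z.coset_join2[OF _ Z.subgroup_self] Z.one_closed
    unfolding RCOSETS_def by blast
  then show ?thesis
    unfolding group_cohomology_def eq by (simp only: FactGroup_def partial_object.simps monoid.simps)
qed

text \<open>The identity behind well-definedness of the connecting map: replacing (a, b) by (a', b')
  changes a - b by a difference within each component.\<close>

lemma diff_of_diff:
  assumes "a \<in> carrier M" "b \<in> carrier M" "a' \<in> carrier M" "b' \<in> carrier M"
  shows "(a \<otimes> inv a') \<otimes> inv (b \<otimes> inv b') \<otimes> (a' \<otimes> inv b') = a \<otimes> inv b"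
proof -
  have "(a \<otimes> inv a') \<otimes> inv (b \<otimes> inv b') \<otimes> (a' \<otimes> inv b') = (a \<otimes> inv b) \<otimes> ((a' \<otimes> inv a') \<otimes> (b' \<otimes> inv b'))"
    using assms by (simp add: m_ac inv_mult del: r_inv l_inv Units_r_inv Units_l_inv)
  then show ?thesis using assms by simp
qed

text \<open>The connecting homomorphism of \<open>0 \<rightarrow> P \<inter> Q \<rightarrow> P \<oplus> Q \<rightarrow> M \<rightarrow> 0\<close>: a cocycle in
  \<open>P \<inter> Q\<close> is \<open>\<delta> a = \<delta> b\<close> with \<open>a\<close> in \<open>P\<close> and \<open>b\<close> in \<open>Q\<close>, and it is sent to \<open>a - b\<close>.\<close>

theorem dimension_shift:
  assumes P: "gsub P" and Q: "gsub Q"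
    and zP: "\<And>n. cocycles d (M\<lparr>carrier := P\<rparr>) ma n \<subseteq> coboundaries d (M\<lparr>carrier := P\<rparr>) ma n"
    and zQ: "\<And>n. cocycles d (M\<lparr>carrier := Q\<rparr>) ma n \<subseteq> coboundaries d (M\<lparr>carrier := Q\<rparr>) ma n"
    and split: "\<And>x. x \<in> carrier M \<Longrightarrow> \<exists>p\<in>P. \<exists>q\<in>Q. x = p \<otimes> inv q"
    and H: "group H" and rep: "cohom_rep d M ma n H \<theta>"
  shows "\<exists>\<theta>'. cohom_rep d (M\<lparr>carrier := P \<inter> Q\<rparr>) ma (Suc n) H \<theta>'"
proof -
  interpret H: group H by (rule H)
  have PQ: "gsub (P \<inter> Q)" by (rule gsub_Int[OF P Q])
  note Pc = cochains_in_closed[OF P] and Qc = cochains_in_closed[OF Q]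
  let ?sub = "\<lambda>a b l. a l \<otimes> inv b l"
  have PM: "a \<in> cochains d M n" if "a \<in> cochains_in P n" for a n
    using that cochains_in_mono[of P "carrier M" a n] gsub_subset[OF P] by (auto simp: cochains_in_carrier)
  have QM: "a \<in> cochains d M n" if "a \<in> cochains_in Q n" for a n
    using that cochains_in_mono[of Q "carrier M" a n] gsub_subset[OF Q] by (auto simp: cochains_in_carrier)
  have subM: "?sub a b \<in> cochains d M n" if "a \<in> cochains d M n" "b \<in> cochains d M n" for a b n
    using cochains_in_mult[OF gsub_carrier _ cochains_in_inv[OF gsub_carrier]] that
    by (simp add: cochains_in_carrier)
  have subS: "?sub a b \<in> cochains_in S n" if "gsub S" "a \<in> cochains_in S n" "b \<in> cochains_in S n" for a b n S
    using cochains_in_mult[OF that(1,2) cochains_in_inv[OF that(1,3)]] by simp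
  \<comment> \<open>Splitting value by value suffices because an inhomogeneous cochain obeys no
    equivariance condition. Invalid tuples get the pair of units.\<close>
  have splitc: "\<exists>p\<in>cochains_in P m. \<exists>q\<in>cochains_in Q m. z = ?sub p q" if z: "z \<in> cochains d M m" for z m
  proof -
    have "\<exists>p q. p \<in> P \<and> q \<in> Q \<and> z l = p \<otimes> inv q \<and> (\<not> valid_tuple d m l \<longrightarrow> p = \<one> \<and> q = \<one>)" for l
    proof (cases "valid_tuple d m l")
      case True
      then show ?thesis using split[OF cochain_closed[OF z, of l]] by blast
    next
      case False
      then have "z l = \<one>" using z by (simp add: cochains_def)
      then show ?thesis using gsub_one[OF P] gsub_one[OF Q] by (intro exI[of _ \<one>]) simp
    qed
    then obtain p q where "\<And>l. p l \<in> P" "\<And>l. q l \<in> Q" "\<And>l. z l = p l \<otimes> inv q l"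
      "\<And>l. \<not> valid_tuple d m l \<Longrightarrow> p l = \<one> \<and> q l = \<one>" by metis
    then have "p \<in> cochains_in P m" "q \<in> cochains_in Q m" "z = ?sub p q"
      by (auto simp: cochains_in_iff)
    then show ?thesis by blast
  qed
  have \<theta>_mult: "\<theta> (\<lambda>l. f l \<otimes> h l) = \<theta> f \<otimes>\<^bsub>H\<^esub> \<theta> h" if "f \<in> cocycles d M ma n" "h \<in> cocycles d M ma n" for f h
    using rep that by (auto simp: cohom_rep_def)
  have \<theta>_in: "\<theta> f \<in> carrier H" if "f \<in> cocycles d M ma n" for f
    using rep that by (auto simp: cohom_rep_def)
  have \<theta>_one: "\<theta> f = \<one>\<^bsub>H\<^esub> \<longleftrightarrow> f \<in> coboundaries d M ma n" if "f \<in> cocycles d M ma n" for f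
    using rep that by (auto simp: cohom_rep_def)
  have cocyc: "?sub a b \<in> cocycles d M ma n"
    if "a \<in> cochains_in P n" "b \<in> cochains_in Q n" "\<delta> n a = \<delta> n b" for a b
  proof -
    have "\<delta> n (?sub a b) = (\<lambda>l. \<one>)"
      unfolding \<delta>_diff[of a b, OF Pc[OF that(1)] Qc[OF that(2)]] that(3)
      using \<delta>_closed[of b n, OF Qc[OF that(2)]] by simp
    then show ?thesis using subM[OF PM[OF that(1)] QM[OF that(2)]] by (simp add: cocycles_iff)
  qed
  \<comment> \<open>The source of uniqueness: by acyclicity the two cocycles have primitives in
    \<open>P\<close> and in \<open>Q\<close>, whose difference is a primitive in \<open>M\<close>;
    in degree 0 both are trivial.\<close>
  have triv: "?sub a b \<in> coboundaries d M ma n"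
    if a: "a \<in> cochains_in P n" "\<delta> n a = (\<lambda>l. \<one>)" and b: "b \<in> cochains_in Q n" "\<delta> n b = (\<lambda>l. \<one>)" for a b
  proof -
    have a': "a \<in> coboundaries d (M\<lparr>carrier := P\<rparr>) ma n"
      using zP[of n] a cocycles_in_iff[OF P] by auto
    have b': "b \<in> coboundaries d (M\<lparr>carrier := Q\<rparr>) ma n"
      using zQ[of n] b cocycles_in_iff[OF Q] by auto
    show ?thesis
    proof (cases n)
      case 0
      then show ?thesis using a' b' coboundaries_in_0 by (simp add: coboundaries_def)
    next
      case (Suc m)
      obtain u v where u: "u \<in> cochains_in P m" "a = \<delta> m u" and v: "v \<in> cochains_in Q m" "b = \<delta> m v"
        using a' b' coboundaries_in_Suc[OF P] coboundaries_in_Suc[OF Q] unfolding Suc by blast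
      have "?sub a b = \<delta> m (?sub u v)"
        unfolding \<delta>_diff[of u v, OF Pc[OF u(1)] Qc[OF v(1)]] u(2) v(2) ..
      moreover have "?sub u v \<in> cochains d M m"
        by (rule subM[OF PM[OF u(1)] QM[OF v(1)]])
      ultimately show ?thesis by (simp add: coboundaries_def Suc)
    qed
  qed
  define R where "R f a b \<longleftrightarrow> a \<in> cochains_in P n \<and> b \<in> cochains_in Q n \<and> \<delta> n a = f \<and> \<delta> n b = f" for f a b
  have well: "\<theta> (?sub a b) = \<theta> (?sub a' b')" if r: "R f a b" "R f a' b'" for f a b a' b'
  proof -
    have in1: "a \<in> cochains_in P n" "a' \<in> cochains_in P n" "b \<in> cochains_in Q n" "b' \<in> cochains_in Q n"
      and d1: "\<delta> n a = f" "\<delta> n a' = f" "\<delta> n b = f" "\<delta> n b' = f"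
      using r by (auto simp: R_def)
    note cl = Pc[OF in1(1)] Pc[OF in1(2)] Qc[OF in1(3)] Qc[OF in1(4)]
    have dcl: "f l \<in> carrier M" for l using \<delta>_closed[of a n l, OF cl(1)] d1 by simp
    have da: "\<delta> n (?sub a a') = (\<lambda>l. \<one>)"
      unfolding \<delta>_diff[of a a', OF cl(1,2)] d1 using dcl by simp
    have db: "\<delta> n (?sub b b') = (\<lambda>l. \<one>)"
      unfolding \<delta>_diff[of b b', OF cl(3,4)] d1 using dcl by simp
    have cob: "?sub (?sub a a') (?sub b b') \<in> coboundaries d M ma n"
      by (rule triv[OF subS[OF P in1(1,2)] da subS[OF Q in1(3,4)] db])
    have cyc: "?sub (?sub a a') (?sub b b') \<in> cocycles d M ma n"
      using cob coboundaries_subset_cocycles by blast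
    have c': "?sub a' b' \<in> cocycles d M ma n" using cocyc[OF in1(2,4)] d1 by simp
    have "?sub a b = (\<lambda>l. ?sub (?sub a a') (?sub b b') l \<otimes> ?sub a' b' l)"
      using diff_of_diff[OF cl(1) cl(3) cl(2) cl(4)] by simp
    then have "\<theta> (?sub a b) = \<theta> (?sub (?sub a a') (?sub b b')) \<otimes>\<^bsub>H\<^esub> \<theta> (?sub a' b')"
      by (simp only: \<theta>_mult[OF cyc c'])
    also have "\<theta> (?sub (?sub a a') (?sub b b')) = \<one>\<^bsub>H\<^esub>"
      using \<theta>_one[OF cyc] cob by blast
    finally show ?thesis using \<theta>_in[OF c'] by simp
  qed
  let ?Z = "cocycles d (M\<lparr>carrier := P \<inter> Q\<rparr>) ma (Suc n)"
  have ex: "\<exists>a b. R f a b" if f: "f \<in> ?Z" for f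
  proof -
    have f': "f \<in> cochains_in (P \<inter> Q) (Suc n)" "\<delta> (Suc n) f = (\<lambda>l. \<one>)"
      using f unfolding cocycles_in_iff[OF PQ] by blast+
    have "f \<in> cochains_in P (Suc n)" "f \<in> cochains_in Q (Suc n)"
      using f'(1) cochains_in_mono[of "P \<inter> Q"] by blast+
    then have "f \<in> coboundaries d (M\<lparr>carrier := P\<rparr>) ma (Suc n)" "f \<in> coboundaries d (M\<lparr>carrier := Q\<rparr>) ma (Suc n)"
      using zP[of "Suc n"] zQ[of "Suc n"] f'(2) cocycles_in_iff[OF P] cocycles_in_iff[OF Q] by blast+
    then obtain a b where "a \<in> cochains_in P n" "f = \<delta> n a" "b \<in> cochains_in Q n" "f = \<delta> n b"
      unfolding coboundaries_in_Suc[OF P] coboundaries_in_Suc[OF Q] by (elim bexE)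
    then have "R f a b" by (simp add: R_def)
    then show ?thesis by (intro exI)
  qed
  \<comment> \<open>The definition chooses a pair (a, b); by \<open>well\<close> the value does not
    depend on the choice.\<close>
  define \<theta>' where "\<theta>' f = (SOME x. \<exists>a b. R f a b \<and> x = \<theta> (?sub a b))" for f
  have \<theta>': "\<theta>' f = \<theta> (?sub a b)" if r: "R f a b" for f a b
    unfolding \<theta>'_def
  proof (rule some_equality)
    show "\<exists>a' b'. R f a' b' \<and> \<theta> (?sub a b) = \<theta> (?sub a' b')" using r by blast
  qed (use well[OF _ r] in blast)
  have "cohom_rep d (M\<lparr>carrier := P \<inter> Q\<rparr>) ma (Suc n) H \<theta>'"
    unfolding cohom_rep_def
  proof (intro conjI ballI)
    fix f h assume f: "f \<in> ?Z" and h: "h \<in> ?Z"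
    obtain a b a' b' where r: "R f a b" and r': "R h a' b'" using ex[OF f] ex[OF h] by blast
    have in1: "a \<in> cochains_in P n" "a' \<in> cochains_in P n" "b \<in> cochains_in Q n" "b' \<in> cochains_in Q n"
      and d1: "\<delta> n a = f" "\<delta> n a' = h" "\<delta> n b = f" "\<delta> n b' = h"
      using r r' by (auto simp: R_def)
    note cl = Pc[OF in1(1)] Pc[OF in1(2)] Qc[OF in1(3)] Qc[OF in1(4)]
    have rr: "R (\<lambda>l. f l \<otimes> h l) (\<lambda>l. a l \<otimes> a' l) (\<lambda>l. b l \<otimes> b' l)"
      unfolding R_def coboundary_mult[of a a', OF cl(1,2)] coboundary_mult[of b b', OF cl(3,4)] d1
      using cochains_in_mult[OF P in1(1,2)] cochains_in_mult[OF Q in1(3,4)] by simp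
    have "?sub (\<lambda>l. a l \<otimes> a' l) (\<lambda>l. b l \<otimes> b' l) = (\<lambda>l. ?sub a b l \<otimes> ?sub a' b' l)"
      using cl by (simp add: inv_mult m_ac)
    then show "\<theta>' (\<lambda>l. f l \<otimes>\<^bsub>M\<lparr>carrier := P \<inter> Q\<rparr>\<^esub> h l) = \<theta>' f \<otimes>\<^bsub>H\<^esub> \<theta>' h"
      using \<theta>'[OF r] \<theta>'[OF r'] \<theta>'[OF rr] \<theta>_mult[OF cocyc[OF in1(1,3)] cocyc[OF in1(2,4)]] d1 by simp
  next
    show "\<theta>' ` ?Z = carrier H"
    proof (intro equalityI subsetI)
      fix x assume "x \<in> \<theta>' ` ?Z"
      then obtain f where f: "f \<in> ?Z" "x = \<theta>' f" by blast
      obtain a b where r: "R f a b" using ex[OF f(1)] by blast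
      then show "x \<in> carrier H"
        using \<theta>'[OF r] f(2) \<theta>_in[OF cocyc] by (simp add: R_def)
    next
      fix x assume "x \<in> carrier H"
      then have "x \<in> \<theta> ` cocycles d M ma n"
        using rep by (simp add: cohom_rep_def)
      then obtain z where z: "z \<in> cocycles d M ma n" "x = \<theta> z" by blast
      then have zc: "z \<in> cochains d M n" and dz: "\<delta> n z = (\<lambda>l. \<one>)" by (simp_all add: cocycles_iff)
      \<comment> \<open>Any splitting of a cocycle of \<open>M\<close> gives a preimage: as a - b is
        closed, \<open>a\<close> and \<open>b\<close> have the same coboundary, which therefore lies
        in both \<open>P\<close> and \<open>Q\<close>.\<close>
      obtain a b where a: "a \<in> cochains_in P n" and b: "b \<in> cochains_in Q n" and zab: "z = ?sub a b"
        using splitc[OF zc] by blast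
      have "\<delta> n a l \<otimes> inv \<delta> n b l = \<one>" for l
        using dz unfolding zab \<delta>_diff[of a b, OF Pc[OF a] Qc[OF b]] by (simp add: fun_eq_iff)
      then have "\<delta> n a l = \<delta> n b l" for l
        using \<delta>_closed[of a n l, OF Pc[OF a]] \<delta>_closed[of b n l, OF Qc[OF b]] mult_inv_eq_one_iff by blast
      then have dab: "\<delta> n a = \<delta> n b" by (rule ext)
      have r: "R (\<delta> n a) a b" using a b dab by (simp add: R_def)
      have "\<delta> n a \<in> cochains_in (P \<inter> Q) (Suc n)"
        using \<delta>_in[OF P a] \<delta>_in[OF Q b] unfolding dab cochains_in_iff by blast
      then have "\<delta> n a \<in> ?Z"
        using coboundary_coboundary[of a n, OF Pc[OF a]] by (simp add: cocycles_in_iff[OF PQ])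
      then show "x \<in> \<theta>' ` ?Z" using \<theta>'[OF r] z(2) zab by (intro image_eqI[of _ _ "\<delta> n a"]) simp_all
    qed
  next
    fix f assume f: "f \<in> ?Z"
    obtain a b where r: "R f a b" using ex[OF f] by blast
    have in1: "a \<in> cochains_in P n" "b \<in> cochains_in Q n" and d1: "\<delta> n a = f" "\<delta> n b = f"
      using r by (auto simp: R_def)
    note cl = Pc[OF in1(1)] Qc[OF in1(2)]
    show "\<theta>' f = \<one>\<^bsub>H\<^esub> \<longleftrightarrow> f \<in> coboundaries d (M\<lparr>carrier := P \<inter> Q\<rparr>) ma (Suc n)"
    proof
      assume "\<theta>' f = \<one>\<^bsub>H\<^esub>"
      then have cob: "?sub a b \<in> coboundaries d M ma n"
        using \<theta>'[OF r] \<theta>_one[OF cocyc[OF in1]] d1 by simp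
      \<comment> \<open>A primitive of a - b is split too, so that a - b = u - v with cocycles
        \<open>u\<close> in \<open>P\<close> and \<open>v\<close> in \<open>Q\<close>. Then a - u =
        b - v lies in the intersection and still has coboundary \<open>f\<close>.\<close>
      have "\<exists>u\<in>cochains_in P n. \<exists>v\<in>cochains_in Q n. \<delta> n u = (\<lambda>l. \<one>) \<and> \<delta> n v = (\<lambda>l. \<one>) \<and> ?sub a b = ?sub u v"
      proof (cases n)
        case 0
        then show ?thesis
          using cob cochains_in_one[OF P, of n] cochains_in_one[OF Q, of n] \<delta>_one
          by (intro bexI[of _ "\<lambda>l. \<one>"]) (auto simp: coboundaries_def)
      next
        case (Suc m)
        then obtain c where c: "c \<in> cochains d M m" "?sub a b = \<delta> m c"
          using cob by (auto simp: coboundaries_def)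
        obtain u v where u: "u \<in> cochains_in P m" and v: "v \<in> cochains_in Q m" and cuv: "c = ?sub u v"
          using splitc[OF c(1)] by blast
        have "?sub a b = ?sub (\<delta> m u) (\<delta> m v)"
          unfolding c(2) cuv \<delta>_diff[of u v, OF Pc[OF u] Qc[OF v]] ..
        then show ?thesis
          using \<delta>_in[OF P u] \<delta>_in[OF Q v] coboundary_coboundary[of u m, OF Pc[OF u]]
            coboundary_coboundary[of v m, OF Qc[OF v]] unfolding Suc by blast
      qed
      then obtain u v where u: "u \<in> cochains_in P n" "\<delta> n u = (\<lambda>l. \<one>)" and v: "v \<in> cochains_in Q n" "\<delta> n v = (\<lambda>l. \<one>)"
        and uv: "?sub a b = ?sub u v" by blast
      have "a l \<otimes> inv u l = b l \<otimes> inv v l" for l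
      proof -
        note c = cl(1)[of l] cl(2)[of l] Pc[OF u(1), of l] Qc[OF v(1), of l]
        have "a l = b l \<otimes> (a l \<otimes> inv b l)" using c by (simp add: m_lcomm)
        also have "\<dots> = b l \<otimes> (u l \<otimes> inv v l)" using uv by (metis (no_types))
        also have "\<dots> = (b l \<otimes> inv v l) \<otimes> u l" using c by (simp add: m_ac)
        finally show ?thesis using c by (simp add: m_assoc)
      qed
      then have eq: "?sub a u = ?sub b v" by (rule ext)
      have "?sub a u \<in> cochains_in (P \<inter> Q) n"
        using subS[OF P in1(1) u(1)] subS[OF Q in1(2) v(1)] unfolding eq cochains_in_iff by blast
      moreover have "f = \<delta> n (?sub a u)"
        unfolding \<delta>_diff[of a u, OF cl(1) Pc[OF u(1)]] u(2) d1
        using \<delta>_closed[of a n, OF cl(1)] d1 by simp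
      ultimately show "f \<in> coboundaries d (M\<lparr>carrier := P \<inter> Q\<rparr>) ma (Suc n)"
        unfolding coboundaries_in_Suc[OF PQ] by blast
    next
      assume "f \<in> coboundaries d (M\<lparr>carrier := P \<inter> Q\<rparr>) ma (Suc n)"
      then obtain e where e: "e \<in> cochains_in (P \<inter> Q) n" and fe: "f = \<delta> n e"
        unfolding coboundaries_in_Suc[OF PQ] by blast
      have eP: "e \<in> cochains_in P n" and eQ: "e \<in> cochains_in Q n"
        using e cochains_in_mono[of "P \<inter> Q"] by blast+
      have R: "R f e e" using eP eQ fe by (simp add: R_def)
      have "?sub e e = (\<lambda>l. \<one>)" using Pc[OF eP] by simp
      then have "\<theta>' f = \<theta> (\<lambda>l. \<one>)" using \<theta>'[OF R] by simp
      also have "\<dots> = \<one>\<^bsub>H\<^esub>"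
        using \<theta>_one[of "\<lambda>l. \<one>"] one_coboundary coboundaries_subset_cocycles by blast
      finally show "\<theta>' f = \<one>\<^bsub>H\<^esub>" .
    qed
  qed
  then show ?thesis by blast
qed

end

subsection \<open>Cohomological dimension\<close>

lemma (in comm_group) int_antidifference:
  fixes c :: "int \<Rightarrow> 'a"
  assumes c: "\<And>j. c j \<in> carrier G"
  shows "\<exists>s. (\<forall>j. s j \<in> carrier G) \<and> (\<forall>j. s j = s (j - 1) \<otimes> c j)"
proof -
  \<comment> \<open>A discrete integral based at 0: at least one of the two ranges is empty, and the
    second serves negative \<open>j\<close> with the opposite sign.\<close>
  define s where "s j = finprod G c {1..j} \<otimes> inv finprod G c {j+1..0}" for j :: int
  have fc: "finprod G c A \<in> carrier G" for A using c by (auto intro: finprod_closed)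
  have "s j = s (j - 1) \<otimes> c j" for j
  proof (cases "1 \<le> j")
    case True
    have "{1..j} = insert j {1..j - 1}" using True by auto
    then have "finprod G c {1..j} = c j \<otimes> finprod G c {1..j - 1}" using c by simp
    then show ?thesis using True c fc by (simp add: s_def m_comm)
  next
    case False
    have "{j - 1 + 1..0} = insert j {j + 1..0}" using False by auto
    then have "finprod G c {j - 1 + 1..0} = c j \<otimes> finprod G c {j + 1..0}" using c by simp
    then show ?thesis using False c fc by (simp add: s_def inv_mult m_ac) (simp add: m_assoc[symmetric])
  qed
  moreover have "s j \<in> carrier G" for j using fc by (simp add: s_def)
  ultimately show ?thesis by blast
qed

definition unit_vec :: "nat \<Rightarrow> nat \<Rightarrow> int" where
  "unit_vec k = (\<lambda>i. if i = k then 1 else 0)"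

lemma unit_vec_Zd: "k < d \<Longrightarrow> unit_vec k \<in> Zd d"
  by (auto simp: unit_vec_def Zd_def)

lemma fun_upd_Zd: "x \<in> Zd d \<Longrightarrow> k < d \<Longrightarrow> x(k := j) \<in> Zd d"
  by (auto simp: Zd_def)

section \<open>Function modules on the group\<close>

context gmodule
begin

text \<open>With the diagonal action \<open>fun_act\<close>, a model of the coinduced module. The
  default \<open>\<one>\<close> off \<open>Zd d\<close> makes equality of functions the right
  equality.\<close>

definition Fun :: "((nat \<Rightarrow> int) \<Rightarrow> 'm) monoid" where
  "Fun = \<lparr>carrier = {\<phi>. (\<forall>x\<in>Zd d. \<phi> x \<in> carrier M) \<and> (\<forall>x. x \<notin> Zd d \<longrightarrow> \<phi> x = \<one>)},
          mult = (\<lambda>\<phi> \<psi> x. \<phi> x \<otimes> \<psi> x), one = (\<lambda>x. \<one>)\<rparr>"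

definition fun_act :: "(nat \<Rightarrow> int) \<Rightarrow> ((nat \<Rightarrow> int) \<Rightarrow> 'm) \<Rightarrow> (nat \<Rightarrow> int) \<Rightarrow> 'm" where
  "fun_act g \<phi> = (\<lambda>x. if x \<in> Zd d then ma g (\<phi> (vadd x (vneg g))) else \<one>)"

lemma Fun_simps [simp]:
  "\<phi> \<otimes>\<^bsub>Fun\<^esub> \<psi> = (\<lambda>x. \<phi> x \<otimes> \<psi> x)" "\<one>\<^bsub>Fun\<^esub> = (\<lambda>x. \<one>)"
  by (simp_all add: Fun_def)

lemma Fun_mem_iff: "\<phi> \<in> carrier Fun \<longleftrightarrow> (\<forall>x\<in>Zd d. \<phi> x \<in> carrier M) \<and> (\<forall>x. x \<notin> Zd d \<longrightarrow> \<phi> x = \<one>)"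
  by (simp add: Fun_def)

lemma Fun_closed: "\<phi> \<in> carrier Fun \<Longrightarrow> \<phi> x \<in> carrier M"
  by (cases "x \<in> Zd d") (auto simp: Fun_mem_iff)

lemma comm_group_Fun: "comm_group Fun"
proof (rule comm_groupI)
  fix \<phi> assume \<phi>: "\<phi> \<in> carrier Fun"
  have "(\<lambda>x. inv \<phi> x) \<in> carrier Fun" using \<phi> by (auto simp: Fun_mem_iff)
  moreover have "(\<lambda>x. inv \<phi> x \<otimes> \<phi> x) = (\<lambda>x. \<one>)" using Fun_closed[OF \<phi>] by simp
  ultimately show "\<exists>\<psi>\<in>carrier Fun. \<psi> \<otimes>\<^bsub>Fun\<^esub> \<phi> = \<one>\<^bsub>Fun\<^esub>" unfolding Fun_simps
    by (intro bexI[of _ "\<lambda>x. inv \<phi> x"])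
next
  fix \<phi> \<psi> \<xi> assume "\<phi> \<in> carrier Fun" "\<psi> \<in> carrier Fun" "\<xi> \<in> carrier Fun"
  then show "\<phi> \<otimes>\<^bsub>Fun\<^esub> \<psi> \<otimes>\<^bsub>Fun\<^esub> \<xi> = \<phi> \<otimes>\<^bsub>Fun\<^esub> (\<psi> \<otimes>\<^bsub>Fun\<^esub> \<xi>)"
    by (simp add: Fun_closed m_assoc)
next
  fix \<phi> \<psi> assume "\<phi> \<in> carrier Fun" "\<psi> \<in> carrier Fun"
  then show "\<phi> \<otimes>\<^bsub>Fun\<^esub> \<psi> = \<psi> \<otimes>\<^bsub>Fun\<^esub> \<phi>"
    by (simp add: Fun_closed m_comm)
qed (auto simp: Fun_mem_iff Fun_closed)

lemma inv_Fun: "\<phi> \<in> carrier Fun \<Longrightarrow> inv\<^bsub>Fun\<^esub> \<phi> = (\<lambda>x. inv \<phi> x)"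
proof -
  assume \<phi>: "\<phi> \<in> carrier Fun"
  interpret F: comm_group Fun by (rule comm_group_Fun)
  show ?thesis
    using \<phi> Fun_closed[OF \<phi>] by (intro F.inv_equality) (auto simp: Fun_mem_iff)
qed

lemma gmodule_Fun: "gmodule Fun d fun_act"
proof -
  interpret F: comm_group Fun by (rule comm_group_Fun)
  show ?thesis
  proof unfold_locales
    fix g assume g: "g \<in> Zd d"
    show "fun_act g \<in> hom Fun Fun"
      using g by (auto simp: hom_def fun_act_def Fun_mem_iff ma_mult)
    fix h \<phi> assume h: "h \<in> Zd d" and \<phi>: "\<phi> \<in> carrier Fun"
    show "fun_act g (fun_act h \<phi>) = fun_act (vadd g h) \<phi>"
      using g h Fun_closed[OF \<phi>] by (auto simp: fun_act_def fun_eq_iff ma_vadd vneg_vadd vadd_assoc)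
  next
    fix \<phi> assume "\<phi> \<in> carrier Fun"
    then show "fun_act vzero \<phi> = \<phi>" by (auto simp: fun_act_def fun_eq_iff Fun_mem_iff ma_vzero)
  qed
qed

lemma eval_hom: "(\<lambda>\<phi>. \<phi> x) \<in> hom Fun M"
  by (auto simp: hom_def Fun_closed)

text \<open>The primitive \<open>k\<close> turns the point \<open>x\<close> into an extra first
  entry \<open>vneg x\<close> of the tuple and evaluates at \<open>vzero\<close>. The cocycle
  identity for \<open>vneg x # gs\<close> at \<open>vzero\<close>, moved back by \<open>x\<close>,
  is then the required equation at \<open>x\<close>. The construction lowers the degree, hence the
  positive degree.\<close>

lemma cocycles_Fun_subset: "cocycles d Fun fun_act (Suc n) \<subseteq> coboundaries d Fun fun_act (Suc n)"
proof
  interpret F: gmodule Fun d fun_act by (rule gmodule_Fun)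
  fix f assume f: "f \<in> cocycles d Fun fun_act (Suc n)"
  then have fc: "f \<in> cochains d Fun (Suc n)" and df: "F.\<delta> (Suc n) f = (\<lambda>l. \<one>\<^bsub>Fun\<^esub>)"
    by (auto simp: cocycles_def)
  have fM: "f l y \<in> carrier M" for l y using F.cochain_closed[OF fc] Fun_closed by blast
  define k where "k l = (\<lambda>x. if valid_tuple d n l \<and> x \<in> Zd d then ma x (f (vneg x # l) vzero) else \<one>)" for l
  have k: "k \<in> cochains d Fun n"
    using fM by (auto simp: cochains_def k_def Fun_mem_iff)
  obtain F where ext: "F.extends F f" using F.extends_exists[of f, OF F.cochain_closed[OF fc]] by blast
  obtain F' where ext': "F.extends F' k" using F.extends_exists[of k, OF F.cochain_closed[OF k]] by blast
  have "F.\<delta> n k gs x = f gs x" if gs: "valid_tuple d (Suc n) gs" and x: "x \<in> Zd d" for gs x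
  proof -
    obtain h r where hr: "gs = h # r" using gs by (cases gs) (auto simp: valid_tuple_def)
    have h: "h \<in> Zd d" and r: "valid_tuple d n r" using gs by (auto simp: hr valid_tuple_def)
    \<comment> \<open>\<open>G1\<close> evaluates chains through \<open>k\<close> at
      \<open>x\<close>, while \<open>G2\<close> evaluates them through \<open>f\<close> at
      \<open>vzero\<close> and then translates by \<open>x\<close>; the two differentials are
      matched under these.\<close>
    define G1 where "G1 c = F' c x" for c
    define G2 where "G2 c = ma x (F c vzero)" for c
    have G1: "G1 \<in> hom (free_Abelian_group UNIV) M"
      using Group.hom_compose[OF F.extends_hom[OF ext'] eval_hom] by (simp add: comp_def G1_def[abs_def])
    have G2: "G2 \<in> hom (free_Abelian_group UNIV) M"
      using Group.hom_compose[OF Group.hom_compose[OF F.extends_hom[OF ext] eval_hom] ma_hom[OF x]]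
      by (simp add: comp_def G2_def[abs_def])
    let ?T = "bar_tail (\<lambda>a l. formal a (vneg x # l)) vzero gs"
    have tail: "G1 (bar_tail formal vzero gs) = G2 ?T"
    proof (rule bar_tail_transfer[OF G1 G2, of d])
      fix l assume "set l \<subseteq> Zd d" "Suc (length l) = length gs"
      then have "valid_tuple d n l" using gs by (simp add: valid_tuple_def)
      moreover have "F' (formal vzero l) = k l" "F (formal vzero (vneg x # l)) = f (vneg x # l)"
        by (simp_all add: F.extends_formal[OF ext'] F.extends_formal[OF ext]
            F.ma_vzero[OF F.cochain_closed[OF k]] F.ma_vzero[OF F.cochain_closed[OF fc]])
      ultimately show "G1 (formal vzero l) = G2 (formal vzero (vneg x # l))"
        using x by (simp add: G1_def G2_def k_def)
    qed (use gs in \<open>simp add: valid_tuple_def\<close>)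
    have "G1 (formal h r) = G2 (formal vzero (vadd (vneg x) h # r))"
    proof -
      have "vadd h (vadd x (vneg h)) = x" by (auto simp: vadd_def vneg_def)
      moreover have "vneg (vadd x (vneg h)) = vadd (vneg x) h" by (auto simp: vadd_def vneg_def)
      ultimately show ?thesis
        using x h r fM F.ma_vzero[OF F.cochain_closed[OF fc]]
        by (simp add: G1_def G2_def F.extends_formal[OF ext'] F.extends_formal[OF ext])
           (simp add: fun_act_def k_def ma_vadd)
    qed
    moreover have "F.\<delta> n k gs x = G1 (bar_diff formal vzero gs)"
      unfolding F.coboundary_eq_bar_diff[OF ext' F.cochain_closed[OF k] gs] G1_def ..
    ultimately have dk: "F.\<delta> n k gs x = G2 (formal vzero (vadd (vneg x) h # r)) \<otimes> G2 ?T"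
      using tail by (simp add: hr frag_hom_add[OF G1] del: bar_tail.simps)
    have v: "valid_tuple d (Suc (Suc n)) (vneg x # gs)" using gs x by (auto simp: valid_tuple_def)
    have "G2 (bar_diff formal vzero (vneg x # gs)) = \<one>"
      unfolding G2_def F.coboundary_eq_bar_diff[OF ext F.cochain_closed[OF fc] v, symmetric] df using x by simp
    moreover have "bar_diff formal vzero (vneg x # gs) = formal (vneg x) gs
        - (formal vzero (vadd (vneg x) h # r) + ?T)"
      by (simp add: hr)
    moreover have "G2 (formal (vneg x) gs) = f gs x"
      using x fM by (simp add: G2_def F.extends_formal[OF ext] fun_act_def ma_vadd ma_vzero)
    ultimately have "f gs x \<otimes> inv (G2 (formal vzero (vadd (vneg x) h # r)) \<otimes> G2 ?T) = \<one>"
      by (simp only: frag_hom_diff[OF G2] frag_hom_add[OF G2])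
    then show ?thesis
      unfolding dk using fM frag_hom_closed[OF G2]
        mult_inv_eq_one_iff[of "f gs x" "G2 (formal vzero (vadd (vneg x) h # r)) \<otimes> G2 ?T"] by simp
  qed
  moreover have "F.\<delta> n k gs x = f gs x" if "\<not> (valid_tuple d (Suc n) gs \<and> x \<in> Zd d)" for gs x
    using that F.\<delta>_closed[of k n gs, OF F.cochain_closed[OF k]] fc F.cochain_closed[OF fc, of gs]
    by (cases "valid_tuple d (Suc n) gs") (auto simp: coboundary_invalid cochains_def Fun_mem_iff)
  ultimately have "F.\<delta> n k = f" by blast
  then show "f \<in> coboundaries d Fun fun_act (Suc n)" using k by (auto simp: coboundaries_def)
qed

text \<open>Interpolates between the constants for \<open>k = 0\<close>, a copy of the module
  itself, and all of \<open>Fun\<close> for \<open>k = d\<close>. Translations preserve agreement in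
  the first coordinates, so each stage is a submodule.\<close>

definition Fun_upto :: "nat \<Rightarrow> ((nat \<Rightarrow> int) \<Rightarrow> 'm) set" where
  "Fun_upto k = {\<phi> \<in> carrier Fun. \<forall>x\<in>Zd d. \<forall>y\<in>Zd d. (\<forall>i<k. x i = y i) \<longrightarrow> \<phi> x = \<phi> y}"

lemma Fun_upto_eqD:
  "\<phi> \<in> Fun_upto k \<Longrightarrow> x \<in> Zd d \<Longrightarrow> y \<in> Zd d \<Longrightarrow> (\<And>i. i < k \<Longrightarrow> x i = y i) \<Longrightarrow> \<phi> x = \<phi> y"
  unfolding Fun_upto_def by blast

lemma Fun_uptoI:
  "\<phi> \<in> carrier Fun \<Longrightarrow> (\<And>x y. x \<in> Zd d \<Longrightarrow> y \<in> Zd d \<Longrightarrow> \<forall>i<k. x i = y i \<Longrightarrow> \<phi> x = \<phi> y) \<Longrightarrow> \<phi> \<in> Fun_upto k"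
  unfolding Fun_upto_def by blast

lemma Fun_upto_Fun: "\<phi> \<in> Fun_upto k \<Longrightarrow> \<phi> \<in> carrier Fun"
  unfolding Fun_upto_def by blast

lemma Fun_upto_d: "Fun_upto d = carrier Fun"
proof -
  have "x = y" if "x \<in> Zd d" "y \<in> Zd d" "\<forall>i<d. x i = y i" for x y
  proof
    show "x i = y i" for i using that by (cases "i < d") (auto simp: Zd_def)
  qed
  then show ?thesis by (auto simp: Fun_upto_def)
qed

lemma gsub_Fun_upto: "gmodule.gsub Fun d fun_act (Fun_upto k)"
proof -
  interpret F: gmodule Fun d fun_act by (rule gmodule_Fun)
  have "subgroup (Fun_upto k) Fun"
  proof (rule F.subgroupI)
    have "(\<lambda>x. \<one>) \<in> Fun_upto k" by (rule Fun_uptoI) (simp_all add: Fun_mem_iff)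
    then show "Fun_upto k \<noteq> {}" by blast
    show "Fun_upto k \<subseteq> carrier Fun" using Fun_upto_Fun by blast
    fix \<phi> assume \<phi>: "\<phi> \<in> Fun_upto k"
    show "inv\<^bsub>Fun\<^esub> \<phi> \<in> Fun_upto k"
    proof (rule Fun_uptoI)
      show "inv\<^bsub>Fun\<^esub> \<phi> \<in> carrier Fun" using Fun_upto_Fun[OF \<phi>] by simp
      fix x y assume "x \<in> Zd d" "y \<in> Zd d" "\<forall>i<k. x i = y i"
      then have "\<phi> x = \<phi> y" using Fun_upto_eqD[OF \<phi>] by blast
      then show "(inv\<^bsub>Fun\<^esub> \<phi>) x = (inv\<^bsub>Fun\<^esub> \<phi>) y" by (simp add: inv_Fun[OF Fun_upto_Fun[OF \<phi>]])
    qed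
    fix \<psi> assume \<psi>: "\<psi> \<in> Fun_upto k"
    show "\<phi> \<otimes>\<^bsub>Fun\<^esub> \<psi> \<in> Fun_upto k"
    proof (rule Fun_uptoI)
      show "\<phi> \<otimes>\<^bsub>Fun\<^esub> \<psi> \<in> carrier Fun" using Fun_upto_Fun[OF \<phi>] Fun_upto_Fun[OF \<psi>] by (rule F.m_closed)
      fix x y assume "x \<in> Zd d" "y \<in> Zd d" "\<forall>i<k. x i = y i"
      then have "\<phi> x = \<phi> y" "\<psi> x = \<psi> y" using Fun_upto_eqD[OF \<phi>] Fun_upto_eqD[OF \<psi>] by blast+
      then show "(\<phi> \<otimes>\<^bsub>Fun\<^esub> \<psi>) x = (\<phi> \<otimes>\<^bsub>Fun\<^esub> \<psi>) y" by simp
    qed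
  qed
  moreover have "fun_act g \<phi> \<in> Fun_upto k" if g: "g \<in> Zd d" and \<phi>: "\<phi> \<in> Fun_upto k" for g \<phi>
  proof -
    have "fun_act g \<phi> x = fun_act g \<phi> y" if "x \<in> Zd d" "y \<in> Zd d" "\<forall>i<k. x i = y i" for x y
    proof -
      have "\<phi> (vadd x (vneg g)) = \<phi> (vadd y (vneg g))"
        using that g by (intro Fun_upto_eqD[OF \<phi>]) (auto, simp add: vadd_def)
      then show ?thesis using that by (simp add: fun_act_def)
    qed
    then show ?thesis using F.ma_closed[OF g Fun_upto_Fun[OF \<phi>]] by (intro Fun_uptoI)
  qed
  ultimately show ?thesis by (simp add: F.gsub_def)
qed

definition Fun_diff :: "nat \<Rightarrow> ((nat \<Rightarrow> int) \<Rightarrow> 'm) \<Rightarrow> (nat \<Rightarrow> int) \<Rightarrow> 'm" where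
  "Fun_diff k \<phi> = (\<lambda>x. if x \<in> Zd d then \<phi> x \<otimes> inv \<phi> (vadd x (vneg (unit_vec k))) else \<one>)"

lemma Fun_diff_closed:
  assumes "k < d" "\<phi> \<in> Fun_upto (Suc k)"
  shows "Fun_diff k \<phi> \<in> Fun_upto (Suc k)"
proof -
  have \<phi>: "\<phi> \<in> carrier Fun" using assms by (simp add: Fun_upto_def)
  have "Fun_diff k \<phi> x = Fun_diff k \<phi> y" if "x \<in> Zd d" "y \<in> Zd d" "\<forall>i<Suc k. x i = y i" for x y
  proof -
    have "\<phi> (vadd x (vneg (unit_vec k))) = \<phi> (vadd y (vneg (unit_vec k)))"
      using that unit_vec_Zd[OF assms(1)] by (intro Fun_upto_eqD[OF assms(2)]) (auto, simp add: vadd_def)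
    moreover have "\<phi> x = \<phi> y" using Fun_upto_eqD[OF assms(2)] that by blast
    ultimately show ?thesis using that by (simp add: Fun_diff_def)
  qed
  moreover have "Fun_diff k \<phi> \<in> carrier Fun"
    using Fun_closed[OF \<phi>] by (auto simp: Fun_mem_iff Fun_diff_def)
  ultimately show ?thesis by (intro Fun_uptoI)
qed

lemma Fun_diff_surj:
  assumes k: "k < d" and \<phi>: "\<phi> \<in> Fun_upto (Suc k)"
  shows "\<exists>\<psi>\<in>Fun_upto (Suc k). Fun_diff k \<psi> = \<phi>"
proof -
  have \<phi>F: "\<phi> \<in> carrier Fun" using \<phi> by (simp add: Fun_upto_def)
  \<comment> \<open>The antidifference is chosen as a function of the sequence alone. Points on one
    line in direction \<open>k\<close>, and points with the same first \<open>Suc k\<close>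
    coordinates, yield the same sequence and so share one choice.\<close>
  define S where "S c = (SOME s. (\<forall>j. s j \<in> carrier M) \<and> (\<forall>j. s j = s (j - 1) \<otimes> c j))" for c :: "int \<Rightarrow> 'm"
  have S: "(\<forall>j. S c j \<in> carrier M) \<and> (\<forall>j. S c j = S c (j - 1) \<otimes> c j)" if "\<And>j. c j \<in> carrier M" for c
    unfolding S_def by (rule someI_ex[OF int_antidifference[of c, OF that]])
  define \<psi> where "\<psi> x = (if x \<in> Zd d then S (\<lambda>j. \<phi> (x(k := j))) (x k) else \<one>)" for x
  have S_closed: "S c j \<in> carrier M" if "\<And>j. c j \<in> carrier M" for c j using S[of c] that by blast
  have \<psi>F: "\<psi> \<in> carrier Fun"
    unfolding Fun_mem_iff \<psi>_def using S_closed[OF Fun_closed[OF \<phi>F]] by simp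
  have "\<psi> x = \<psi> y" if "x \<in> Zd d" "y \<in> Zd d" "\<forall>i<Suc k. x i = y i" for x y
  proof -
    have "(\<lambda>j. \<phi> (x(k := j))) = (\<lambda>j. \<phi> (y(k := j)))"
    proof
      fix j
      have "\<forall>i<Suc k. (x(k := j)) i = (y(k := j)) i" using that by auto
      then show "\<phi> (x(k := j)) = \<phi> (y(k := j))"
        using Fun_upto_eqD[OF \<phi> fun_upd_Zd[OF that(1) k, of j] fun_upd_Zd[OF that(2) k, of j]] by blast
    qed
    then show ?thesis using that by (simp add: \<psi>_def)
  qed
  then have \<psi>: "\<psi> \<in> Fun_upto (Suc k)" using \<psi>F by (intro Fun_uptoI)
  have "Fun_diff k \<psi> x = \<phi> x" for x
  proof (cases "x \<in> Zd d")
    case True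
    let ?y = "vadd x (vneg (unit_vec k))" and ?c = "\<lambda>j. \<phi> (x(k := j))"
    have y: "?y \<in> Zd d" using True unit_vec_Zd[OF k] by simp
    have yk: "?y k = x k - 1" "?y(k := j) = x(k := j)" for j
      by (auto simp: vadd_def vneg_def unit_vec_def)
    have "\<psi> x = \<psi> ?y \<otimes> \<phi> x"
    proof -
      have "S ?c (x k) = S ?c (x k - 1) \<otimes> ?c (x k)"
        using S[of ?c] Fun_closed[OF \<phi>F] by blast
      then show ?thesis using True y unfolding \<psi>_def yk by simp
    qed
    then show ?thesis
      using True Fun_closed[OF \<phi>F, of x] Fun_closed[OF \<psi>F, of ?y]
      by (simp add: Fun_diff_def m_comm[of "\<psi> ?y"] m_assoc)
  next
    case False
    then show ?thesis using \<phi>F by (simp add: Fun_diff_def Fun_mem_iff)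
  qed
  then show ?thesis using \<psi> by (intro bexI[of _ \<psi>]) auto
qed

lemma Fun_diff_kernel:
  assumes k: "k < d"
  shows "Fun_upto k = {\<phi> \<in> Fun_upto (Suc k). Fun_diff k \<phi> = (\<lambda>x. \<one>)}"
proof (intro equalityI subsetI)
  fix \<phi> assume \<phi>: "\<phi> \<in> Fun_upto k"
  then have \<phi>F: "\<phi> \<in> carrier Fun" by (simp add: Fun_upto_def)
  have "\<phi> (vadd x (vneg (unit_vec k))) = \<phi> x" if "x \<in> Zd d" for x
    using that unit_vec_Zd[OF k] by (intro Fun_upto_eqD[OF \<phi>]) (auto, simp add: vadd_def vneg_def unit_vec_def)
  then have "Fun_diff k \<phi> = (\<lambda>x. \<one>)" using Fun_closed[OF \<phi>F] by (simp add: Fun_diff_def fun_eq_iff)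
  moreover have "\<phi> \<in> Fun_upto (Suc k)"
    using Fun_upto_eqD[OF \<phi>] less_SucI by (intro Fun_uptoI[OF \<phi>F]) blast
  ultimately show "\<phi> \<in> {\<phi> \<in> Fun_upto (Suc k). Fun_diff k \<phi> = (\<lambda>x. \<one>)}" by simp
next
  fix \<phi> assume *: "\<phi> \<in> {\<phi> \<in> Fun_upto (Suc k). Fun_diff k \<phi> = (\<lambda>x. \<one>)}"
  then have \<phi>: "\<phi> \<in> Fun_upto (Suc k)" and \<phi>F: "\<phi> \<in> carrier Fun" using Fun_upto_Fun by blast+
  have step: "\<phi> (vadd x (vneg (unit_vec k))) = \<phi> x" if x: "x \<in> Zd d" for x
  proof -
    have "\<phi> x \<otimes> inv \<phi> (vadd x (vneg (unit_vec k))) = \<one>"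
      using * x by (auto simp: Fun_diff_def fun_eq_iff split: if_splits)
    then show ?thesis using Fun_closed[OF \<phi>F] mult_inv_eq_one_iff by metis
  qed
  have stepk: "\<phi> (x(k := j - 1)) = \<phi> (x(k := j))" if x: "x \<in> Zd d" for x j
  proof -
    have "vadd (x(k := j)) (vneg (unit_vec k)) = x(k := j - 1)"
      by (auto simp: vadd_def vneg_def unit_vec_def)
    then show ?thesis using step[OF fun_upd_Zd[OF x k, of j]] by simp
  qed
  have any: "\<phi> (x(k := j)) = \<phi> x" if x: "x \<in> Zd d" for x j
  proof (induction j rule: int_induct[of _ "x k"])
    case base then show ?case by simp
  next
    case (step1 i) then show ?case using stepk[OF x, of "i + 1"] by (simp add: fun_upd_def)
  next
    case (step2 i) then show ?case using stepk[OF x, of i] by (simp add: fun_upd_def)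
  qed
  have "\<phi> x = \<phi> y" if x: "x \<in> Zd d" and y: "y \<in> Zd d" and eq: "\<forall>i<k. x i = y i" for x y
  proof -
    have "\<forall>i<Suc k. (x(k := y k)) i = y i" using eq by (auto simp: less_Suc_eq)
    then have "\<phi> (x(k := y k)) = \<phi> y"
      using Fun_upto_eqD[OF \<phi> fun_upd_Zd[OF x k, of "y k"] y] by blast
    then show ?thesis using any[OF x] by simp
  qed
  then show "\<phi> \<in> Fun_upto k" using \<phi>F by (intro Fun_uptoI)
qed

text \<open>Each descent to a kernel of \<open>Fun_diff\<close> costs one degree, starting from
  vanishing in all positive degrees; hence the condition \<open>j < n\<close>.\<close>

lemma cocycles_Fun_upto_subset:
  assumes "j \<le> d" "j < n"
  shows "cocycles d (Fun\<lparr>carrier := Fun_upto (d - j)\<rparr>) fun_act n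
    \<subseteq> coboundaries d (Fun\<lparr>carrier := Fun_upto (d - j)\<rparr>) fun_act n"
  using assms
proof (induction j arbitrary: n)
  case 0
  then obtain m where "n = Suc m" by (cases n) auto
  then show ?case using cocycles_Fun_subset[of m] by (simp add: Fun_upto_d)
next
  case (Suc j)
  then obtain m where m: "n = Suc (Suc m)" by (cases n; cases "n - 1") auto
  define k where "k = d - Suc j"
  have k: "k < d" "d - j = Suc k" using Suc.prems by (auto simp: k_def)
  interpret F: gmodule Fun d fun_act by (rule gmodule_Fun)
  let ?N = "Fun\<lparr>carrier := Fun_upto (Suc k)\<rparr>"
  have N: "gmodule ?N d fun_act" by (rule F.gmodule_gsub[OF gsub_Fun_upto])
  have FU: "\<phi> \<in> carrier Fun" if "\<phi> \<in> Fun_upto i" for \<phi> i using that by (simp add: Fun_upto_def)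
  have IH: "cocycles d ?N fun_act i \<subseteq> coboundaries d ?N fun_act i" if "i > j" for i
    using Suc.IH[of i] Suc.prems that by (simp add: k(2))
  have "Fun_diff k \<in> hom ?N ?N"
    using Fun_diff_closed[OF k(1)] Fun_closed[OF FU]
    by (auto simp: hom_def Fun_diff_def fun_eq_iff inv_mult m_ac)
  moreover have "Fun_diff k (fun_act g \<phi>) = fun_act g (Fun_diff k \<phi>)" if g: "g \<in> Zd d" and \<phi>: "\<phi> \<in> carrier ?N" for g \<phi>
  proof
    fix x
    have "vadd (vadd x (vneg (unit_vec k))) (vneg g) = vadd (vadd x (vneg g)) (vneg (unit_vec k))"
      by (auto simp: vadd_def)
    then show "Fun_diff k (fun_act g \<phi>) x = fun_act g (Fun_diff k \<phi>) x"
      using g \<phi> Fun_closed[OF FU] unit_vec_Zd[OF k(1)]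
      by (simp add: Fun_diff_def fun_act_def ma_mult ma_inv)
  qed
  moreover have "Fun_diff k ` carrier ?N = carrier ?N"
    using Fun_diff_closed[OF k(1)] Fun_diff_surj[OF k(1)] by fastforce
  moreover have "cocycles d ?N fun_act (Suc (Suc m)) \<subseteq> coboundaries d ?N fun_act (Suc (Suc m))"
    "cocycles d ?N fun_act (Suc m) \<subseteq> coboundaries d ?N fun_act (Suc m)"
    using IH Suc.prems m by auto
  moreover have "Fun_upto k = {\<phi> \<in> carrier ?N. Fun_diff k \<phi> = \<one>\<^bsub>?N\<^esub>}"
    using Fun_diff_kernel[OF k(1)] by simp
  ultimately have "cocycles d (?N\<lparr>carrier := Fun_upto k\<rparr>) fun_act (Suc (Suc m))
      \<subseteq> coboundaries d (?N\<lparr>carrier := Fun_upto k\<rparr>) fun_act (Suc (Suc m))"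
    by (rule cocycles_kernel_subset_coboundaries[OF N N])
  then show ?case by (simp add: m k_def)
qed

text \<open>After all \<open>d\<close> coordinates are removed only constants remain. They are
  reached from \<open>M\<close> by \<open>c\<close> and read off at \<open>vzero\<close>, both
  equivariantly, so vanishing passes to \<open>M\<close>.\<close>

theorem cohomological_dimension_le:
  assumes "d < n"
  shows "cocycles d M ma n \<subseteq> coboundaries d M ma n"
proof
  fix f assume f: "f \<in> cocycles d M ma n"
  then have fc: "f \<in> cochains d M n" and df: "\<delta> n f = (\<lambda>l. \<one>)" by (auto simp: cocycles_iff)
  obtain m where m: "n = Suc m" using assms by (cases n) auto
  interpret F: gmodule Fun d fun_act by (rule gmodule_Fun)
  let ?N = "Fun\<lparr>carrier := Fun_upto 0\<rparr>"
  interpret N: gmodule ?N d fun_act by (rule F.gmodule_gsub[OF gsub_Fun_upto])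
  define c where "c y = (\<lambda>x. if x \<in> Zd d then y else \<one>)" for y
  have "c y \<in> Fun_upto 0" if "y \<in> carrier M" for y
    using that by (intro Fun_uptoI) (auto simp: c_def Fun_mem_iff)
  then have c: "c \<in> hom M ?N" by (auto simp: hom_def c_def fun_eq_iff)
  have c_eq: "c (ma g y) = fun_act g (c y)" if "g \<in> Zd d" for g y
    using that by (auto simp: c_def fun_act_def fun_eq_iff)
  have "coboundary d ?N fun_act n (\<lambda>l. c (f l)) = (\<lambda>l. c (\<delta> n f l))"
    by (rule coboundary_natural[OF gmodule_axioms N.gmodule_axioms c]) (use c_eq cochain_closed[OF fc] in auto)
  moreover have "c \<one> = \<one>\<^bsub>?N\<^esub>" by (auto simp: c_def)
  ultimately have "(\<lambda>l. c (f l)) \<in> cocycles d ?N fun_act n"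
    using fc hom_in_carrier[OF c] df by (auto simp: cocycles_def cochains_def)
  moreover have "cocycles d ?N fun_act n \<subseteq> coboundaries d ?N fun_act n"
    using cocycles_Fun_upto_subset[of d n] assms by simp
  ultimately obtain a where a: "a \<in> cochains d ?N m" and fa: "(\<lambda>l. c (f l)) = coboundary d ?N fun_act m a"
    by (auto simp: coboundaries_def m)
  have ev: "(\<lambda>\<phi>. \<phi> vzero) \<in> hom ?N M"
    using Fun_closed[OF Fun_upto_Fun] by (auto simp: hom_def)
  \<comment> \<open>On constants the translation of the argument in \<open>fun_act\<close> is
    invisible, which makes evaluation at a point equivariant.\<close>
  have ev_eq: "fun_act g \<phi> vzero = ma g (\<phi> vzero)" if "g \<in> Zd d" "\<phi> \<in> carrier ?N" for g \<phi>
  proof -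
    have "\<phi> (vneg g) = \<phi> vzero" using that by (intro Fun_upto_eqD[of \<phi> 0]) auto
    then show ?thesis using that by (simp add: fun_act_def)
  qed
  have "\<delta> m (\<lambda>l. a l vzero) = (\<lambda>l. coboundary d ?N fun_act m a l vzero)"
    by (rule coboundary_natural[OF N.gmodule_axioms gmodule_axioms ev]) (use ev_eq N.cochain_closed[OF a] in auto)
  also have "\<dots> = f" unfolding fa[symmetric] by (simp add: c_def)
  finally have "\<delta> m (\<lambda>l. a l vzero) = f" .
  moreover have "(\<lambda>l. a l vzero) \<in> cochains d M m"
    using a hom_in_carrier[OF ev] by (auto simp: cochains_def)
  ultimately show "f \<in> coboundaries d M ma n" by (auto simp: coboundaries_def m)
qed

end

subsection \<open>Proper actions\<close>

locale proper_Zd_action =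
  fixes Xs :: "'a topology" and d :: nat and act :: "'a \<Rightarrow> (nat \<Rightarrow> int) \<Rightarrow> 'a"
  assumes hausdorff: "Hausdorff_space Xs" and loc_compact: "locally_compact_space Xs"
    and proper: "proper_action Xs d act"
begin

lemma act_vzero [simp]: "x \<in> topspace Xs \<Longrightarrow> act x vzero = x"
  and act_vadd: "x \<in> topspace Xs \<Longrightarrow> g \<in> Zd d \<Longrightarrow> h \<in> Zd d \<Longrightarrow> act (act x g) h = act x (vadd g h)"
  using proper by (auto simp: proper_action_def right_action_def)

lemma continuous_act:
  assumes "g \<in> Zd d" shows "continuous_map Xs Xs (\<lambda>x. act x g)"
proof -
  have "continuous_map Xs (prod_topology Xs (discrete_topology (Zd d))) (\<lambda>x. (x, g))"
    using assms by (simp add: continuous_map_pairwise comp_def)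
  moreover have "continuous_map (prod_topology Xs (discrete_topology (Zd d))) Xs (\<lambda>(x, g). act x g)"
    using proper by (simp add: proper_action_def right_action_def)
  ultimately show ?thesis using continuous_map_compose by (fastforce simp: comp_def)
qed

lemma act_closed [simp]: "x \<in> topspace Xs \<Longrightarrow> g \<in> Zd d \<Longrightarrow> act x g \<in> topspace Xs"
  using continuous_map_image_subset_topspace[OF continuous_act] by blast

lemma act_vneg_act [simp]:
  "x \<in> topspace Xs \<Longrightarrow> g \<in> Zd d \<Longrightarrow> act (act x g) (vneg g) = x"
  "x \<in> topspace Xs \<Longrightarrow> g \<in> Zd d \<Longrightarrow> act (act x (vneg g)) g = x"
  by (simp_all add: act_vadd)

definition tr :: "'a set \<Rightarrow> (nat \<Rightarrow> int) set \<Rightarrow> 'a set" where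
  "tr K S = (\<Union>g\<in>S. (\<lambda>x. act x g) ` K)"

lemma tr_iff: "y \<in> tr K S \<longleftrightarrow> (\<exists>x\<in>K. \<exists>g\<in>S. y = act x g)"
  by (auto simp: tr_def)

lemma tr_mono: "K \<subseteq> K' \<Longrightarrow> S \<subseteq> S' \<Longrightarrow> tr K S \<subseteq> tr K' S'"
  by (auto simp: tr_def)

lemma tr_subset_topspace: "K \<subseteq> topspace Xs \<Longrightarrow> S \<subseteq> Zd d \<Longrightarrow> tr K S \<subseteq> topspace Xs"
  by (auto simp: tr_def subset_iff)

text \<open>The preimage of \<open>K' \<times> K\<close> under the proper map is compact, and its
  projection to the discrete factor is compact, that is, finite.\<close>

lemma finite_meeting:
  assumes K: "compactin Xs K" and K': "compactin Xs K'"
  shows "finite {g \<in> Zd d. \<exists>x\<in>K. act x g \<in> K'}"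
proof -
  let ?P = "prod_topology Xs (discrete_topology (Zd d))"
  have "proper_map ?P (prod_topology Xs Xs) (\<lambda>(x, g). (act x g, x))"
    using proper by (simp add: proper_action_def)
  moreover have "compactin (prod_topology Xs Xs) (K' \<times> K)" using K K' by (simp add: compactin_Times)
  ultimately have "compactin ?P {z \<in> topspace ?P. (\<lambda>(x, g). (act x g, x)) z \<in> K' \<times> K}"
    by (rule compactin_proper_map_preimage)
  then have "compactin (discrete_topology (Zd d)) (snd ` {z \<in> topspace ?P. (\<lambda>(x, g). (act x g, x)) z \<in> K' \<times> K})"
    by (rule image_compactin) (rule continuous_map_snd)
  moreover have "{g \<in> Zd d. \<exists>x\<in>K. act x g \<in> K'} \<subseteq> snd ` {z \<in> topspace ?P. (\<lambda>(x, g). (act x g, x)) z \<in> K' \<times> K}"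
    using compactin_subset_topspace[OF K] by (force simp: image_iff)
  ultimately show ?thesis using finite_subset by (auto simp: compactin_discrete_topology)
qed

lemma bounded_meeting:
  fixes lev :: "(nat \<Rightarrow> int) \<Rightarrow> int"
  assumes K: "compactin Xs K" and K': "compactin Xs K'"
  obtains N where "N > 0" "\<And>g x. g \<in> Zd d \<Longrightarrow> x \<in> K \<Longrightarrow> act x g \<in> K' \<Longrightarrow> lev g < N"
proof -
  let ?F = "{g \<in> Zd d. \<exists>x\<in>K. act x g \<in> K'}"
  \<comment> \<open>Inserting 0 makes the maximum exist when no translate meets \<open>K'\<close>,
    and makes the bound positive.\<close>
  have fin: "finite (insert 0 (lev ` ?F))" using finite_meeting[OF K K'] by simp
  show thesis
  proof (rule that[of "Max (insert 0 (lev ` ?F)) + 1"])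
    show "0 < Max (insert 0 (lev ` ?F)) + 1" using Max_ge[OF fin, of 0] by simp
    fix g x assume "g \<in> Zd d" "x \<in> K" "act x g \<in> K'"
    then have "lev g \<in> insert 0 (lev ` ?F)" by blast
    then show "lev g < Max (insert 0 (lev ` ?F)) + 1" using Max_ge[OF fin, of "lev g"] by linarith
  qed
qed

lemma compact_neighbourhood:
  assumes "x \<in> topspace Xs"
  obtains U L where "openin Xs U" "compactin Xs L" "x \<in> U" "U \<subseteq> L"
  using loc_compact assms unfolding locally_compact_space_def by blast

lemma compactin_act: "compactin Xs K \<Longrightarrow> g \<in> Zd d \<Longrightarrow> compactin Xs ((\<lambda>x. act x g) ` K)"
  by (rule image_compactin[OF _ continuous_act])

text \<open>The union may be infinite, but it is locally finite: a compact neighbourhood of a point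
  meets only finitely many translates of \<open>K\<close>. An arbitrary \<open>S\<close> is allowed
  so that half spaces are covered.\<close>

lemma closedin_tr:
  assumes K: "compactin Xs K" and S: "S \<subseteq> Zd d"
  shows "closedin Xs (tr K S)"
  unfolding tr_def
proof (rule closedin_locally_finite_Union)
  fix C assume "C \<in> (\<lambda>g. (\<lambda>x. act x g) ` K) ` S"
  then show "closedin Xs C"
    using S K compactin_act compactin_imp_closedin[OF hausdorff] by blast
next
  show "locally_finite_in Xs ((\<lambda>g. (\<lambda>x. act x g) ` K) ` S)"
    unfolding locally_finite_in_def
  proof (intro conjI ballI)
    show "\<Union> ((\<lambda>g. (\<lambda>x. act x g) ` K) ` S) \<subseteq> topspace Xs"
      using tr_subset_topspace[OF compactin_subset_topspace[OF K] S] by (simp add: tr_def)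
    fix x assume "x \<in> topspace Xs"
    then obtain U L where U: "openin Xs U" "compactin Xs L" "x \<in> U" "U \<subseteq> L"
      by (rule compact_neighbourhood)
    have "{C \<in> (\<lambda>g. (\<lambda>x. act x g) ` K) ` S. C \<inter> U \<noteq> {}}
        \<subseteq> (\<lambda>g. (\<lambda>x. act x g) ` K) ` {g \<in> Zd d. \<exists>x\<in>K. act x g \<in> L}"
      using S U(4) by blast
    then have "finite {C \<in> (\<lambda>g. (\<lambda>x. act x g) ` K) ` S. C \<inter> U \<noteq> {}}"
      using finite_meeting[OF K U(2)] finite_subset by blast
    then show "\<exists>V. openin Xs V \<and> x \<in> V \<and> finite {C \<in> (\<lambda>g. (\<lambda>x. act x g) ` K) ` S. C \<inter> V \<noteq> {}}"
      using U by blast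
  qed
qed

lemma openin_tr:
  assumes U: "openin Xs U" and S: "S \<subseteq> Zd d"
  shows "openin Xs (tr U S)"
  unfolding tr_def
proof (rule openin_Union)
  fix W assume "W \<in> (\<lambda>g. (\<lambda>x. act x g) ` U) ` S"
  then obtain g where g: "g \<in> Zd d" and W: "W = (\<lambda>x. act x g) ` U" using S by blast
  have "W = {x \<in> topspace Xs. act x (vneg g) \<in> U}"
  proof (intro equalityI subsetI)
    fix y assume "y \<in> {x \<in> topspace Xs. act x (vneg g) \<in> U}"
    then have "y = act (act y (vneg g)) g" "act y (vneg g) \<in> U" using g by auto
    then show "y \<in> W" unfolding W by blast
  qed (use W g openin_subset[OF U] in auto)
  then show "openin Xs W"
    using openin_continuous_map_preimage[OF continuous_act U, of "vneg g"] g by simp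
qed

end

lemma continuous_map_paste_closed:
  assumes "closedin T A" "closedin T B" "continuous_map (subtopology T A) Y f" "continuous_map (subtopology T B) Y g"
    and "\<And>x. x \<in> A \<Longrightarrow> x \<in> B \<Longrightarrow> f x = g x"
  shows "continuous_map (subtopology T (A \<union> B)) Y (\<lambda>x. if x \<in> A then f x else g x)"
proof (rule pasting_lemma_closed[where I = "{True, False}" and T = "\<lambda>b. if b then A else B" and f = "\<lambda>b. if b then f else g"])
  fix b :: bool
  show "closedin (subtopology T (A \<union> B)) (if b then A else B)"
    using assms(1,2) by (auto intro: closedin_subset_topspace)
  have "subtopology (subtopology T (A \<union> B)) (if b then A else B) = subtopology T (if b then A else B)"
    by (simp add: subtopology_subtopology inf_absorb2)
  then show "continuous_map (subtopology (subtopology T (A \<union> B)) (if b then A else B)) Y (if b then f else g)"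
    using assms(3,4) by (cases b) simp_all
qed (use assms(5) in \<open>auto split: if_splits\<close>)

subsection \<open>Sections of an equivariant sheaf\<close>

locale equivariant_etale = proper_Zd_action Xs d act
  for Xs :: "'a topology" and d and act +
  fixes E :: "'e topology" and p :: "'e \<Rightarrow> 'a" and eadd :: "'e \<Rightarrow> 'e \<Rightarrow> 'e"
    and zer :: "'a \<Rightarrow> 'e" and neg :: "'e \<Rightarrow> 'e" and tau :: "'e \<Rightarrow> (nat \<Rightarrow> int) \<Rightarrow> 'e"
  assumes sheaf: "equivariant_sheaf Xs d act E p eadd zer neg tau"
begin

lemma etale: "etale_sheaf Xs E p eadd zer neg"
  using sheaf by (simp add: equivariant_sheaf_def)

lemma continuous_p: "continuous_map E Xs p"
  and local_homeo: "e \<in> topspace E \<Longrightarrow> \<exists>U. openin E U \<and> e \<in> U \<and> openin Xs (p ` U) \<and>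
         homeomorphic_map (subtopology E U) (subtopology Xs (p ` U)) p"
  and continuous_zer: "continuous_map Xs E zer"
  and p_zer [simp]: "x \<in> topspace Xs \<Longrightarrow> p (zer x) = x"
  and continuous_neg: "continuous_map E E neg"
  and p_neg [simp]: "e \<in> topspace E \<Longrightarrow> p (neg e) = p e"
  and continuous_eadd: "continuous_map (subtopology (prod_topology E E)
                       {(e, f). e \<in> topspace E \<and> f \<in> topspace E \<and> p e = p f})
                    E (\<lambda>(e, f). eadd e f)"
  and p_eadd: "e \<in> topspace E \<Longrightarrow> f \<in> topspace E \<Longrightarrow> p e = p f \<Longrightarrow> p (eadd e f) = p e"
  and eadd_assoc: "e \<in> topspace E \<Longrightarrow> f \<in> topspace E \<Longrightarrow> k \<in> topspace E \<Longrightarrow> p e = p f \<Longrightarrow> p f = p k \<Longrightarrow>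
         eadd (eadd e f) k = eadd e (eadd f k)"
  and eadd_commute: "e \<in> topspace E \<Longrightarrow> f \<in> topspace E \<Longrightarrow> p e = p f \<Longrightarrow> eadd e f = eadd f e"
  and eadd_zer: "e \<in> topspace E \<Longrightarrow> eadd (zer (p e)) e = e"
  and eadd_neg: "e \<in> topspace E \<Longrightarrow> eadd (neg e) e = zer (p e)"
  using etale unfolding etale_sheaf_def by blast+

lemma zer_closed [simp]: "x \<in> topspace Xs \<Longrightarrow> zer x \<in> topspace E"
  using continuous_map_image_subset_topspace[OF continuous_zer] by blast

lemma p_closed [simp]: "e \<in> topspace E \<Longrightarrow> p e \<in> topspace Xs"
  using continuous_map_image_subset_topspace[OF continuous_p] by blast

lemma neg_closed [simp]: "e \<in> topspace E \<Longrightarrow> neg e \<in> topspace E"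
  using continuous_map_image_subset_topspace[OF continuous_neg] by blast

lemma continuous_tau:
  assumes "g \<in> Zd d" shows "continuous_map E E (\<lambda>e. tau e g)"
proof -
  have "continuous_map E (prod_topology E (discrete_topology (Zd d))) (\<lambda>x. (x, g))"
    using assms by (simp add: continuous_map_pairwise comp_def)
  moreover have "continuous_map (prod_topology E (discrete_topology (Zd d))) E (\<lambda>(e, g). tau e g)"
    using sheaf by (simp add: equivariant_sheaf_def)
  ultimately show ?thesis using continuous_map_compose by (fastforce simp: comp_def)
qed

lemma tau_closed [simp]: "e \<in> topspace E \<Longrightarrow> g \<in> Zd d \<Longrightarrow> tau e g \<in> topspace E"
  using continuous_map_image_subset_topspace[OF continuous_tau] by blast

lemma p_tau: "e \<in> topspace E \<Longrightarrow> g \<in> Zd d \<Longrightarrow> p (tau e g) = act (p e) g"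
  and tau_vzero: "e \<in> topspace E \<Longrightarrow> tau e vzero = e"
  and tau_vadd: "e \<in> topspace E \<Longrightarrow> g \<in> Zd d \<Longrightarrow> h \<in> Zd d \<Longrightarrow> tau (tau e g) h = tau e (vadd g h)"
  and tau_eadd: "e \<in> topspace E \<Longrightarrow> f \<in> topspace E \<Longrightarrow> g \<in> Zd d \<Longrightarrow> p e = p f \<Longrightarrow>
         tau (eadd e f) g = eadd (tau e g) (tau f g)"
  using sheaf unfolding equivariant_sheaf_def by blast+

lemma eadd_idem_zer:
  assumes e: "e \<in> topspace E" and idem: "eadd e e = e" shows "e = zer (p e)"
proof -
  have "zer (p e) = eadd (neg e) (eadd e e)" using e idem by (simp add: eadd_neg)
  also have "\<dots> = eadd (eadd (neg e) e) e" using e by (simp add: eadd_assoc)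
  also have "\<dots> = e" using e by (simp add: eadd_neg eadd_zer)
  finally show ?thesis by simp
qed

text \<open>The fibre maps of \<open>tau\<close> are additive and so preserve idempotents, and zero
  is the only idempotent of a fibre.\<close>

lemma tau_zer:
  assumes x: "x \<in> topspace Xs" and g: "g \<in> Zd d" shows "tau (zer x) g = zer (act x g)"
proof -
  have "eadd (zer x) (zer x) = zer x" using eadd_zer[of "zer x"] x by simp
  then have "eadd (tau (zer x) g) (tau (zer x) g) = tau (zer x) g"
    using tau_eadd[of "zer x" "zer x" g] x g by simp
  then show ?thesis using eadd_idem_zer[of "tau (zer x) g"] x g by (simp add: p_tau)
qed

section \<open>The module of global sections and their supports\<close>

abbreviation \<Gamma> where "\<Gamma> \<equiv> global_sections Xs E p zer"

lemma sec_iff: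
  "s \<in> \<Gamma> \<longleftrightarrow> continuous_map Xs E s \<and> (\<forall>x\<in>topspace Xs. p (s x) = x) \<and> (\<forall>x. x \<notin> topspace Xs \<longrightarrow> s x = zer x)"
  by (auto simp: global_sections_def section_on_def)

lemma sec_cont: "s \<in> \<Gamma> \<Longrightarrow> continuous_map Xs E s"
  and sec_p [simp]: "s \<in> \<Gamma> \<Longrightarrow> x \<in> topspace Xs \<Longrightarrow> p (s x) = x"
  and sec_outside: "s \<in> \<Gamma> \<Longrightarrow> x \<notin> topspace Xs \<Longrightarrow> s x = zer x"
  by (auto simp: sec_iff)

lemma sec_closed [simp]: "s \<in> \<Gamma> \<Longrightarrow> x \<in> topspace Xs \<Longrightarrow> s x \<in> topspace E"
  using continuous_map_image_subset_topspace[OF sec_cont] by blast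

lemma sec_eqI: "s \<in> \<Gamma> \<Longrightarrow> s' \<in> \<Gamma> \<Longrightarrow> (\<And>x. x \<in> topspace Xs \<Longrightarrow> s x = s' x) \<Longrightarrow> s = s'"
  by (rule ext) (metis sec_outside)

lemma zer_sec [simp]: "zer \<in> \<Gamma>"
  by (simp add: sec_iff continuous_zer)

lemma sec_add_sec:
  assumes s: "s \<in> \<Gamma>" and s': "s' \<in> \<Gamma>" shows "sec_add Xs eadd zer s s' \<in> \<Gamma>"
proof -
  have "continuous_map Xs (subtopology (prod_topology E E)
                       {(e, f). e \<in> topspace E \<and> f \<in> topspace E \<and> p e = p f}) (\<lambda>x. (s x, s' x))"
    using s s' by (auto simp: continuous_map_in_subtopology continuous_map_pairwise comp_def sec_cont)
  from continuous_map_compose[OF this continuous_eadd]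
  have "continuous_map Xs E (\<lambda>x. eadd (s x) (s' x))" by (simp add: comp_def)
  then have "continuous_map Xs E (sec_add Xs eadd zer s s')"
    by (rule continuous_map_eq) (simp add: sec_add_def)
  then show ?thesis using s s' by (simp add: sec_iff sec_add_def p_eadd)
qed

definition sec_neg :: "('a \<Rightarrow> 'e) \<Rightarrow> 'a \<Rightarrow> 'e" where
  "sec_neg s = (\<lambda>x. if x \<in> topspace Xs then neg (s x) else zer x)"

lemma sec_neg_sec:
  assumes s: "s \<in> \<Gamma>" shows "sec_neg s \<in> \<Gamma>"
proof -
  have "continuous_map Xs E (\<lambda>x. neg (s x))"
    using continuous_map_compose[OF sec_cont[OF s] continuous_neg] by (simp add: comp_def)
  then have "continuous_map Xs E (sec_neg s)"
    by (rule continuous_map_eq) (simp add: sec_neg_def)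
  then show ?thesis using s by (simp add: sec_iff sec_neg_def)
qed

definition Sec :: "('a \<Rightarrow> 'e) monoid" where
  "Sec = \<lparr>carrier = \<Gamma>, mult = sec_add Xs eadd zer, one = zer\<rparr>"

abbreviation sact where "sact \<equiv> sec_act Xs act tau zer"

lemma Sec_simps [simp]:
  "carrier Sec = \<Gamma>" "mult Sec = sec_add Xs eadd zer" "one Sec = zer"
  by (simp_all add: Sec_def)

lemma sec_add_app: "x \<in> topspace Xs \<Longrightarrow> sec_add Xs eadd zer s s' x = eadd (s x) (s' x)"
  by (simp add: sec_add_def)

lemma comm_group_Sec: "comm_group Sec"
proof (rule comm_groupI)
  fix s assume s: "s \<in> carrier Sec"
  have "sec_add Xs eadd zer (sec_neg s) s = zer"
    using s sec_neg_sec[of s]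
    by (intro sec_eqI) (auto simp: sec_add_sec sec_add_app sec_neg_def eadd_neg)
  then show "\<exists>s'\<in>carrier Sec. s' \<otimes>\<^bsub>Sec\<^esub> s = \<one>\<^bsub>Sec\<^esub>"
    using s sec_neg_sec[of s] by auto
  show "\<one>\<^bsub>Sec\<^esub> \<otimes>\<^bsub>Sec\<^esub> s = s"
  proof (rule sec_eqI)
    fix x assume "x \<in> topspace Xs"
    then show "(\<one>\<^bsub>Sec\<^esub> \<otimes>\<^bsub>Sec\<^esub> s) x = s x" using s eadd_zer[of "s x"] by (simp add: sec_add_app)
  qed (use s in \<open>simp_all add: sec_add_sec\<close>)
next
  fix s s' assume "s \<in> carrier Sec" "s' \<in> carrier Sec"
  then show "s \<otimes>\<^bsub>Sec\<^esub> s' = s' \<otimes>\<^bsub>Sec\<^esub> s"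
    by (intro sec_eqI) (auto simp: sec_add_sec sec_add_app eadd_commute)
next
  fix s s' s'' assume "s \<in> carrier Sec" "s' \<in> carrier Sec" "s'' \<in> carrier Sec"
  then show "s \<otimes>\<^bsub>Sec\<^esub> s' \<otimes>\<^bsub>Sec\<^esub> s'' = s \<otimes>\<^bsub>Sec\<^esub> (s' \<otimes>\<^bsub>Sec\<^esub> s'')"
    by (intro sec_eqI) (auto simp: sec_add_sec sec_add_app eadd_assoc)
qed (auto simp: sec_add_sec)

sublocale Sec: comm_group Sec by (rule comm_group_Sec)

lemma sact_app: "x \<in> topspace Xs \<Longrightarrow> sact g s x = tau (s (act x (vneg g))) g"
  by (simp add: sec_act_def)

lemma sact_sec:
  assumes s: "s \<in> \<Gamma>" and g: "g \<in> Zd d" shows "sact g s \<in> \<Gamma>"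
proof -
  have "continuous_map Xs E (\<lambda>x. tau (s (act x (vneg g))) g)"
    using continuous_map_compose[OF continuous_map_compose[OF continuous_act sec_cont[OF s]] continuous_tau[OF g], of "vneg g"] g
    by (simp add: comp_def)
  then have "continuous_map Xs E (sact g s)"
    by (rule continuous_map_eq) (simp add: sact_app)
  then show ?thesis using s g by (simp add: sec_iff sact_app p_tau) (simp add: sec_act_def)
qed

lemma gmodule_Sec: "gmodule Sec d sact"
proof unfold_locales
  fix g assume g: "g \<in> Zd d"
  show "sact g \<in> hom Sec Sec"
  proof (rule homI)
    fix s assume s: "s \<in> carrier Sec"
    then show "sact g s \<in> carrier Sec" using g sact_sec by simp
    fix s' assume s': "s' \<in> carrier Sec"
    show "sact g (s \<otimes>\<^bsub>Sec\<^esub> s') = sact g s \<otimes>\<^bsub>Sec\<^esub> sact g s'"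
      using s s' g by (intro sec_eqI) (auto simp: sact_sec sec_add_sec sec_add_app sact_app tau_eadd)
  qed
  fix h s assume h: "h \<in> Zd d" and s: "s \<in> carrier Sec"
  show "sact g (sact h s) = sact (vadd g h) s"
    using g h s
    by (intro sec_eqI) (auto simp: sact_sec sact_app tau_vadd act_vadd vneg_vadd vadd_commute)
next
  fix s assume "s \<in> carrier Sec"
  then show "sact vzero s = s"
    by (intro sec_eqI) (auto simp: sact_sec sact_app tau_vzero)
qed

sublocale Sec: gmodule Sec d sact by (rule gmodule_Sec)

abbreviation spt where "spt \<equiv> supp Xs zer"

lemma spt_iff: "x \<in> spt s \<longleftrightarrow> x \<in> topspace Xs \<and> s x \<noteq> zer x"
  by (simp add: supp_def)

text \<open>The projection is injective near each point of \<open>E\<close>, so two sections that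
  agree at a point agree around it. Vanishing is thus an open condition.\<close>

lemma closedin_spt:
  assumes s: "s \<in> \<Gamma>" shows "closedin Xs (spt s)"
proof -
  have "openin Xs {x \<in> topspace Xs. s x = zer x}"
  proof (subst openin_subopen, intro ballI)
    fix x assume "x \<in> {x \<in> topspace Xs. s x = zer x}"
    then have x: "x \<in> topspace Xs" "s x = zer x" by auto
    obtain U where U: "openin E U" "s x \<in> U" "homeomorphic_map (subtopology E U) (subtopology Xs (p ` U)) p"
      using local_homeo[OF sec_closed[OF s x(1)]] by blast
    have inj: "inj_on p U"
      using homeomorphic_imp_injective_map[OF U(3)] openin_subset[OF U(1)] by (simp add: inf_absorb2)
    let ?W = "{y \<in> topspace Xs. s y \<in> U} \<inter> {y \<in> topspace Xs. zer y \<in> U}"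
    have "openin Xs ?W"
      using openin_continuous_map_preimage[OF sec_cont[OF s] U(1)]
        openin_continuous_map_preimage[OF continuous_zer U(1)] by blast
    moreover have "s y = zer y" if "y \<in> ?W" for y
      using inj_onD[OF inj, of "s y" "zer y"] that s by simp
    moreover have "x \<in> ?W" using x U(2) by auto
    ultimately show "\<exists>T. openin Xs T \<and> x \<in> T \<and> T \<subseteq> {x \<in> topspace Xs. s x = zer x}"
      by blast
  qed
  moreover have "spt s = topspace Xs - {x \<in> topspace Xs. s x = zer x}" by (auto simp: supp_def)
  ultimately show ?thesis by (simp add: closedin_diff)
qed

lemma spt_sec_add:
  assumes "s \<in> \<Gamma>" "s' \<in> \<Gamma>" shows "spt (sec_add Xs eadd zer s s') \<subseteq> spt s \<union> spt s'"
proof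
  fix x assume x: "x \<in> spt (sec_add Xs eadd zer s s')"
  show "x \<in> spt s \<union> spt s'"
  proof (rule ccontr)
    assume "x \<notin> spt s \<union> spt s'"
    then have "s x = zer x" "s' x = zer x" using x by (auto simp: spt_iff)
    moreover have "x \<in> topspace Xs" using x by (simp add: spt_iff)
    ultimately show False using x eadd_zer[of "zer x"] by (simp add: spt_iff sec_add_app)
  qed
qed

lemma inv_Sec_app:
  assumes s: "s \<in> \<Gamma>" and x: "x \<in> topspace Xs" shows "(inv\<^bsub>Sec\<^esub> s) x = neg (s x)"
proof -
  have "inv\<^bsub>Sec\<^esub> s = sec_neg s"
    using s sec_neg_sec[OF s]
    by (intro Sec.inv_equality sec_eqI) (auto simp: sec_add_sec sec_add_app sec_neg_def eadd_neg)
  then show ?thesis using x by (simp add: sec_neg_def)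
qed

lemma neg_zer: "x \<in> topspace Xs \<Longrightarrow> neg (zer x) = zer x"
  using eadd_neg[of "zer x"] eadd_zer[of "neg (zer x)"] eadd_commute[of "neg (zer x)" "zer x"] by simp

lemma spt_inv: "s \<in> \<Gamma> \<Longrightarrow> spt (inv\<^bsub>Sec\<^esub> s) \<subseteq> spt s"
  by (auto simp: spt_iff inv_Sec_app neg_zer)

lemma spt_sact:
  assumes s: "s \<in> \<Gamma>" and g: "g \<in> Zd d" shows "spt (sact g s) \<subseteq> (\<lambda>x. act x g) ` spt s"
proof
  fix x assume "x \<in> spt (sact g s)"
  then have x: "x \<in> topspace Xs" "tau (s (act x (vneg g))) g \<noteq> zer x" by (auto simp: spt_iff sact_app)
  have "act x (vneg g) \<in> spt s"
    using x g tau_zer[of "act x (vneg g)" g] by (auto simp: spt_iff)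
  moreover have "x = act (act x (vneg g)) g" using x g by simp
  ultimately show "x \<in> (\<lambda>x. act x g) ` spt s" by blast
qed

end

subsection \<open>Sections supported in translates of compact sets\<close>

context equivariant_etale
begin

definition secS :: "(nat \<Rightarrow> int) set \<Rightarrow> ('a \<Rightarrow> 'e) set" where
  "secS S = {s \<in> \<Gamma>. \<exists>K. compactin Xs K \<and> spt s \<subseteq> tr K S}"

lemma secS_sec: "s \<in> secS S \<Longrightarrow> s \<in> \<Gamma>"
  by (simp add: secS_def)

lemma secSI: "s \<in> \<Gamma> \<Longrightarrow> compactin Xs K \<Longrightarrow> spt s \<subseteq> tr K S \<Longrightarrow> s \<in> secS S"
  by (auto simp: secS_def)

lemma secSE:
  assumes "s \<in> secS S"
  obtains K where "compactin Xs K" "spt s \<subseteq> tr K S"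
  using assms by (auto simp: secS_def)

lemma secS_mono: "S \<subseteq> S' \<Longrightarrow> secS S \<subseteq> secS S'"
  unfolding secS_def using tr_mono[OF order_refl, of S S'] by blast

lemma gsub_secS:
  assumes S: "S \<subseteq> Zd d" shows "Sec.gsub (secS S)"
proof -
  have "subgroup (secS S) Sec"
  proof (rule Sec.subgroupI)
    show "secS S \<subseteq> carrier Sec" using secS_sec by auto
    have "spt zer = {}" by (simp add: supp_def)
    then have "zer \<in> secS S" by (intro secSI[of _ "{}"]) auto
    then show "secS S \<noteq> {}" by blast
    fix s assume s: "s \<in> secS S"
    note sec = secS_sec[OF s]
    obtain K where K: "compactin Xs K" "spt s \<subseteq> tr K S" using s by (rule secSE)
    have "inv\<^bsub>Sec\<^esub> s \<in> \<Gamma>" using Sec.inv_closed[of s] sec by simp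
    then show "inv\<^bsub>Sec\<^esub> s \<in> secS S"
      using K spt_inv[OF sec] by (intro secSI[OF _ K(1)]) auto
    fix s' assume s': "s' \<in> secS S"
    note sec' = secS_sec[OF s']
    obtain K' where K': "compactin Xs K'" "spt s' \<subseteq> tr K' S" using s' by (rule secSE)
    have "spt (sec_add Xs eadd zer s s') \<subseteq> tr (K \<union> K') S"
      using spt_sec_add[OF sec sec'] K(2) K'(2) tr_mono[of K "K \<union> K'" S S] tr_mono[of K' "K \<union> K'" S S] by blast
    then show "s \<otimes>\<^bsub>Sec\<^esub> s' \<in> secS S"
      using sec_add_sec[OF sec sec'] compactin_Un[OF K(1) K'(1)] by (auto intro: secSI)
  qed
  moreover have "sact g s \<in> secS S" if g: "g \<in> Zd d" and s: "s \<in> secS S" for g s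
  proof -
    note sec = secS_sec[OF s]
    obtain K where K: "compactin Xs K" "spt s \<subseteq> tr K S" using s by (rule secSE)
    have "spt (sact g s) \<subseteq> tr ((\<lambda>x. act x g) ` K) S"
    proof
      fix x assume "x \<in> spt (sact g s)"
      then obtain y where y: "y \<in> spt s" "x = act y g" using spt_sact[OF sec g] by blast
      then obtain k h where k: "k \<in> K" "h \<in> S" "y = act k h"
        using K(2) unfolding tr_def by blast
      have "k \<in> topspace Xs" using k K(1) compactin_subset_topspace by blast
      \<comment> \<open>Commutativity moves \<open>g\<close> past \<open>h\<close> onto the compact
        set.\<close>
      then have "x = act (act k g) h"
        using k y g S by (simp add: act_vadd vadd_commute subsetD[OF S])
      then show "x \<in> tr ((\<lambda>x. act x g) ` K) S" using k by (auto simp: tr_iff)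
    qed
    then show ?thesis using sact_sec[OF sec g] compactin_act[OF K(1) g] by (intro secSI)
  qed
  ultimately show ?thesis by (simp add: Sec.gsub_def)
qed

text \<open>Supplies sums of locally finite series: near each point the sequence is eventually one
  fixed section, and these sections glue.\<close>

lemma stable_limit:
  assumes P: "\<And>n. P n \<in> \<Gamma>"
    and stable: "\<And>x. x \<in> topspace Xs \<Longrightarrow> \<exists>V N. openin Xs V \<and> x \<in> V \<and> (\<forall>n\<ge>N. \<forall>y\<in>V. P n y = P N y)"
  obtains u where "u \<in> \<Gamma>" "\<And>x. x \<in> topspace Xs \<Longrightarrow> \<exists>N::nat. \<forall>n\<ge>N. u x = P n x"
proof -
  obtain V N where VN: "\<And>x. x \<in> topspace Xs \<Longrightarrow> openin Xs (V x) \<and> x \<in> V x \<and> (\<forall>n\<ge>N x. \<forall>y\<in>V x. P n y = P (N x) y)"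
    using stable by metis
  define u where "u x = (if x \<in> topspace Xs then P (N x) x else zer x)" for x
  have u: "u x = P n x" if "x \<in> topspace Xs" "N x \<le> n" for x n
    using VN[OF that(1)] that by (metis u_def)
  have "continuous_map Xs E u"
  proof (rule pasting_lemma[where I = "topspace Xs" and T = V and f = "\<lambda>x. P (N x)"])
    show "continuous_map (subtopology Xs (V i)) E (P (N i))" for i
      using P sec_cont continuous_map_from_subtopology by blast
    fix i j x assume *: "i \<in> topspace Xs" "j \<in> topspace Xs" "x \<in> topspace Xs \<inter> V i \<inter> V j"
    then have "P (max (N i) (N j)) x = P (N i) x" "P (max (N i) (N j)) x = P (N j) x"
      using VN by (meson IntD1 IntD2 max.cobounded1 max.cobounded2)+
    then show "P (N i) x = P (N j) x" by simp
  next
    fix x assume x: "x \<in> topspace Xs"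
    show "openin Xs (V x)" using VN[OF x] by blast
    show "\<exists>j. j \<in> topspace Xs \<and> x \<in> V j \<and> u x = P (N j) x" using VN[OF x] u[OF x] x by blast
  qed
  moreover have "p (u x) = x" if "x \<in> topspace Xs" for x using that P u_def sec_p by simp
  ultimately have "u \<in> \<Gamma>" by (simp add: sec_iff u_def)
  then show thesis using that u by blast
qed

section \<open>Invertibility of 1 - t on sections supported in a half space\<close>

context
  fixes S :: "(nat \<Rightarrow> int) set" and t :: "nat \<Rightarrow> int" and lev :: "(nat \<Rightarrow> int) \<Rightarrow> int"
  assumes S: "S \<subseteq> Zd d" and t: "t \<in> Zd d" and S_t: "\<And>h. h \<in> S \<Longrightarrow> vadd h t \<in> S"
    and lev_nonneg: "\<And>h. h \<in> S \<Longrightarrow> 0 \<le> lev h"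
    and lev_t: "\<And>h. h \<in> Zd d \<Longrightarrow> lev (vadd h t) = lev h + 1"
begin

lemma sact_iterate_spt:
  assumes s: "s \<in> \<Gamma>" and K: "compactin Xs K" "spt s \<subseteq> tr K S"
  shows "(sact t ^^ n) s \<in> \<Gamma> \<and> spt ((sact t ^^ n) s) \<subseteq> tr K {h \<in> S. int n \<le> lev h}"
proof (induction n)
  case 0
  have "{h \<in> S. 0 \<le> lev h} = S" using lev_nonneg by auto
  then show ?case using s K by simp
next
  case (Suc n)
  let ?s = "(sact t ^^ n) s"
  have "spt (sact t ?s) \<subseteq> tr K {h \<in> S. int (Suc n) \<le> lev h}"
  proof
    fix x assume "x \<in> spt (sact t ?s)"
    then obtain y where "y \<in> spt ?s" "x = act y t" using spt_sact Suc t by blast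
    then obtain k h where k: "k \<in> K" "h \<in> S" "int n \<le> lev h" "x = act (act k h) t"
      using Suc unfolding tr_def by blast
    have hd: "h \<in> Zd d" "k \<in> topspace Xs" using k S K(1) compactin_subset_topspace by blast+
    then have "x = act k (vadd h t)" using k t by (simp add: act_vadd)
    moreover have "vadd h t \<in> {h \<in> S. int (Suc n) \<le> lev h}" using k hd S_t lev_t by simp
    ultimately show "x \<in> tr K {h \<in> S. int (Suc n) \<le> lev h}" using k(1) unfolding tr_iff by blast
  qed
  then show ?case using Suc t sact_sec by simp
qed

text \<open>The n-th translate lives on levels at least n, whereas by properness a compact
  neighbourhood meets translates of \<open>K\<close> on levels bounded above.\<close>

lemma sact_iterate_vanish:
  assumes s: "s \<in> \<Gamma>" and K: "compactin Xs K" "spt s \<subseteq> tr K S" and x: "x \<in> topspace Xs"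
  shows "\<exists>V N. openin Xs V \<and> x \<in> V \<and> (\<forall>n\<ge>N. \<forall>y\<in>V. (sact t ^^ n) s y = zer y)"
proof -
  obtain V L where V: "openin Xs V" "compactin Xs L" "x \<in> V" "V \<subseteq> L"
    using x by (rule compact_neighbourhood)
  obtain N where N: "N > 0" "\<And>g x. g \<in> Zd d \<Longrightarrow> x \<in> K \<Longrightarrow> act x g \<in> L \<Longrightarrow> lev g < N"
    using bounded_meeting[OF K(1) V(2), of lev] by blast
  have "(sact t ^^ n) s y = zer y" if n: "nat N \<le> n" and y: "y \<in> V" for n y
  proof (rule ccontr)
    assume "(sact t ^^ n) s y \<noteq> zer y"
    then have "y \<in> spt ((sact t ^^ n) s)" using y openin_subset[OF V(1)] by (auto simp: spt_iff)
    then obtain k h where kh: "k \<in> K" "h \<in> S" "int n \<le> lev h" "y = act k h"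
      using sact_iterate_spt[OF s K, of n] unfolding tr_def by blast
    then have "lev h < N" using N(2)[of h k] y V(4) S by blast
    then show False using kh(3) n by linarith
  qed
  then show ?thesis using V(1,3) by (intro exI[of _ V] exI[of _ "nat N"]) simp
qed

lemma shift_injective:
  assumes s: "s \<in> secS S" and inv: "sact t s = s" shows "s = zer"
proof (rule sec_eqI)
  note sec = secS_sec[OF s]
  obtain K where K: "compactin Xs K" "spt s \<subseteq> tr K S" using s by (rule secSE)
  show "s \<in> \<Gamma>" by (rule sec)
  fix x assume x: "x \<in> topspace Xs"
  obtain V N where V: "x \<in> V" and N: "\<forall>n\<ge>N. \<forall>y\<in>V. (sact t ^^ n) s y = zer y"
    using sact_iterate_vanish[OF sec K x] by (elim exE conjE)
  have "(sact t ^^ N) s x = zer x" using N V by simp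
  moreover have "(sact t ^^ n) s = s" for n using inv by (induction n) auto
  ultimately show "s x = zer x" by simp
qed simp

lemma shift_surjective:
  assumes s: "s \<in> secS S" shows "\<exists>u\<in>secS S. u \<otimes>\<^bsub>Sec\<^esub> inv\<^bsub>Sec\<^esub> (sact t u) = s"
proof -
  note sec = secS_sec[OF s]
  obtain K where K: "compactin Xs K" "spt s \<subseteq> tr K S" using s by (rule secSE)
  define it where "it n = (sact t ^^ n) s" for n
  have it: "it n \<in> \<Gamma>" "spt (it n) \<subseteq> tr K S" for n
    using sact_iterate_spt[OF sec K, of n] tr_mono[of K K "{h \<in> S. int n \<le> lev h}" S] unfolding it_def by blast+
  \<comment> \<open>Partial sums of s + t s + t^2 s + ... . All are supported in the same
    \<open>tr K S\<close>, because \<open>S\<close> is stable under adding \<open>t\<close>, so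
    their limit stays in \<open>secS S\<close>.\<close>
  define P where "P = rec_nat zer (\<lambda>n a. sec_add Xs eadd zer a (it n))"
  have P_simps: "P 0 = zer" "P (Suc n) = sec_add Xs eadd zer (P n) (it n)" for n
    by (simp_all add: P_def)
  have P: "P n \<in> \<Gamma> \<and> spt (P n) \<subseteq> tr K S" for n
  proof (induction n)
    case 0
    then show ?case by (auto simp: P_simps spt_iff)
  next
    case (Suc n)
    then show ?case using spt_sec_add[of "P n" "it n"] it[of n] sec_add_sec by (auto simp: P_simps)
  qed
  \<comment> \<open>The recursion from the other end, which passes to the limit as u = t u +
    s.\<close>
  have P_Suc: "P (Suc n) = sec_add Xs eadd zer (sact t (P n)) s" for n
  proof (induction n)
    case 0
    have "sact t zer = zer" using Sec.ma_one[OF t] by simp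
    then show ?case by (simp add: P_simps it_def)
  next
    case (Suc n)
    have *: "sact t (P n) \<in> \<Gamma>" "sact t (it n) \<in> \<Gamma>" using P it t sact_sec by auto
    have "it (Suc n) = sact t (it n)" by (simp add: it_def)
    then have "P (Suc (Suc n)) = sact t (P n) \<otimes>\<^bsub>Sec\<^esub> s \<otimes>\<^bsub>Sec\<^esub> sact t (it n)"
      using Suc by (simp add: P_simps)
    also have "\<dots> = sact t (P n) \<otimes>\<^bsub>Sec\<^esub> sact t (it n) \<otimes>\<^bsub>Sec\<^esub> s"
      using Sec.m_assoc[of "sact t (P n)" s "sact t (it n)"] Sec.m_assoc[of "sact t (P n)" "sact t (it n)" s]
        Sec.m_comm[of s "sact t (it n)"] sec * by (metis Sec_simps(1))
    also have "sact t (P n) \<otimes>\<^bsub>Sec\<^esub> sact t (it n) = sact t (P (Suc n))"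
      using Sec.ma_mult[OF t, of "P n" "it n"] P it by (simp add: P_simps)
    finally show ?case by simp
  qed
  have stable: "\<exists>V N. openin Xs V \<and> x \<in> V \<and> (\<forall>n\<ge>N. \<forall>y\<in>V. P n y = P N y)" if x: "x \<in> topspace Xs" for x
  proof -
    obtain V N where V: "openin Xs V" "x \<in> V" and N: "\<forall>n\<ge>N. \<forall>y\<in>V. it n y = zer y"
      using sact_iterate_vanish[OF sec K x] unfolding it_def by (elim exE conjE)
    have "P n y = P N y" if "N \<le> n" and y: "y \<in> V" for n y
      using that(1)
    proof (induction n rule: dec_induct)
      case (step n)
      have yt: "y \<in> topspace Xs" using y openin_subset[OF V(1)] by blast
      have "P (Suc n) y = eadd (P n y) (zer y)"
        using N step(1) y yt by (simp add: P_simps sec_add_app)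
      also have "\<dots> = P n y"
        using eadd_zer[of "P n y"] eadd_commute[of "P n y" "zer y"] P[of n] yt by simp
      finally show ?case using step by simp
    qed simp
    then show ?thesis using V by blast
  qed
  obtain u where u: "u \<in> \<Gamma>" "\<And>x. x \<in> topspace Xs \<Longrightarrow> \<exists>N::nat. \<forall>n\<ge>N. u x = P n x"
    by (rule stable_limit[of P]) (use P stable in blast)+
  have "spt u \<subseteq> tr K S"
  proof
    fix x assume x: "x \<in> spt u"
    then obtain N where "u x = P N x" using u(2)[of x] by (auto simp: spt_iff)
    then have "x \<in> spt (P N)" using x by (simp add: spt_iff)
    then show "x \<in> tr K S" using P by blast
  qed
  then have uS: "u \<in> secS S" using u(1) K(1) by (intro secSI)
  have "u = sec_add Xs eadd zer (sact t u) s"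
  proof (rule sec_eqI)
    fix x assume x: "x \<in> topspace Xs"
    have xt: "act x (vneg t) \<in> topspace Xs" using x t by simp
    obtain N where N: "\<forall>n\<ge>N. u x = P n x" using u(2)[OF x] by blast
    obtain N' where N': "\<forall>n\<ge>N'. u (act x (vneg t)) = P n (act x (vneg t))" using u(2)[OF xt] by blast
    \<comment> \<open>The limit is reached at different indices at \<open>x\<close> and at its
      translate; \<open>max N N'\<close> serves both.\<close>
    have "u x = P (Suc (max N N')) x" using N by simp
    also have "\<dots> = eadd (sact t (P (max N N')) x) (s x)" unfolding P_Suc using x by (simp add: sec_add_app)
    also have "sact t (P (max N N')) x = sact t u x"
    proof -
      have "u (act x (vneg t)) = P (max N N') (act x (vneg t))" using N' by (meson max.cobounded2)
      then show ?thesis using x by (simp add: sact_app)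
    qed
    finally show "u x = sec_add Xs eadd zer (sact t u) s x" using x by (simp add: sec_add_app)
  qed (use u(1) t sec sact_sec sec_add_sec in auto)
  then have "u = sact t u \<otimes>\<^bsub>Sec\<^esub> s" by simp
  moreover have "sact t u \<in> carrier Sec" "s \<in> carrier Sec" using u(1) t sec sact_sec by auto
  ultimately have "u \<otimes>\<^bsub>Sec\<^esub> inv\<^bsub>Sec\<^esub> (sact t u) = s"
    using Sec.inv_solve_right'[of s u "sact t u"] Sec.m_comm[of s "sact t u"] u(1) by simp
  then show ?thesis using uS by blast
qed

lemma secS_acyclic:
  "cocycles d (Sec\<lparr>carrier := secS S\<rparr>) sact n \<subseteq> coboundaries d (Sec\<lparr>carrier := secS S\<rparr>) sact n"
proof -
  interpret M: gmodule "Sec\<lparr>carrier := secS S\<rparr>" d sact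
    by (rule Sec.gmodule_gsub[OF gsub_secS[OF S]])
  have sub: "subgroup (secS S) Sec" and st: "\<And>u. u \<in> secS S \<Longrightarrow> sact t u \<in> secS S"
    using gsub_secS[OF S] t by (auto simp: Sec.gsub_def)
  show ?thesis
  proof (rule M.cocycles_subset_coboundaries_if_bij[OF t])
    fix s assume "s \<in> carrier (Sec\<lparr>carrier := secS S\<rparr>)"
    then have "\<exists>u\<in>secS S. u \<otimes>\<^bsub>Sec\<^esub> inv\<^bsub>Sec\<^esub> (sact t u) = s" using shift_surjective by simp
    then show "\<exists>u\<in>carrier (Sec\<lparr>carrier := secS S\<rparr>).
        u \<otimes>\<^bsub>Sec\<lparr>carrier := secS S\<rparr>\<^esub> inv\<^bsub>Sec\<lparr>carrier := secS S\<rparr>\<^esub> (sact t u) = s"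
      using Sec.m_inv_consistent[OF sub st] by auto
  next
    fix s assume "s \<in> carrier (Sec\<lparr>carrier := secS S\<rparr>)" "sact t s = s"
    then show "s = \<one>\<^bsub>Sec\<lparr>carrier := secS S\<rparr>\<^esub>" using shift_injective by simp
  qed
qed

end

section \<open>Half spaces and their acyclicity\<close>

definition upper :: "nat \<Rightarrow> (nat \<Rightarrow> int) set" where
  "upper k = {g \<in> Zd (Suc k). 0 \<le> g k}"

definition lower :: "nat \<Rightarrow> (nat \<Rightarrow> int) set" where
  "lower k = {g \<in> Zd (Suc k). g k \<le> 0}"

lemma Zd_mono: "k \<le> m \<Longrightarrow> Zd k \<subseteq> Zd m"
  by (auto simp: Zd_def)

lemma upper_acyclic:
  assumes k: "k < d"
  shows "cocycles d (Sec\<lparr>carrier := secS (upper k)\<rparr>) sact n \<subseteq> coboundaries d (Sec\<lparr>carrier := secS (upper k)\<rparr>) sact n"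
proof (rule secS_acyclic[where t = "unit_vec k" and lev = "\<lambda>g. g k"])
  show "upper k \<subseteq> Zd d" using Zd_mono[of "Suc k" d] k by (auto simp: upper_def)
  show "unit_vec k \<in> Zd d" by (rule unit_vec_Zd[OF k])
qed (auto simp: upper_def vadd_def unit_vec_def Zd_def)

lemma lower_acyclic:
  assumes k: "k < d"
  shows "cocycles d (Sec\<lparr>carrier := secS (lower k)\<rparr>) sact n \<subseteq> coboundaries d (Sec\<lparr>carrier := secS (lower k)\<rparr>) sact n"
proof (rule secS_acyclic[where t = "vneg (unit_vec k)" and lev = "\<lambda>g. - g k"])
  show "lower k \<subseteq> Zd d" using Zd_mono[of "Suc k" d] k by (auto simp: lower_def)
  show "vneg (unit_vec k) \<in> Zd d" using unit_vec_Zd[OF k] by simp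
qed (auto simp: lower_def vadd_def vneg_def unit_vec_def Zd_def)

end

section \<open>Mayer-Vietoris decomposition into half spaces\<close>

context equivariant_etale
begin

definition axis :: "nat \<Rightarrow> int \<Rightarrow> nat \<Rightarrow> int" where
  "axis k j = (\<lambda>i. if i = k then j else 0)"

lemma axis_Zd: "k < d \<Longrightarrow> axis k j \<in> Zd d"
  by (auto simp: axis_def Zd_def)

text \<open>Moving the compact set by \<open>c\<close> moves the level at which a half space begins,
  so a bound at any level, not only at 0, gives membership in \<open>secS (upper k)\<close> or
  \<open>secS (lower k)\<close>.\<close>

lemma secS_shift:
  assumes s: "s \<in> \<Gamma>" and L: "compactin Xs L" and c: "c \<in> Zd d" and T: "T \<subseteq> Zd d"
    and spt: "spt s \<subseteq> tr L T" and shift: "\<And>g. g \<in> T \<Longrightarrow> vadd (vneg c) g \<in> S"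
  shows "s \<in> secS S"
proof (rule secSI[OF s compactin_act[OF L c]])
  show "spt s \<subseteq> tr ((\<lambda>x. act x c) ` L) S"
  proof
    fix x assume "x \<in> spt s"
    then obtain l g where lg: "l \<in> L" "g \<in> T" "x = act l g" using spt unfolding tr_def by blast
    have "l \<in> topspace Xs" "g \<in> Zd d" using lg L T compactin_subset_topspace by blast+
    then have "act (act l c) (vadd (vneg c) g) = x"
      using c lg(3) by (simp add: act_vadd vadd_assoc[symmetric])
    then show "x \<in> tr ((\<lambda>x. act x c) ` L) S" using lg shift unfolding tr_def by blast
  qed
qed

text \<open>A point of the support is both \<open>act a g\<close> and \<open>act b h\<close> with
  g_k \<ge> 0 \<ge> h_k. Then g - h carries \<open>a\<close> into \<open>K'\<close>, so properness
  bounds g_k - h_k and with it g_k. The finitely many possible steps in direction \<open>k\<close>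
  are absorbed into the compact set.\<close>

lemma secS_upper_Int_lower:
  assumes k: "k < d"
  shows "secS (upper k) \<inter> secS (lower k) = secS (Zd k)"
proof (intro equalityI subsetI)
  fix s assume "s \<in> secS (Zd k)"
  moreover have "Zd k \<subseteq> upper k" "Zd k \<subseteq> lower k" by (auto simp: upper_def lower_def Zd_def)
  ultimately show "s \<in> secS (upper k) \<inter> secS (lower k)" using secS_mono by blast
next
  fix s assume s: "s \<in> secS (upper k) \<inter> secS (lower k)"
  then have sec: "s \<in> \<Gamma>" using secS_sec by blast
  obtain K where K: "compactin Xs K" "spt s \<subseteq> tr K (upper k)" using s by (auto elim: secSE)
  obtain K' where K': "compactin Xs K'" "spt s \<subseteq> tr K' (lower k)" using s by (auto elim: secSE)
  obtain N where N: "N > 0" "\<And>g x. g \<in> Zd d \<Longrightarrow> x \<in> K \<Longrightarrow> act x g \<in> K' \<Longrightarrow> g k < N"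
    using bounded_meeting[OF K(1) K'(1), of "\<lambda>g. g k"] by blast
  let ?K = "\<Union>j\<in>{0..N}. (\<lambda>x. act x (axis k j)) ` K"
  show "s \<in> secS (Zd k)"
  proof (rule secSI[OF sec, of ?K])
    show "compactin Xs ?K"
      using compactin_act[OF K(1) axis_Zd[OF k]] by (intro compactin_Union) auto
    show "spt s \<subseteq> tr ?K (Zd k)"
    proof
      fix x assume x: "x \<in> spt s"
      obtain a g where a: "a \<in> K" "g \<in> upper k" "x = act a g" using x K(2) unfolding tr_def by blast
      obtain b h where b: "b \<in> K'" "h \<in> lower k" "x = act b h" using x K'(2) unfolding tr_def by blast
      have Z: "g \<in> Zd d" "h \<in> Zd d"
        using a b Zd_mono[of "Suc k" d] k by (auto simp: upper_def lower_def)
      have T: "a \<in> topspace Xs" "b \<in> topspace Xs"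
        using a b K(1) K'(1) compactin_subset_topspace by blast+
      have "act a (vadd g (vneg h)) = act (act b h) (vneg h)"
        using a(3) b(3) Z T act_vadd[of a g "vneg h"] by simp
      then have "act a (vadd g (vneg h)) \<in> K'" using b Z T by simp
      then have "vadd g (vneg h) k < N" using N(2)[of "vadd g (vneg h)" a] a Z by simp
      then have gk: "g k \<in> {0..N}" using a(2) b(2) by (auto simp: upper_def lower_def vadd_def vneg_def)
      have dec: "vadd (axis k (g k)) (g(k := 0)) = g" by (auto simp: vadd_def axis_def)
      have "g(k := 0) \<in> Zd k" using a(2) by (auto simp: upper_def Zd_def)
      moreover have "x = act (act a (axis k (g k))) (g(k := 0))"
        using a(3) T Z fun_upd_Zd[OF Z(1) k] axis_Zd[OF k] by (simp add: act_vadd dec)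
      ultimately show "x \<in> tr ?K (Zd k)" using a(1) gk unfolding tr_def by blast
    qed
  qed
qed

text \<open>A section is prescribed on a closed set: equal to \<open>s\<close> far up, zero far
  down, and zero on a shell around the support. Softness extends it, and the shell permits cutting
  the extension off, so that its support is again controlled by a compact set.\<close>

lemma secS_split:
  assumes soft: "soft_wrt Xs E p (Supp Xs (cZd Xs d act))" and k: "k < d" and s: "s \<in> secS (Zd (Suc k))"
  shows "\<exists>u\<in>secS (upper k). \<exists>v\<in>secS (lower k). s = u \<otimes>\<^bsub>Sec\<^esub> inv\<^bsub>Sec\<^esub> v"
proof -
  let ?B = "Zd (Suc k)"
  note sec = secS_sec[OF s]
  have Bd: "?B \<subseteq> Zd d" using Zd_mono[of "Suc k" d] k by simp
  obtain K where K: "compactin Xs K" "spt s \<subseteq> tr K ?B" using s by (rule secSE)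
  obtain U L where UL: "openin Xs U" "compactin Xs L" "K \<subseteq> U" "U \<subseteq> L"
    using loc_compact hausdorff K(1) locally_compact_space_compact_closed_compact by metis
  \<comment> \<open>With this \<open>N\<close> the parts above level N and below level -N are
    disjoint: a common point would give an element of level at least 2 N carrying a point of
    \<open>L\<close> into \<open>L\<close>.\<close>
  obtain N where N: "N > 0" "\<And>g x. g \<in> Zd d \<Longrightarrow> x \<in> L \<Longrightarrow> act x g \<in> L \<Longrightarrow> g k < N"
    using bounded_meeting[OF UL(2) UL(2), of "\<lambda>g. g k"] by blast
  have Ltop: "L \<subseteq> topspace Xs" by (rule compactin_subset_topspace[OF UL(2)])
  define A where "A = tr L {g \<in> ?B. N \<le> g k}"
  define C where "C = tr L {g \<in> ?B. g k \<le> - N}"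
  \<comment> \<open>As \<open>K\<close> lies in the open \<open>U\<close> and \<open>U\<close> in
    the compact \<open>L\<close>, this is a closed shell on which \<open>s\<close> vanishes.\<close>
  define D where "D = tr L ?B - tr U ?B"
  have AC: "A \<inter> C = {}"
  proof (rule ccontr)
    assume "A \<inter> C \<noteq> {}"
    then obtain a g b h where *: "a \<in> L" "g \<in> ?B" "N \<le> g k" "b \<in> L" "h \<in> ?B" "h k \<le> - N" "act a g = act b h"
      unfolding A_def C_def tr_def by blast
    have Z: "g \<in> Zd d" "h \<in> Zd d" and T: "a \<in> topspace Xs" "b \<in> topspace Xs" using * Bd Ltop by blast+
    have "act a (vadd g (vneg h)) = act (act b h) (vneg h)"
      using *(7) Z T act_vadd[of a g "vneg h"] by simp
    then have "act a (vadd g (vneg h)) \<in> L" using * Z T by simp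
    then have "vadd g (vneg h) k < N" using N(2)[of "vadd g (vneg h)" a] * Z by simp
    then show False using * N(1) by (simp add: vadd_def vneg_def)
  qed
  have sD: "s x = zer x" if "x \<in> D" for x
  proof -
    have "x \<notin> tr K ?B" using that tr_mono[OF UL(3) order_refl] by (auto simp: D_def)
    moreover have "x \<in> topspace Xs" using that tr_subset_topspace[OF Ltop Bd] by (auto simp: D_def)
    ultimately show ?thesis using K(2) by (auto simp: spt_iff subset_iff)
  qed
  have clL: "closedin Xs (tr L ?B)" by (rule closedin_tr[OF UL(2) Bd])
  have opU: "openin Xs (tr U ?B)" by (rule openin_tr[OF UL(1) Bd])
  have clA: "closedin Xs A" unfolding A_def using Bd by (intro closedin_tr[OF UL(2)]) auto
  have clC: "closedin Xs C" unfolding C_def using Bd by (intro closedin_tr[OF UL(2)]) auto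
  have clD: "closedin Xs D" unfolding D_def by (rule closedin_diff[OF clL opU])
  let ?r = "\<lambda>x. if x \<in> A then s x else zer x"
  have cl: "closedin Xs (A \<union> (C \<union> D))" using clA clC clD by blast
  have "section_on Xs E p (A \<union> (C \<union> D)) ?r"
    unfolding section_on_def
  proof
    show "continuous_map (subtopology Xs (A \<union> (C \<union> D))) E ?r"
      using clA clC clD sec_cont[OF sec] continuous_zer AC sD
      by (intro continuous_map_paste_closed continuous_map_from_subtopology) auto
    show "\<forall>x\<in>A \<union> (C \<union> D). p (?r x) = x"
      using closedin_subset[OF cl] sec by (auto simp: subset_iff)
  qed
  moreover have "A \<union> (C \<union> D) \<in> Supp Xs (cZd Xs d act)"
    unfolding Supp_def
  proof (rule InterI)
    fix \<Phi> assume "\<Phi> \<in> {\<Phi>. family_of_supports Xs \<Phi> \<and> cZd Xs d act \<subseteq> \<Phi>}"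
    then have \<Phi>: "family_of_supports Xs \<Phi>" "cZd Xs d act \<subseteq> \<Phi>" by auto
    \<comment> \<open>\<open>cZd\<close> consists of saturations under the full group, so the closed
      set is placed inside one of them.\<close>
    have "tr L (Zd d) \<in> cZd Xs d act" unfolding cZd_def tr_def using UL(2) by blast
    moreover have "A \<union> (C \<union> D) \<subseteq> tr L (Zd d)"
      unfolding A_def C_def D_def tr_def using Bd by blast
    ultimately show "A \<union> (C \<union> D) \<in> \<Phi>" using \<Phi> cl unfolding family_of_supports_def by blast
  qed
  ultimately obtain r where r: "section_on Xs E p (topspace Xs) r" "\<And>x. x \<in> A \<union> (C \<union> D) \<Longrightarrow> r x = ?r x"
    using soft unfolding soft_wrt_def by blast
  have rC: "r x = zer x" if "x \<in> C \<union> D" for x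
  proof (cases "x \<in> A")
    case True
    then have "x \<in> D" using that AC by blast
    then show ?thesis using r(2)[of x] sD[of x] by auto
  next
    case False
    then show ?thesis using r(2)[of x] that by auto
  qed
  have rA: "r x = s x" if "x \<in> A" for x using r(2)[of x] that by auto
  \<comment> \<open>The set \<open>tr L ?B\<close> and the complement of \<open>tr U ?B\<close>
    overlap in \<open>D\<close>, where \<open>r\<close> is zero; hence the cut-off is
    continuous.\<close>
  define u where "u = (\<lambda>x. if x \<in> tr L ?B then r x else zer x)"
  have "tr L ?B \<union> (topspace Xs - tr U ?B) = topspace Xs"
    using tr_subset_topspace[OF Ltop Bd] tr_mono[OF UL(4) order_refl, of ?B] by blast
  moreover have "continuous_map (subtopology Xs (tr L ?B \<union> (topspace Xs - tr U ?B))) E u"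
    unfolding u_def
  proof (rule continuous_map_paste_closed)
    show "closedin Xs (topspace Xs - tr U ?B)" using opU by blast
    have "continuous_map Xs E r" using r(1) by (simp add: section_on_def)
    then show "continuous_map (subtopology Xs (tr L ?B)) E r" by (rule continuous_map_from_subtopology)
    show "continuous_map (subtopology Xs (topspace Xs - tr U ?B)) E zer"
      using continuous_zer by (rule continuous_map_from_subtopology)
    fix x assume "x \<in> tr L ?B" "x \<in> topspace Xs - tr U ?B"
    then show "r x = zer x" using rC[of x] by (simp add: D_def)
  qed (rule clL)
  ultimately have "continuous_map Xs E u" by simp
  then have u: "u \<in> \<Gamma>"
    using r(1) tr_subset_topspace[OF Ltop Bd] by (auto simp: sec_iff u_def section_on_def)
  have "spt u \<subseteq> tr L {g \<in> ?B. - N < g k}"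
  proof
    fix x assume x: "x \<in> spt u"
    then have "x \<in> tr L ?B" by (auto simp: spt_iff u_def split: if_splits)
    moreover have "x \<notin> C" using x rC[of x] by (auto simp: spt_iff u_def split: if_splits)
    ultimately show "x \<in> tr L {g \<in> ?B. - N < g k}" unfolding C_def tr_def not_le[symmetric] by blast
  qed
  \<comment> \<open>Levels above -N become positive once the compact set is moved by -N in direction
    \<open>k\<close>.\<close>
  then have uu: "u \<in> secS (upper k)"
    using Bd axis_Zd[OF k, of "- N"]
    by (intro secS_shift[OF u UL(2), of "axis k (- N)" "{g \<in> ?B. - N < g k}"])
       (auto simp: upper_def vadd_def vneg_def axis_def Zd_def)
  \<comment> \<open>This is u - s. It vanishes on \<open>A\<close>, where \<open>u\<close> equals
    \<open>s\<close>, and is therefore bounded above in direction \<open>k\<close>.\<close>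
  let ?v = "inv\<^bsub>Sec\<^esub> s \<otimes>\<^bsub>Sec\<^esub> u"
  have is_sec: "inv\<^bsub>Sec\<^esub> s \<in> \<Gamma>" using Sec.inv_closed[of s] sec by simp
  have v: "?v \<in> \<Gamma>" using sec_add_sec[OF is_sec u] by simp
  have "spt ?v \<subseteq> tr L {g \<in> ?B. g k < N}"
  proof
    fix x assume x: "x \<in> spt ?v"
    then have xt: "x \<in> topspace Xs" by (simp add: spt_iff)
    have "x \<in> spt s \<union> spt u" using x spt_sec_add[OF is_sec u] spt_inv[OF sec] by auto
    moreover have "spt u \<subseteq> tr L ?B" by (auto simp: spt_iff u_def split: if_splits)
    ultimately have xB: "x \<in> tr L ?B" using K(2) tr_mono[of K L ?B ?B] UL by blast
    have "x \<notin> A"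
    proof
      assume "x \<in> A"
      then have "u x = s x" using xB rA by (simp add: u_def)
      then have "?v x = zer x" using xt sec by (simp add: sec_add_app inv_Sec_app eadd_neg)
      then show False using x by (simp add: spt_iff)
    qed
    then show "x \<in> tr L {g \<in> ?B. g k < N}" using xB unfolding A_def tr_def not_le[symmetric] by blast
  qed
  then have vv: "?v \<in> secS (lower k)"
    using Bd axis_Zd[OF k, of N]
    by (intro secS_shift[OF v UL(2), of "axis k N" "{g \<in> ?B. g k < N}"])
       (auto simp: lower_def vadd_def vneg_def axis_def Zd_def)
  have "s = u \<otimes>\<^bsub>Sec\<^esub> inv\<^bsub>Sec\<^esub> ?v"
  proof -
    have c: "s \<in> carrier Sec" "u \<in> carrier Sec" using sec u by auto
    have "u \<otimes>\<^bsub>Sec\<^esub> inv\<^bsub>Sec\<^esub> ?v = u \<otimes>\<^bsub>Sec\<^esub> (s \<otimes>\<^bsub>Sec\<^esub> inv\<^bsub>Sec\<^esub> u)"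
      using c by (simp only: Sec.inv_mult Sec.inv_closed Sec.inv_inv)
    also have "\<dots> = s \<otimes>\<^bsub>Sec\<^esub> (u \<otimes>\<^bsub>Sec\<^esub> inv\<^bsub>Sec\<^esub> u)"
      using c by (simp only: Sec.m_lcomm Sec.inv_closed)
    also have "\<dots> = s" using c by (simp only: Sec.r_inv Sec.r_one)
    finally show ?thesis by simp
  qed
  then show ?thesis using uu vv by blast
qed

lemma secS_Zd_0: "secS (Zd 0) = Gamma_c Xs E p zer"
proof -
  have Z: "Zd 0 = {vzero}" by (auto simp: Zd_def vzero_def)
  have tr0: "tr K (Zd 0) = K" if "compactin Xs K" for K
    using compactin_subset_topspace[OF that] by (force simp: tr_def Z)
  show ?thesis
  proof (intro equalityI subsetI)
    fix s assume s: "s \<in> secS (Zd 0)"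
    then obtain K where K: "compactin Xs K" "spt s \<subseteq> tr K (Zd 0)" by (rule secSE)
    then have "compactin Xs (spt s)"
      using closed_compactin[OF K(1) _ closedin_spt[OF secS_sec[OF s]]] tr0 by simp
    then show "s \<in> Gamma_c Xs E p zer" using secS_sec[OF s] by (simp add: Gamma_c_def)
  next
    fix s assume "s \<in> Gamma_c Xs E p zer"
    then show "s \<in> secS (Zd 0)" using tr0 by (auto simp: Gamma_c_def intro: secSI[of s "spt s"])
  qed
qed

end

subsection \<open>Invariant sections and the quotient space\<close>

context proper_Zd_action
begin

abbreviation Q where "Q \<equiv> quotient_space Xs d act"
abbreviation orb where "orb \<equiv> orbit d act"

lemma openin_Q: "openin Q U \<longleftrightarrow> U \<subseteq> orb ` topspace Xs \<and> openin Xs {x \<in> topspace Xs. orb x \<in> U}"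
proof -
  let ?P = "\<lambda>U. U \<subseteq> orb ` topspace Xs \<and> openin Xs {x \<in> topspace Xs. orb x \<in> U}"
  have "istopology ?P"
    unfolding istopology_def
  proof (rule conjI; intro allI impI)
    fix U V assume UV: "?P U" "?P V"
    have "{x \<in> topspace Xs. orb x \<in> U \<inter> V} = {x \<in> topspace Xs. orb x \<in> U} \<inter> {x \<in> topspace Xs. orb x \<in> V}" by blast
    then show "?P (U \<inter> V)" using UV by auto
  next
    fix \<U> assume \<U>: "\<forall>U\<in>\<U>. ?P U"
    have "{x \<in> topspace Xs. orb x \<in> \<Union> \<U>} = (\<Union>U\<in>\<U>. {x \<in> topspace Xs. orb x \<in> U})" by blast
    then show "?P (\<Union> \<U>)" using \<U> by auto
  qed
  then show ?thesis unfolding quotient_space_def by (simp add: topology_inverse')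
qed

lemma topspace_Q: "topspace Q = orb ` topspace Xs"
proof -
  have "{x \<in> topspace Xs. orb x \<in> orb ` topspace Xs} = topspace Xs" by blast
  then have "openin Q (orb ` topspace Xs)" by (simp add: openin_Q)
  then show ?thesis using openin_subset[of Q] openin_topspace[of Q] openin_Q by blast
qed

lemma orb_eq_iff:
  assumes x: "x \<in> topspace Xs" and y: "y \<in> topspace Xs"
  shows "orb y = orb x \<longleftrightarrow> (\<exists>g\<in>Zd d. y = act x g)"
proof
  assume "orb y = orb x"
  moreover have "y \<in> orb y" using y by (auto simp: orbit_def intro!: image_eqI[of _ _ vzero])
  ultimately show "\<exists>g\<in>Zd d. y = act x g" by (auto simp: orbit_def)
next
  assume "\<exists>g\<in>Zd d. y = act x g"
  then obtain g where g: "g \<in> Zd d" "y = act x g" by blast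
  have "act x h \<in> orb y" if "h \<in> Zd d" for h
  proof -
    have "act y (vadd (vneg g) h) = act x h"
      using g that x by (simp add: act_vadd vadd_assoc[symmetric])
    then show ?thesis unfolding orbit_def using g that by (intro image_eqI[of _ _ "vadd (vneg g) h"]) auto
  qed
  moreover have "act y h \<in> orb x" if "h \<in> Zd d" for h
    unfolding orbit_def using g that x by (intro image_eqI[of _ _ "vadd g h"]) (auto simp: act_vadd)
  ultimately show "orb y = orb x" unfolding orbit_def by blast
qed

lemma continuous_orb: "continuous_map Xs Q orb"
  by (auto simp: continuous_map_def openin_Q topspace_Q)

lemma orb_preimage_image:
  assumes "V \<subseteq> topspace Xs" shows "{x \<in> topspace Xs. orb x \<in> orb ` V} = tr V (Zd d)"
proof (intro equalityI subsetI)
  fix x assume x: "x \<in> {x \<in> topspace Xs. orb x \<in> orb ` V}"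
  then obtain v where "v \<in> V" "orb x = orb v" by blast
  then show "x \<in> tr V (Zd d)" using orb_eq_iff[of v x] x assms unfolding tr_def by blast
next
  fix x assume "x \<in> tr V (Zd d)"
  then obtain v g where v: "v \<in> V" "g \<in> Zd d" "x = act v g" unfolding tr_def by blast
  then have "v \<in> topspace Xs" "x \<in> topspace Xs" using assms by auto
  then show "x \<in> {x \<in> topspace Xs. orb x \<in> orb ` V}" using orb_eq_iff[of v x] v by blast
qed

lemma openin_orb_image: "openin Xs V \<Longrightarrow> openin Q (orb ` V)"
  using openin_tr[of V "Zd d"] orb_preimage_image[of V] openin_subset[of Xs V] by (simp add: openin_Q image_mono)

end

context equivariant_etale
begin

definition invariants :: "('a \<Rightarrow> 'e) set" where
  "invariants = {s \<in> \<Gamma>. \<forall>g\<in>Zd d. sact g s = s}"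

lemma invariant_spt:
  assumes s: "s \<in> invariants" and x: "x \<in> topspace Xs" and g: "g \<in> Zd d"
  shows "act x g \<in> spt s \<longleftrightarrow> x \<in> spt s"
proof -
  have sec: "s \<in> \<Gamma>" and inv: "\<And>g. g \<in> Zd d \<Longrightarrow> sact g s = s" using s by (auto simp: invariants_def)
  have *: "y \<in> spt s" if yh: "act y h \<in> spt s" and y: "y \<in> topspace Xs" and h: "h \<in> Zd d" for y h
  proof -
    obtain z where z: "z \<in> spt s" "act y h = act z h"
      using spt_sact[OF sec h] inv[OF h] yh by auto
    have "act (act y h) (vneg h) = act (act z h) (vneg h)" using z(2) by simp
    then have "y = z" using z(1) y h by (simp add: spt_iff)
    then show ?thesis using z by simp
  qed
  show ?thesis using *[of x g] *[of "act x g" "vneg g"] x g by auto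
qed

text \<open>The support of an invariant section is saturated, so the image of its complement is an
  open set disjoint from the image of the support, and it witnesses the vanishing of the
  germs.\<close>

lemma quotient_supp_eq:
  assumes s: "s \<in> invariants"
  shows "quotient_supp Xs d act zer s = orb ` spt s"
    and "closedin Q (orb ` spt s)"
proof -
  have sec: "s \<in> \<Gamma>" using s by (simp add: invariants_def)
  let ?W = "orb ` (topspace Xs - spt s)"
  have oW: "openin Q ?W"
    using closedin_spt[OF sec] by (intro openin_orb_image) (simp add: closedin_def)
  have vanish: "x \<notin> spt s" if x: "x \<in> topspace Xs" and W: "orb x \<in> ?W" for x
  proof -
    obtain y where y: "y \<in> topspace Xs" "y \<notin> spt s" "orb x = orb y" using W by blast
    then obtain g where "g \<in> Zd d" "x = act y g" using orb_eq_iff[of y x] x by blast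
    then show ?thesis using invariant_spt[OF s y(1)] y(2) by simp
  qed
  show "quotient_supp Xs d act zer s = orb ` spt s"
  proof (intro equalityI subsetI)
    fix y assume y: "y \<in> quotient_supp Xs d act zer s"
    then obtain x where x: "x \<in> topspace Xs" "y = orb x" by (auto simp: quotient_supp_def topspace_Q)
    have "x \<in> spt s"
    proof (rule ccontr)
      assume "x \<notin> spt s"
      then have "y \<in> ?W" using x by blast
      moreover have "\<forall>x\<in>topspace Xs. orb x \<in> ?W \<longrightarrow> s x = zer x"
        using vanish spt_iff by blast
      ultimately show False using y oW unfolding quotient_supp_def by blast
    qed
    then show "y \<in> orb ` spt s" using x by blast
  next
    fix y assume "y \<in> orb ` spt s"
    then obtain x where "x \<in> topspace Xs" "s x \<noteq> zer x" "y = orb x" by (auto simp: spt_iff)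
    then show "y \<in> quotient_supp Xs d act zer s" unfolding quotient_supp_def topspace_Q by blast
  qed
  have "orb ` spt s = topspace Q - ?W"
  proof (intro equalityI subsetI)
    fix y assume "y \<in> orb ` spt s"
    then obtain x where x: "x \<in> spt s" "y = orb x" by blast
    then have "x \<in> topspace Xs" by (simp add: spt_iff)
    then show "y \<in> topspace Q - ?W" unfolding topspace_Q using vanish[of x] x by blast
  qed (unfold topspace_Q, blast)
  then show "closedin Q (orb ` spt s)" using closedin_diff[OF closedin_topspace oW] by simp
qed

text \<open>A compact set of orbits lies in the image of a compact set: cover it by images of open
  sets contained in compact ones and take a finite union. Conversely, the image of the support is
  closed in the compact image of \<open>K\<close>.\<close>

lemma Gamma_c_quot_eq: "Gamma_c_quot Xs d act E p zer tau = invariants \<inter> secS (Zd d)"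
proof -
  have "compactin Q (quotient_supp Xs d act zer s) \<longleftrightarrow> s \<in> secS (Zd d)" if s: "s \<in> invariants" for s
  proof
    have sec: "s \<in> \<Gamma>" using s by (simp add: invariants_def)
    show "compactin Q (quotient_supp Xs d act zer s)" if "s \<in> secS (Zd d)"
    proof -
      obtain K where K: "compactin Xs K" "spt s \<subseteq> tr K (Zd d)" using \<open>s \<in> secS (Zd d)\<close> by (rule secSE)
      have "orb ` spt s \<subseteq> orb ` K"
      proof
        fix y assume "y \<in> orb ` spt s"
        then obtain x where x: "x \<in> spt s" "y = orb x" by blast
        then have "x \<in> {x \<in> topspace Xs. orb x \<in> orb ` K}"
          using K(2) orb_preimage_image[OF compactin_subset_topspace[OF K(1)]] by blast
        then show "y \<in> orb ` K" using x by simp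
      qed
      then show ?thesis
        unfolding quotient_supp_eq(1)[OF s]
        using closed_compactin[OF image_compactin[OF K(1) continuous_orb] _ quotient_supp_eq(2)[OF s]] by blast
    qed
    show "s \<in> secS (Zd d)" if "compactin Q (quotient_supp Xs d act zer s)"
    proof -
      have comp: "compactin Q (orb ` spt s)" using that quotient_supp_eq(1)[OF s] by simp
      define \<V> where "\<V> = {V. openin Xs V \<and> (\<exists>L. compactin Xs L \<and> V \<subseteq> L)}"
      have "orb ` spt s \<subseteq> \<Union> ((\<lambda>V. orb ` V) ` \<V>)"
      proof
        fix y assume "y \<in> orb ` spt s"
        then obtain x where x: "x \<in> topspace Xs" "y = orb x" by (auto simp: spt_iff)
        obtain U L where "openin Xs U" "compactin Xs L" "x \<in> U" "U \<subseteq> L"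
          using x(1) by (rule compact_neighbourhood)
        then show "y \<in> \<Union> ((\<lambda>V. orb ` V) ` \<V>)" using x(2) unfolding \<V>_def by blast
      qed
      moreover have "\<forall>W\<in>(\<lambda>V. orb ` V) ` \<V>. openin Q W"
        using openin_orb_image by (auto simp: \<V>_def)
      ultimately obtain \<F> where \<F>: "finite \<F>" "\<F> \<subseteq> (\<lambda>V. orb ` V) ` \<V>" "orb ` spt s \<subseteq> \<Union> \<F>"
        using comp unfolding compactin_def by meson
      obtain \<G> where \<G>: "finite \<G>" "\<G> \<subseteq> \<V>" "\<F> = (\<lambda>V. orb ` V) ` \<G>"
        using finite_subset_image[OF \<F>(1,2)] by blast
      have "\<forall>V\<in>\<G>. \<exists>L. compactin Xs L \<and> V \<subseteq> L" using \<G>(2) by (auto simp: \<V>_def)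
      then obtain L where L: "\<And>V. V \<in> \<G> \<Longrightarrow> compactin Xs (L V) \<and> V \<subseteq> L V" by metis
      have cL: "compactin Xs (\<Union> (L ` \<G>))" using L \<G>(1) by (intro compactin_Union) auto
      have "spt s \<subseteq> tr (\<Union> (L ` \<G>)) (Zd d)"
      proof
        fix x assume x: "x \<in> spt s"
        then obtain V v where v: "V \<in> \<G>" "v \<in> V" "orb x = orb v"
          using \<F>(3) unfolding \<G>(3) by blast
        then have "v \<in> \<Union> (L ` \<G>)" using L by blast
        then have "x \<in> {x \<in> topspace Xs. orb x \<in> orb ` \<Union> (L ` \<G>)}"
          using x v(3) by (simp add: spt_iff image_eqI[of "orb x" orb v])
        then show "x \<in> tr (\<Union> (L ` \<G>)) (Zd d)"
          using orb_preimage_image[OF compactin_subset_topspace[OF cL]] by simp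
      qed
      then show ?thesis by (rule secSI[OF sec cL])
    qed
  qed
  then show ?thesis by (auto simp: Gamma_c_quot_def invariants_def)
qed

section \<open>Cohomology of the compactly supported sections\<close>

abbreviation SecMod :: "nat \<Rightarrow> ('a \<Rightarrow> 'e) monoid" where
  "SecMod k \<equiv> Sec\<lparr>carrier := secS (Zd k)\<rparr>"

lemma gmodule_Mod: "k \<le> d \<Longrightarrow> gmodule (SecMod k) d sact"
  by (rule Sec.gmodule_gsub[OF gsub_secS[OF Zd_mono]])

text \<open>Mayer-Vietoris for \<open>upper k\<close> and \<open>lower k\<close>; the acting group
  remains \<open>Zd d\<close>, although the supports only involve \<open>Zd (Suc k)\<close>.\<close>

lemma Mod_shift:
  assumes soft: "soft_wrt Xs E p (Supp Xs (cZd Xs d act))" and k: "k < d" and H: "group H"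
    and rep: "cohom_rep d (SecMod (Suc k)) sact n H \<theta>"
  shows "\<exists>\<theta>'. cohom_rep d (SecMod k) sact (Suc n) H \<theta>'"
proof -
  interpret M: gmodule "SecMod (Suc k)" d sact using k by (intro gmodule_Mod) simp
  have up: "upper k \<subseteq> Zd (Suc k)" and lo: "lower k \<subseteq> Zd (Suc k)" by (auto simp: upper_def lower_def)
  have Z: "Zd (Suc k) \<subseteq> Zd d" using Zd_mono[of "Suc k" d] k by simp
  have gsub: "M.gsub (secS S)" if S: "S \<subseteq> Zd (Suc k)" for S
  proof -
    have "Sec.gsub (secS S)" "Sec.gsub (secS (Zd (Suc k)))" using S Z gsub_secS by blast+
    then show ?thesis
      unfolding M.gsub_def Sec.gsub_def using Sec.subgroup_incl secS_mono[OF S] by blast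
  qed
  have lowsub: "subgroup (secS (Zd (Suc k))) Sec" using gsub_secS[OF Z] by (simp add: Sec.gsub_def)
  have "\<exists>\<theta>'. cohom_rep d (SecMod (Suc k)\<lparr>carrier := secS (upper k) \<inter> secS (lower k)\<rparr>) sact (Suc n) H \<theta>'"
  proof (rule M.dimension_shift[OF gsub[OF up] gsub[OF lo] _ _ _ H rep])
    fix m
    show "cocycles d (SecMod (Suc k)\<lparr>carrier := secS (upper k)\<rparr>) sact m
        \<subseteq> coboundaries d (SecMod (Suc k)\<lparr>carrier := secS (upper k)\<rparr>) sact m"
      using upper_acyclic[OF k, of m] by simp
    show "cocycles d (SecMod (Suc k)\<lparr>carrier := secS (lower k)\<rparr>) sact m
        \<subseteq> coboundaries d (SecMod (Suc k)\<lparr>carrier := secS (lower k)\<rparr>) sact m"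
      using lower_acyclic[OF k, of m] by simp
  next
    fix s assume "s \<in> carrier (SecMod (Suc k))"
    then obtain u v where uv: "u \<in> secS (upper k)" "v \<in> secS (lower k)" "s = u \<otimes>\<^bsub>Sec\<^esub> inv\<^bsub>Sec\<^esub> v"
      using secS_split[OF soft k, of s] by auto
    have "inv\<^bsub>SecMod (Suc k)\<^esub> v = inv\<^bsub>Sec\<^esub> v"
      using Sec.m_inv_consistent[OF lowsub] uv(2) secS_mono[OF lo] by blast
    then show "\<exists>u\<in>secS (upper k). \<exists>v\<in>secS (lower k). s = u \<otimes>\<^bsub>SecMod (Suc k)\<^esub> inv\<^bsub>SecMod (Suc k)\<^esub> v"
      using uv by (intro bexI[of _ u] bexI[of _ v]) simp_all
  qed
  then show ?thesis by (simp add: secS_upper_Int_lower[OF k])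
qed

lemma Mod_shift_iterate:
  assumes soft: "soft_wrt Xs E p (Supp Xs (cZd Xs d act))" and H: "group H"
    and "k \<le> d" and "cohom_rep d (SecMod k) sact n H \<theta>"
  shows "\<exists>\<theta>'. cohom_rep d (SecMod 0) sact (n + k) H \<theta>'"
  using assms(3,4)
proof (induction k arbitrary: n \<theta>)
  case (Suc k)
  then obtain \<theta>' where "cohom_rep d (SecMod k) sact (Suc n) H \<theta>'"
    using Mod_shift[OF soft _ H, of k n \<theta>] by auto
  then show ?case using Suc.IH[of "Suc n" \<theta>'] Suc.prems by simp
qed auto

lemma Gamma_c_grp_eq: "Gamma_c_grp Xs E p eadd zer = SecMod 0"
  by (simp add: Gamma_c_grp_def secS_Zd_0 Sec_def)

lemma cohomology_lt:
  assumes soft: "soft_wrt Xs E p (Supp Xs (cZd Xs d act))" and n: "n < d"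
  shows "cocycles d (SecMod 0) sact n \<subseteq> coboundaries d (SecMod 0) sact n"
proof -
  let ?H = "Sec\<lparr>carrier := {\<one>\<^bsub>Sec\<^esub>}\<rparr>"
  have H: "group ?H" using Sec.subgroup_imp_group[OF Sec.triv_subgroup] .
  interpret M: gmodule "SecMod n" d sact using n by (intro gmodule_Mod) simp
  have Zup: "Zd n \<subseteq> upper n" by (auto simp: upper_def Zd_def)
  have one: "f \<in> coboundaries d (SecMod n) sact 0" if f: "f \<in> cocycles d (SecMod n) sact 0" for f
  proof -
    have fc: "f \<in> cochains d (SecMod n) 0" and inv: "sact (unit_vec n) (f []) = f []"
      using f unit_vec_Zd[OF n] by (auto simp: M.cocycles_0_iff)
    have "f [] \<in> secS (upper n)"
      using M.cochain_closed[OF fc, of "[]"] secS_mono[OF Zup] by auto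
    then have "f [] = zer"
    proof (rule shift_injective[where lev = "\<lambda>g. g n", rotated 5])
      show "upper n \<subseteq> Zd d" using Zd_mono[of "Suc n" d] n by (auto simp: upper_def)
      show "unit_vec n \<in> Zd d" by (rule unit_vec_Zd[OF n])
      show "sact (unit_vec n) (f []) = f []" by (rule inv)
    qed (auto simp: upper_def vadd_def unit_vec_def Zd_def)
    then show ?thesis using M.cochains_0_eq_one[OF fc] by (simp add: coboundaries_def)
  qed
  have "cohom_rep d (SecMod n) sact 0 ?H (\<lambda>_. \<one>\<^bsub>Sec\<^esub>)"
    unfolding cohom_rep_def
  proof (intro conjI ballI)
    show "(\<lambda>_. \<one>\<^bsub>Sec\<^esub>) ` cocycles d (SecMod n) sact 0 = carrier ?H"
      using M.one_coboundary[of 0] M.coboundaries_subset_cocycles[of 0] by auto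
    show "\<one>\<^bsub>Sec\<^esub> = \<one>\<^bsub>Sec\<^esub> \<otimes>\<^bsub>?H\<^esub> \<one>\<^bsub>Sec\<^esub>" using Sec.l_one[OF Sec.one_closed] by simp
  qed (use one in simp)
  then obtain \<theta> where "cohom_rep d (SecMod 0) sact n ?H \<theta>"
    using Mod_shift_iterate[OF soft H, of n 0] n by auto
  then show ?thesis unfolding cohom_rep_def by auto
qed

lemma cohomology_eq:
  assumes soft: "soft_wrt Xs E p (Supp Xs (cZd Xs d act))"
  shows "group_cohomology d (SecMod 0) sact d \<cong> Gamma_c_quot_grp Xs d act E p eadd zer tau"
proof -
  let ?I = "invariants \<inter> secS (Zd d)"
  let ?H = "Gamma_c_quot_grp Xs d act E p eadd zer tau"
  have H_eq: "?H = Sec\<lparr>carrier := ?I\<rparr>"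
    by (simp add: Gamma_c_quot_grp_def Gamma_c_quot_eq Sec_def)
  interpret M: gmodule "SecMod d" d sact by (intro gmodule_Mod) simp
  have sub: "subgroup (secS (Zd d)) Sec" using gsub_secS[of "Zd d"] by (simp add: Sec.gsub_def)
  have subI: "subgroup invariants Sec"
  proof (rule Sec.subgroupI)
    show "invariants \<subseteq> carrier Sec" by (auto simp: invariants_def)
    have "zer \<in> invariants" using Sec.ma_one by (simp add: invariants_def)
    then show "invariants \<noteq> {}" by blast
    fix s assume s: "s \<in> invariants"
    then show "inv\<^bsub>Sec\<^esub> s \<in> invariants"
      using Sec.ma_inv[of _ s] Sec.inv_closed[of s] by (simp add: invariants_def)
    fix s' assume "s' \<in> invariants"
    then show "s \<otimes>\<^bsub>Sec\<^esub> s' \<in> invariants"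
      using s Sec.ma_mult[of _ s s'] Sec.m_closed[of s s'] by (simp add: invariants_def)
  qed
  have H: "group ?H"
    unfolding H_eq using Sec.subgroups_Inter_pair[OF subI sub] Sec.subgroup_imp_group by blast
  \<comment> \<open>In degree 0 a cochain is its value on the empty tuple, and only the trivial
    coboundary has to be divided out.\<close>
  have "cohom_rep d (SecMod d) sact 0 ?H (\<lambda>f. f [])"
    unfolding cohom_rep_def
  proof (intro conjI ballI)
    show "(\<lambda>f. f []) ` cocycles d (SecMod d) sact 0 = carrier ?H"
    proof (intro equalityI subsetI)
      fix s assume "s \<in> (\<lambda>f. f []) ` cocycles d (SecMod d) sact 0"
      then obtain f where f: "f \<in> cocycles d (SecMod d) sact 0" "s = f []" by blast
      then have fc: "f \<in> cochains d (SecMod d) 0" by (simp add: M.cocycles_0_iff)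
      have "s \<in> secS (Zd d)" using M.cochain_closed[OF fc, of "[]"] f(2) by simp
      then show "s \<in> carrier ?H"
        using f secS_sec[of s] by (simp add: H_eq invariants_def M.cocycles_0_iff)
    next
      fix s assume "s \<in> carrier ?H"
      then have s: "s \<in> invariants" "s \<in> secS (Zd d)" by (auto simp: H_eq)
      define f where "f l = (if l = [] then s else zer)" for l :: "(nat \<Rightarrow> int) list"
      have "f \<in> cochains d (SecMod d) 0" using s(2) by (auto simp: cochains_def f_def valid_tuple_def)
      then have "f \<in> cocycles d (SecMod d) sact 0"
        using s(1) by (auto simp: M.cocycles_0_iff f_def invariants_def)
      then show "s \<in> (\<lambda>f. f []) ` cocycles d (SecMod d) sact 0"
        by (intro image_eqI[of _ _ f]) (simp_all add: f_def)
    qed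
  next
    fix f h assume "f \<in> cocycles d (SecMod d) sact 0" "h \<in> cocycles d (SecMod d) sact 0"
    show "f [] \<otimes>\<^bsub>SecMod d\<^esub> h [] = f [] \<otimes>\<^bsub>?H\<^esub> h []" by (simp add: H_eq)
  next
    fix f assume "f \<in> cocycles d (SecMod d) sact 0"
    then have fc: "f \<in> cochains d (SecMod d) 0" by (simp add: M.cocycles_0_iff)
    show "f [] = \<one>\<^bsub>?H\<^esub> \<longleftrightarrow> f \<in> coboundaries d (SecMod d) sact 0"
      using M.cochains_0_eq_one[OF fc] by (auto simp: H_eq coboundaries_def)
  qed
  then obtain \<theta> where rep: "cohom_rep d (SecMod 0) sact d ?H \<theta>"
    using Mod_shift_iterate[OF soft H, of d 0] by auto
  interpret M0: gmodule "SecMod 0" d sact by (intro gmodule_Mod) simp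
  show ?thesis by (rule M0.group_cohomology_iso[OF rep H])
qed

end

theorem theorem1p3:
  fixes Xs :: "'a topology" and d :: nat and act :: "'a \<Rightarrow> (nat \<Rightarrow> int) \<Rightarrow> 'a"
    and E :: "'e topology" and p :: "'e \<Rightarrow> 'a" and eadd :: "'e \<Rightarrow> 'e \<Rightarrow> 'e"
    and zer :: "'a \<Rightarrow> 'e" and neg :: "'e \<Rightarrow> 'e" and tau :: "'e \<Rightarrow> (nat \<Rightarrow> int) \<Rightarrow> 'e"
    and n :: nat
  assumes "Hausdorff_space Xs" and "locally_compact_space Xs"
    and "proper_action Xs d act"
    and "equivariant_sheaf Xs d act E p eadd zer neg tau"
    and "soft_wrt Xs E p (Supp Xs (cZd Xs d act))"
  shows "(n = d \<longrightarrow>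
            group_cohomology d (Gamma_c_grp Xs E p eadd zer) (sec_act Xs act tau zer) n
              \<cong> Gamma_c_quot_grp Xs d act E p eadd zer tau) \<and>
         (n \<noteq> d \<longrightarrow>
            carrier (group_cohomology d (Gamma_c_grp Xs E p eadd zer) (sec_act Xs act tau zer) n)
              = {\<one>\<^bsub>group_cohomology d (Gamma_c_grp Xs E p eadd zer) (sec_act Xs act tau zer) n\<^esub>})"
proof -
  interpret equivariant_etale Xs d act E p eadd zer neg tau
    using assms by unfold_locales
  interpret M: gmodule "SecMod 0" d sact by (intro gmodule_Mod) simp
  have "cocycles d (SecMod 0) sact n \<subseteq> coboundaries d (SecMod 0) sact n" if "n \<noteq> d"
    using that cohomology_lt[OF assms(5), of n] M.cohomological_dimension_le[of n] by linarith
  then show ?thesis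
    unfolding Gamma_c_grp_eq using cohomology_eq[OF assms(5)] M.group_cohomology_trivial[of n] by blast
qed

end
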